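(* After blocking, for any even tensor $\mathcal A$ it is always possible to obtain another even tensor $\mathcal A_{GCF}$ in graded canonical form generating the same fermionic matrix product state with antiperiodic boundary conditions. That is, for every even tensor $\mathcal A$ there are $k\ge1$ and an even tensor $\mathcal A_{GCF}$ in graded canonical form such that $\mathcal A_{GCF}$ and the blocked tensor $\mathcal A_k$ generate the same fMPS with antiperiodic boundary conditions for all $N\ge1$.
   Context: The local physical space is $\mathbb Z_2$-graded of dimension $d$ with homogeneous orthonormal basis labelled by $n$, of parity $|n|\in\{0,1\}$. An even tensor $\mathcal A$ consists of complex $D\times D$ matrices $A^n$ and a diagonal parity matrix $Z$ with entries $\pm1$ on the auxiliary space $\mathbb C^D$ such that $ZA^n=(-1)^{|n|}A^nZ$ for all $n$. The fMPS with antiperiodic boundary conditions it generates is the vector of the $N$-site chain with coefficients $c_{n_1,\dots,n_N}=\mathrm{tr}(A^{n_1}\cdots A^{n_N})$ in the product basis $|n_1,\dots,n_N\rangle$ (for fermionic modes, $(a_1^\dagger)^{n_1}\cdots(a_N^\dagger)^{n_N}|\Omega\rangle$). The blocked tensor $\mathcal A_k$ has physical index $(n_1,\dots,n_k)$ of parity $\sum_j|n_j|$ mod 2, matrices $A^{n_1}\cdots A^{n_k}$ and the same $Z$. The transfer matrix of $\mathcal A$ is $E=\sum_nA^n\otimes\overline{A^n}$. A subspace $W$ of the auxiliary space is graded if its orthogonal projector commutes with $Z$. An even tensor is a graded normal tensor (GNT) if there is no nontrivial proper graded subspace invariant under all $A^n$ and the transfer matrix has spectral radius $1$ and, counted with multiplicity,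 either exactly one (non-degenerate) or exactly two (degenerate) eigenvalues of modulus $1$, all equal to $1$. An even tensor is in graded canonical form (GCF) if $A^n=\bigoplus_{k=1}^r\mu_kA_k^n$ with $\mu_k\in\mathbb C$, the parity $Z$ has the same block structure, and each block tensor $\mathcal A_k=(A_k^n)_n$ is a GNT (in particular its transfer matrix has spectral radius one). *)

theory Defs
  imports "Jordan_Normal_Form.Spectral_Radius"
begin

text \<open>A local physical space is given by the labels of its homogeneous orthonormal basis together
  with their parities. The label set is explicit (not a type), because blocking k sites replaces
  the labels by the words of length k over them.\<close>

record 'n graded_space =
  labels :: "'n set"
  grade :: "'n \<Rightarrow> nat"

definition graded_space :: "'n graded_space \<Rightarrow> bool" where
  "graded_space H \<longleftrightarrow>
     finite (labels H) \<and> labels H \<noteq> {} \<and> (\<forall>n\<in>labels H. grade H n \<in> {0, 1})"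

text \<open>The values of \<open>amat\<close> outside the labels of the physical space are irrelevant.\<close>

record 'n tensor =
  bond :: nat
  amat :: "'n \<Rightarrow> complex mat"
  zmat :: "complex mat"

definition even_tensor :: "'n graded_space \<Rightarrow> 'n tensor \<Rightarrow> bool" where
  "even_tensor H T \<longleftrightarrow>
     1 \<le> bond T \<and>
     (\<forall>n\<in>labels H. amat T n \<in> carrier_mat (bond T) (bond T)) \<and>
     zmat T \<in> carrier_mat (bond T) (bond T) \<and>
     diagonal_mat (zmat T) \<and>
     (\<forall>i<bond T. zmat T $$ (i, i) \<in> {1, -1}) \<and>
     (\<forall>n\<in>labels H. zmat T * amat T n = (-1) ^ grade H n \<cdot>\<^sub>m (amat T n * zmat T))"

definition word_mat :: "'n tensor \<Rightarrow> 'n list \<Rightarrow> complex mat" where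
  "word_mat T w = foldr (\<lambda>n M. amat T n * M) w (1\<^sub>m (bond T))"

definition mat_trace :: "complex mat \<Rightarrow> complex" where
  "mat_trace M = (\<Sum>i<dim_row M. M $$ (i, i))"

definition words :: "'n graded_space \<Rightarrow> nat \<Rightarrow> 'n list set" where
  "words H N = {w. set w \<subseteq> labels H \<and> length w = N}"

text \<open>The vector of the N-site chain is represented by its coefficients in the product basis,
  which is indexed by \<open>words H N\<close> (and is 0 off this index set). With antiperiodic
  boundary conditions no parity matrix is inserted under the trace.\<close>

definition fMPS :: "'n graded_space \<Rightarrow> 'n tensor \<Rightarrow> nat \<Rightarrow> 'n list \<Rightarrow> complex" where
  "fMPS H T N = (\<lambda>w. if w \<in> words H N then mat_trace (word_mat T w) else 0)"

definition block_space :: "nat \<Rightarrow> 'n graded_space \<Rightarrow> 'n list graded_space" where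
  "block_space k H = \<lparr>labels = words H k, grade = (\<lambda>w. sum_list (map (grade H) w) mod 2)\<rparr>"

definition block_tensor :: "'n tensor \<Rightarrow> 'n list tensor" where
  "block_tensor T = \<lparr>bond = bond T, amat = word_mat T, zmat = zmat T\<rparr>"

definition kronecker :: "complex mat \<Rightarrow> complex mat \<Rightarrow> complex mat" where
  "kronecker A B = mat (dim_row A * dim_row B) (dim_col A * dim_col B)
     (\<lambda>(i, j). A $$ (i div dim_row B, j div dim_col B) * B $$ (i mod dim_row B, j mod dim_col B))"

definition transfer_mat :: "'n graded_space \<Rightarrow> 'n tensor \<Rightarrow> complex mat" where
  "transfer_mat H T = mat (bond T * bond T) (bond T * bond T)
     (\<lambda>(i, j). \<Sum>n\<in>labels H. kronecker (amat T n) (map_mat cnj (amat T n)) $$ (i, j))"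

abbreviation aux_subspace :: "nat \<Rightarrow> complex vec set \<Rightarrow> bool" where
  "aux_subspace D W \<equiv> VectorSpace.subspace class_ring W (module_vec TYPE(complex) D)"

definition orthogonal_projector :: "nat \<Rightarrow> complex vec set \<Rightarrow> complex mat \<Rightarrow> bool" where
  "orthogonal_projector D W P \<longleftrightarrow> P \<in> carrier_mat D D \<and>
     (\<forall>v\<in>carrier_vec D. P *\<^sub>v v \<in> W \<and> (\<forall>w\<in>W. (v - P *\<^sub>v v) \<bullet>c w = 0))"

text \<open>The orthogonal projector onto a subspace exists and is unique.\<close>

definition graded_subspace :: "'n tensor \<Rightarrow> complex vec set \<Rightarrow> bool" where
  "graded_subspace T W \<longleftrightarrow> aux_subspace (bond T) W \<and>
     (\<exists>P. orthogonal_projector (bond T) W P \<and> P * zmat T = zmat T * P)"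

definition invariant_subspace :: "'n graded_space \<Rightarrow> 'n tensor \<Rightarrow> complex vec set \<Rightarrow> bool" where
  "invariant_subspace H T W \<longleftrightarrow> (\<forall>n\<in>labels H. \<forall>w\<in>W. amat T n *\<^sub>v w \<in> W)"

definition peripheral_spectrum :: "complex mat \<Rightarrow> complex set" where
  "peripheral_spectrum E = {e \<in> spectrum E. cmod e = 1}"

text \<open>Number of eigenvalues of modulus 1, counted with algebraic multiplicity.\<close>

definition peripheral_count :: "complex mat \<Rightarrow> nat" where
  "peripheral_count E = (\<Sum>e\<in>peripheral_spectrum E. Polynomial.order e (char_poly E))"

definition GNT :: "'n graded_space \<Rightarrow> 'n tensor \<Rightarrow> bool" where
  "GNT H T \<longleftrightarrow> even_tensor H T \<and>
     (\<nexists>W. graded_subspace T W \<and> invariant_subspace H T W \<and>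
          W \<noteq> {0\<^sub>v (bond T)} \<and> W \<noteq> carrier_vec (bond T)) \<and>
     spectral_radius (transfer_mat H T) = 1 \<and>
     peripheral_count (transfer_mat H T) \<in> {1, 2} \<and>
     (\<forall>e\<in>peripheral_spectrum (transfer_mat H T). e = 1)"

text \<open>The list holds the pairs of a coefficient and a block tensor. It is automatically nonempty,
  since the bond dimension of an even tensor is positive.\<close>

definition GCF :: "'n graded_space \<Rightarrow> 'n tensor \<Rightarrow> bool" where
  "GCF H T \<longleftrightarrow> even_tensor H T \<and>
     (\<exists>bs :: (complex \<times> 'n tensor) list.
        (\<forall>(\<mu>, B)\<in>set bs. GNT H B) \<and>
        (\<forall>n\<in>labels H. amat T n = diag_block_mat (map (\<lambda>(\<mu>, B). \<mu> \<cdot>\<^sub>m amat B n) bs)) \<and>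
        zmat T = diag_block_mat (map (\<lambda>(\<mu>, B). zmat B) bs))"

end

(*
  Invariant graded subspaces split the trace of a product of matrices into the traces of a
  sub- and a quotient family, so by induction on the bond dimension one may pass to families
  which, after blocking k sites, are irreducible (together with Z) and remain so under every
  further blocking. For such a stable family A the map F |-> sum_n (A^n)^T F conj(A^n) on
  sesquilinear forms (the transpose of the transfer matrix) has, after scaling, a positive
  definite fixed form h that commutes with Z; it is found by minimising r subject to
  "image of F <= r F" over positive forms F of trace one. With respect to h an eigenform of
  modulus one that is even or odd under Z is given by a bijective intertwiner G with
  G A = lambda A G and G Z = +-Z G. Even intertwiners are scalars, because A permutes the
  eigenspaces of G and a suitable blocking fixes them; products of two odd ones are even.
  Hence the peripheral eigenvalues are +-1 and the eigenvalue 1 has multiplicity at most two,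
  and blocking once more by two removes -1.
*)
theory Submission
  imports "HOL-Analysis.Function_Topology" "HOL-Analysis.Topology_Euclidean_Space" Defs
begin

unbundle no vec_syntax

text \<open>Irreducibility alone does not exclude further roots of unity in the peripheral spectrum:
  a periodic family is irreducible, yet some of its blockings split. Hence irreducibility is
  demanded for all further blockings at once, and the decomposition terminates because each failure
  yields two families of strictly smaller bond dimension. Working with the transpose of the transfer
  matrix changes neither its characteristic polynomial nor its spectrum, and turns positivity, null
  spaces and parity into statements about forms evaluated on vectors. The multiplicity of the
  eigenvalue 1 is algebraic, so besides the dimension of the space of fixed forms the absence of
  Jordan chains is required; it follows because the iterates of the map stay bounded relative to h.
  A summand that vanishes on all words of the block length cannot be scaled to spectral radius one.
  It receives the coefficient 0 and some normal block as a placeholder; block lengths that are even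
  from the outset make such a block available.\<close>

definition subsp :: "nat \<Rightarrow> complex vec set \<Rightarrow> bool" where
  "subsp D U \<longleftrightarrow> U \<subseteq> carrier_vec D \<and> 0\<^sub>v D \<in> U \<and>
     (\<forall>u\<in>U. \<forall>v\<in>U. u + v \<in> U) \<and> (\<forall>c. \<forall>u\<in>U. c \<cdot>\<^sub>v u \<in> U)"

definition parity :: "nat \<Rightarrow> (nat \<Rightarrow> complex) \<Rightarrow> bool" where
  "parity D z \<longleftrightarrow> (\<forall>i<D. z i \<in> {1, -1})"

text \<open>The diagonal parity matrix Z is represented by the function z of its diagonal entries.\<close>

definition pact :: "(nat \<Rightarrow> complex) \<Rightarrow> complex vec \<Rightarrow> complex vec" where
  "pact z v = vec (dim_vec v) (\<lambda>i. z i * v $ i)"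

lemma subsp_carrier: "subsp D U \<Longrightarrow> u \<in> U \<Longrightarrow> u \<in> carrier_vec D"
  and subsp_zero: "subsp D U \<Longrightarrow> 0\<^sub>v D \<in> U"
  and subsp_add: "subsp D U \<Longrightarrow> u \<in> U \<Longrightarrow> v \<in> U \<Longrightarrow> u + v \<in> U"
  and subsp_smult: "subsp D U \<Longrightarrow> u \<in> U \<Longrightarrow> c \<cdot>\<^sub>v u \<in> U"
  by (auto simp: subsp_def)

lemma subsp_minus:
  assumes "subsp D U" "u \<in> U" "v \<in> U"
  shows "u - v \<in> U"
proof -
  have "u - v = u + (-1) \<cdot>\<^sub>v v"
    using assms by (intro eq_vecI) (auto dest: subsp_carrier)
  then show ?thesis using assms by (metis subsp_add subsp_smult)
qed

lemma pact_dim [simp]: "dim_vec (pact z v) = dim_vec v"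
  by (simp add: pact_def)

lemma pact_carrier [simp]: "pact z v \<in> carrier_vec D \<longleftrightarrow> v \<in> carrier_vec D"
  by (metis carrier_vecI carrier_vecD pact_dim)

lemma pact_index [simp]: "i < dim_vec v \<Longrightarrow> pact z v $ i = z i * v $ i"
  by (simp add: pact_def)

lemma pact_add: "u \<in> carrier_vec D \<Longrightarrow> v \<in> carrier_vec D \<Longrightarrow> pact z (u + v) = pact z u + pact z v"
  by (intro eq_vecI) (auto simp: algebra_simps)

lemma pact_minus: "u \<in> carrier_vec D \<Longrightarrow> v \<in> carrier_vec D \<Longrightarrow> pact z (u - v) = pact z u - pact z v"
  by (intro eq_vecI) (auto simp: algebra_simps)

lemma pact_smult: "pact z (c \<cdot>\<^sub>v u) = c \<cdot>\<^sub>v pact z u"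
  by (intro eq_vecI) (auto simp: algebra_simps)

lemma parity_sq: "parity D z \<Longrightarrow> i < D \<Longrightarrow> z i * z i = 1"
  by (auto simp: parity_def)

lemma pact_pact: "parity D z \<Longrightarrow> v \<in> carrier_vec D \<Longrightarrow> pact z (pact z v) = v"
  by (intro eq_vecI) (auto simp: mult.assoc[symmetric] parity_sq)

lemma mult_mat_entry:
  assumes "A \<in> carrier_mat m n" "B \<in> carrier_mat n p" "i < m" "j < p"
  shows "(A * B) $$ (i, j) = (\<Sum>k<n. A $$ (i, k) * B $$ (k, j))"
  using assms by (auto simp: scalar_prod_def atLeast0LessThan intro!: sum.cong)

lemma mult_vec_entry:
  assumes "A \<in> carrier_mat m n" "v \<in> carrier_vec n" "i < m"
  shows "(A *\<^sub>v v) $ i = (\<Sum>k<n. A $$ (i, k) * v $ k)"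
  using assms by (auto simp: scalar_prod_def atLeast0LessThan intro!: sum.cong)

text \<open>The entry condition is Z A = s A Z read coordinatewise. Source and target carry separate
  parities \<open>z\<close> and \<open>y\<close>, because the rectangular factors of a splitting are
  treated in the same way.\<close>

lemma graded_mat_vec:
  assumes A: "A \<in> carrier_mat m n"
    and gr: "\<And>i j. i < m \<Longrightarrow> j < n \<Longrightarrow> y i * A $$ (i, j) = s * (A $$ (i, j) * z j)"
    and v: "v \<in> carrier_vec n"
  shows "pact y (A *\<^sub>v v) = s \<cdot>\<^sub>v (A *\<^sub>v pact z v)"
proof (intro eq_vecI)
  fix i assume "i < dim_vec (s \<cdot>\<^sub>v (A *\<^sub>v pact z v))"
  then have i: "i < m" using A by simp
  have "pact y (A *\<^sub>v v) $ i = y i * (A *\<^sub>v v) $ i" using i A by simp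
  also have "\<dots> = (\<Sum>k<n. y i * A $$ (i, k) * v $ k)"
    using mult_vec_entry[OF A v i] by (simp add: sum_distrib_left mult.assoc)
  also have "\<dots> = (\<Sum>k<n. s * (A $$ (i, k) * pact z v $ k))"
    using v i by (intro sum.cong) (auto simp: gr)
  also have "\<dots> = s * (A *\<^sub>v pact z v) $ i"
    using A v i by (subst mult_vec_entry[where m=m and n=n]) (auto simp: sum_distrib_left)
  finally show "pact y (A *\<^sub>v v) $ i = (s \<cdot>\<^sub>v (A *\<^sub>v pact z v)) $ i"
    using i A by simp
qed (use A in simp)

lemma graded_mat_vec_conv:
  assumes A: "A \<in> carrier_mat m n"
    and gr: "\<And>v. v \<in> carrier_vec n \<Longrightarrow> pact y (A *\<^sub>v v) = s \<cdot>\<^sub>v (A *\<^sub>v pact z v)"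
    and ij: "i < m" "j < n"
  shows "y i * A $$ (i, j) = s * (A $$ (i, j) * z j)"
proof -
  have p: "pact z (unit_vec n j) = z j \<cdot>\<^sub>v unit_vec n j"
    by (intro eq_vecI) (auto simp: unit_vec_def)
  have e: "(A *\<^sub>v unit_vec n j) $ i = A $$ (i, j)"
    using A ij by simp
  have "y i * A $$ (i, j) = pact y (A *\<^sub>v unit_vec n j) $ i"
    using A ij e by simp
  also have "\<dots> = s * (z j * (A *\<^sub>v unit_vec n j) $ i)"
    unfolding gr[OF unit_vec_carrier] p mult_mat_vec[OF A unit_vec_carrier] using A ij by simp
  finally show ?thesis unfolding e by (simp only: mult.commute)
qed

section \<open>Homogeneous complements and splittings\<close>

text \<open>Starting from P = 0, homogeneous rank one operators are added as long as P does not fix the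
  subspace; each of them makes one more row of 1 - P vanish.\<close>

lemma homogeneous_projection:
  assumes z: "parity D z" and U: "subsp D U" and Uz: "\<And>u. u \<in> U \<Longrightarrow> pact z u \<in> U"
  shows "\<exists>P\<in>carrier_mat D D. (\<forall>v\<in>carrier_vec D. P *\<^sub>v v \<in> U \<and> pact z (P *\<^sub>v v) = P *\<^sub>v pact z v) \<and>
     (\<forall>u\<in>U. P *\<^sub>v u = u)"
proof -
  define N where "N P = {i. i < D \<and> (\<exists>v\<in>carrier_vec D. (v - P *\<^sub>v v) $ i \<noteq> 0)}" for P :: "complex mat"
  define good where "good P \<longleftrightarrow> P \<in> carrier_mat D D \<and>
    (\<forall>v\<in>carrier_vec D. P *\<^sub>v v \<in> U \<and> pact z (P *\<^sub>v v) = P *\<^sub>v pact z v \<and> P *\<^sub>v (P *\<^sub>v v) = P *\<^sub>v v)" for P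
  have step: "\<exists>P'. good P' \<and> card (N P') < card (N P)"
    if P: "good P" and u: "u \<in> U" "P *\<^sub>v u \<noteq> u" for P u
  proof -
    have Pc: "P \<in> carrier_mat D D" using P by (simp add: good_def)
    have PU: "P *\<^sub>v v \<in> U" and Pz: "pact z (P *\<^sub>v v) = P *\<^sub>v pact z v" and PP: "P *\<^sub>v (P *\<^sub>v v) = P *\<^sub>v v"
      if "v \<in> carrier_vec D" for v using P that by (auto simp: good_def)
    have uc: "u \<in> carrier_vec D" using U u subsp_carrier by blast
    \<comment> \<open>\<open>y 1\<close> and \<open>y (-1)\<close> are twice the even and the odd
      part of u. If P fixed both of them, it would fix u.\<close>
    define y where "y s = u + s \<cdot>\<^sub>v pact z u" for s
    have yU: "y s \<in> U" for s unfolding y_def using U u Uz by (metis subsp_add subsp_smult)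
    have yc: "y s \<in> carrier_vec D" for s using U yU subsp_carrier by blast
    have yz: "pact z (y s) = s \<cdot>\<^sub>v y s" if "s \<in> {1, -1}" for s
    proof (intro eq_vecI)
      fix i assume "i < dim_vec (s \<cdot>\<^sub>v y s)"
      then have "i < D" using yc[of s] by auto
      moreover from this have "z i \<in> {1, -1}" using z by (simp add: parity_def)
      ultimately show "pact z (y s) $ i = (s \<cdot>\<^sub>v y s) $ i"
        using uc that unfolding y_def by auto
    qed (use yc[of s] in simp)
    have "P *\<^sub>v y 1 \<noteq> y 1 \<or> P *\<^sub>v y (-1) \<noteq> y (-1)"
    proof (rule ccontr)
      assume n: "\<not> ?thesis"
      have u': "u = (1/2) \<cdot>\<^sub>v (y 1 + y (-1))" using uc
        unfolding y_def by (intro eq_vecI) auto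
      have "P *\<^sub>v u = (1/2) \<cdot>\<^sub>v (P *\<^sub>v y 1 + P *\<^sub>v y (-1))"
        unfolding mult_add_distrib_mat_vec[OF Pc yc yc, symmetric] mult_mat_vec[OF Pc add_carrier_vec[OF yc yc], symmetric]
        u'[symmetric] ..
      with n u' u show False by simp
    qed
    then obtain s where s: "s \<in> {1, -1}" and Py: "P *\<^sub>v y s \<noteq> y s" by auto
    \<comment> \<open>A homogeneous vector of U that is killed by P: the direction by which the
      range of P is enlarged.\<close>
    define x where "x = y s - P *\<^sub>v y s"
    have xU: "x \<in> U" unfolding x_def using U yU yc PU by (metis subsp_minus)
    have xc: "x \<in> carrier_vec D" using U xU subsp_carrier by blast
    have xz: "pact z x = s \<cdot>\<^sub>v x"
    proof -
      have "pact z x = s \<cdot>\<^sub>v y s - P *\<^sub>v (s \<cdot>\<^sub>v y s)"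
        unfolding x_def using yc[of s] Pc by (simp add: pact_minus[where D=D] Pz yz[OF s])
      also have "\<dots> = s \<cdot>\<^sub>v x" unfolding x_def using yc[of s] Pc
        by (simp add: mult_mat_vec[OF Pc], intro eq_vecI) (auto simp: algebra_simps)
      finally show ?thesis .
    qed
    have Px: "P *\<^sub>v x = 0\<^sub>v D"
      unfolding x_def using yc[of s] Pc PP[of "y s"] by (simp add: mult_minus_distrib_mat_vec[OF Pc])
    have "x \<noteq> 0\<^sub>v D"
    proof
      assume "x = 0\<^sub>v D"
      have "y s = P *\<^sub>v y s"
      proof (intro eq_vecI)
        fix i assume "i < dim_vec (P *\<^sub>v y s)"
        then have "x $ i = 0" "i < D" using Pc \<open>x = 0\<^sub>v D\<close> by auto
        then show "y s $ i = (P *\<^sub>v y s) $ i" using Pc yc[of s] unfolding x_def by auto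
      qed (use yc[of s] Pc in auto)
      with Py show False by simp
    qed
    then obtain i where i: "i < D" "x $ i \<noteq> 0"
      using xc by (metis eq_vecI index_zero_vec carrier_vecD)
    \<comment> \<open>The coordinate i at which x does not vanish has the parity of x, so the
      functional \<open>c\<close> below is homogeneous and the rank one term commutes with
      Z.\<close>
    have zi: "z i = s" using arg_cong[OF xz, of "\<lambda>v. v $ i"] i xc by auto
    \<comment> \<open>Since P x = 0, this is normalised by \<open>c x = 1\<close>. Adding
      \<open>c v\<close> times x to P v makes row i of 1 - P' vanish.\<close>
    define c where "c v = (v - P *\<^sub>v v) $ i / x $ i" for v
    define P' where "P' = P + mat D D (\<lambda>(a, b). x $ a * ((1\<^sub>m D - P) $$ (i, b) / x $ i))"
    have P'c: "P' \<in> carrier_mat D D" unfolding P'_def using Pc by auto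
    have act: "P' *\<^sub>v v = P *\<^sub>v v + c v \<cdot>\<^sub>v x" if v: "v \<in> carrier_vec D" for v
    proof (intro eq_vecI)
      fix a assume "a < dim_vec (P *\<^sub>v v + c v \<cdot>\<^sub>v x)"
      then have a: "a < D" using xc by simp
      have d: "(\<Sum>k<D. (1\<^sub>m D - P) $$ (i, k) * v $ k) = (v - P *\<^sub>v v) $ i"
      proof -
        have "(\<Sum>k<D. (1\<^sub>m D - P) $$ (i, k) * v $ k) = ((1\<^sub>m D - P) *\<^sub>v v) $ i"
          by (rule mult_vec_entry[symmetric, of _ D]) (use Pc v i in auto)
        also have "(1\<^sub>m D - P) *\<^sub>v v = v - P *\<^sub>v v"
          using v Pc by (subst minus_mult_distrib_mat_vec[where nr=D and nc=D]) auto
        finally show ?thesis .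
      qed
      have "(P' *\<^sub>v v) $ a = (\<Sum>k<D. P $$ (a, k) * v $ k + x $ a / x $ i * ((1\<^sub>m D - P) $$ (i, k) * v $ k))"
        using a i Pc v P'c by (subst mult_vec_entry[where m=D and n=D])
          (auto simp: P'_def algebra_simps diff_divide_distrib intro!: sum.cong)
      also have "\<dots> = (P *\<^sub>v v) $ a + x $ a / x $ i * (v - P *\<^sub>v v) $ i"
        unfolding sum.distrib d[symmetric] sum_distrib_left mult_vec_entry[OF Pc v a] ..
      finally show "(P' *\<^sub>v v) $ a = (P *\<^sub>v v + c v \<cdot>\<^sub>v x) $ a"
        using a xc Pc by (simp add: c_def)
    qed (use P'c xc in auto)
    have cP: "c (P *\<^sub>v v) = 0" if "v \<in> carrier_vec D" for v
      unfolding c_def PP[OF that] using Pc i that by simp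
    have P'U: "P' *\<^sub>v v \<in> U" if "v \<in> carrier_vec D" for v
      unfolding act[OF that] using U xU PU[OF that] by (metis subsp_add subsp_smult)
    have P'z: "pact z (P' *\<^sub>v v) = P' *\<^sub>v pact z v" if v: "v \<in> carrier_vec D" for v
    proof -
      have "c (pact z v) = s * c v"
        unfolding c_def using v Pc i Pz[OF v, symmetric] by (simp add: zi algebra_simps)
      then show ?thesis using v Pc xc
        by (simp add: act pact_add[where D=D] Pz pact_smult xz smult_smult_assoc mult.commute)
    qed
    have P'P': "P' *\<^sub>v (P' *\<^sub>v v) = P' *\<^sub>v v" if v: "v \<in> carrier_vec D" for v
    proof -
      have w: "P' *\<^sub>v v \<in> carrier_vec D" using P'c v by simp
      have PPv: "P *\<^sub>v (P' *\<^sub>v v) = P *\<^sub>v v"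
        unfolding act[OF v] using v Pc xc
        by (simp add: mult_add_distrib_mat_vec[OF Pc] PP mult_mat_vec[OF Pc] Px) (auto intro!: eq_vecI)
      have "c (P' *\<^sub>v v) = c v"
        unfolding c_def PPv using v Pc xc i by (simp add: act c_def)
      then show ?thesis unfolding act[OF w] PPv by (simp add: act[OF v])
    qed
    have "good P'" using P'c P'U P'z P'P' by (simp add: good_def)
    moreover have "N P' \<subset> N P"
    proof
      show "N P' \<subseteq> N P"
      proof
        fix a assume "a \<in> N P'"
        then obtain v where a: "a < D" and v: "v \<in> carrier_vec D" and ne: "(v - P' *\<^sub>v v) $ a \<noteq> 0"
          by (auto simp: N_def)
        \<comment> \<open>As x = x - P x, a vanishing row of 1 - P also annihilates x, and adding a
          multiple of x to P v leaves that row zero.\<close>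
        show "a \<in> N P"
        proof (rule ccontr)
          assume "a \<notin> N P"
          then have z0: "(w - P *\<^sub>v w) $ a = 0" if "w \<in> carrier_vec D" for w
            using a that by (auto simp: N_def)
          have "x $ a = 0" using z0[OF xc] Px xc a by simp
          then show False using ne z0[OF v] a v Pc xc by (simp add: act)
        qed
      qed
      have "i \<in> N P"
        using i xc Px by (auto simp: N_def intro!: bexI[of _ x])
      moreover have "i \<notin> N P'"
      proof
        assume "i \<in> N P'"
        then obtain v where v: "v \<in> carrier_vec D" and "(v - P' *\<^sub>v v) $ i \<noteq> 0" by (auto simp: N_def)
        then show False using i Pc xc by (simp add: act c_def)
      qed
      ultimately show "N P' \<noteq> N P" by blast
    qed
    then have "card (N P') < card (N P)" by (intro psubset_card_mono) (auto simp: N_def)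
    ultimately show ?thesis by blast
  qed
  have "good (0\<^sub>m D D)"
  proof -
    have "0\<^sub>m D D *\<^sub>v v = 0\<^sub>v D" if "v \<in> carrier_vec D" for v :: "complex vec"
      using that by (intro eq_vecI) auto
    moreover have "pact z (0\<^sub>v D) = 0\<^sub>v D" by (intro eq_vecI) auto
    ultimately show ?thesis by (simp add: good_def subsp_zero[OF U])
  qed
  from ex_has_least_nat[of good, OF this, of "\<lambda>P. card (N P)"]
  obtain P where P: "good P" and min: "\<And>P'. good P' \<Longrightarrow> card (N P) \<le> card (N P')"
    by blast
  have "P *\<^sub>v u = u" if u: "u \<in> U" for u
  proof (rule ccontr)
    assume "P *\<^sub>v u \<noteq> u"
    from step[OF P u this] min show False by (meson not_le)
  qed
  with P show ?thesis by (auto simp: good_def)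
qed

text \<open>The idempotent P factors through the space of dimension d on which the parity is given by y.\<close>

definition splits :: "nat \<Rightarrow> (nat \<Rightarrow> complex) \<Rightarrow> complex mat \<Rightarrow> nat \<Rightarrow> complex mat \<Rightarrow> complex mat \<Rightarrow>
    (nat \<Rightarrow> complex) \<Rightarrow> bool" where
  "splits D z P d R L y \<longleftrightarrow> R \<in> carrier_mat D d \<and> L \<in> carrier_mat d D \<and> L * R = 1\<^sub>m d \<and> R * L = P \<and>
    parity d y \<and> (\<forall>i<D. \<forall>j<d. z i * R $$ (i, j) = R $$ (i, j) * y j) \<and>
    (\<forall>j<d. \<forall>i<D. y j * L $$ (j, i) = L $$ (j, i) * z i)"

text \<open>Subtracting a homogeneous rank one idempotent from P makes one more column vanish.\<close>

lemma homogeneous_splitting: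
  assumes "parity D z" "P \<in> carrier_mat D D" "P * P = P"
    "\<And>i j. i < D \<Longrightarrow> j < D \<Longrightarrow> z i * P $$ (i, j) = P $$ (i, j) * z j"
  shows "\<exists>d R L y. splits D z P d R L y"
  using assms
proof (induction "card {j. j < D \<and> (\<exists>i<D. P $$ (i, j) \<noteq> 0)}" arbitrary: P rule: less_induct)
  case less
  note z = less.prems(1) and P = less.prems(2) and PP = less.prems(3) and Pz = less.prems(4)
  show ?case
  proof (cases "\<exists>i<D. \<exists>j<D. P $$ (i, j) \<noteq> 0")
    case False
    have "P = 0\<^sub>m D D" by (rule eq_matI) (use P False in auto)
    then have "splits D z P 0 (0\<^sub>m D 0) (0\<^sub>m 0 D) z"
      by (auto simp: splits_def parity_def intro!: eq_matI)
    then show ?thesis by blast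
  next
    case True
    then obtain i j where i: "i < D" and j: "j < D" and p: "P $$ (i, j) \<noteq> 0" by blast
    define p where "p = P $$ (i, j)"
    have p0: "p \<noteq> 0" using p by (simp add: p_def)
    \<comment> \<open>\<open>r\<close> is column j of P and \<open>l\<close> is row i divided by the
      pivot p, so P P = P gives P r = r, l P = l and l r = 1.\<close>
    define r where "r = mat D 1 (\<lambda>(a, _). P $$ (a, j))"
    define l where "l = mat 1 D (\<lambda>(_, b). P $$ (i, b) / p)"
    have rc: "r \<in> carrier_mat D 1" and lc: "l \<in> carrier_mat 1 D" by (auto simp: r_def l_def)
    have PPe: "(\<Sum>k<D. P $$ (a, k) * P $$ (k, b)) = P $$ (a, b)" if "a < D" "b < D" for a b
      using mult_mat_entry[OF P P that] PP by simp
    have Pr: "P * r = r"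
    proof (rule eq_matI)
      fix a b assume ab: "a < dim_row r" "b < dim_col r"
      then have "(P * r) $$ (a, b) = (\<Sum>k<D. P $$ (a, k) * r $$ (k, b))"
        using mult_mat_entry[OF P rc] rc by auto
      also have "\<dots> = P $$ (a, j)" using ab rc PPe[of a j] j by (auto simp: r_def)
      finally show "(P * r) $$ (a, b) = r $$ (a, b)" using ab rc by (simp add: r_def)
    qed (use P rc in auto)
    have lP: "l * P = l"
    proof (rule eq_matI)
      fix a b assume ab: "a < dim_row l" "b < dim_col l"
      then have "(l * P) $$ (a, b) = (\<Sum>k<D. l $$ (a, k) * P $$ (k, b))"
        using mult_mat_entry[OF lc P] lc by auto
      also have "\<dots> = P $$ (i, b) / p" using ab lc PPe[of i b] i
        by (auto simp: l_def sum_divide_distrib[symmetric])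
      finally show "(l * P) $$ (a, b) = l $$ (a, b)" using ab lc by (simp add: l_def)
    qed (use P lc in auto)
    have lr: "l * r = 1\<^sub>m 1"
    proof (rule eq_matI)
      fix a b :: nat assume ab: "a < dim_row (1\<^sub>m 1)" "b < dim_col (1\<^sub>m 1)"
      then have "(l * r) $$ (a, b) = (\<Sum>k<D. l $$ (a, k) * r $$ (k, b))"
        using mult_mat_entry[OF lc rc] by auto
      also have "\<dots> = 1" using ab PPe[of i j] i j p0
        by (auto simp: l_def r_def sum_divide_distrib[symmetric] p_def)
      finally show "(l * r) $$ (a, b) = 1\<^sub>m 1 $$ (a, b)" using ab by simp
    qed (use rc lc in auto)
    define Q where "Q = r * l"
    have Qc: "Q \<in> carrier_mat D D" unfolding Q_def using rc lc by auto
    have Qe: "Q $$ (a, b) = P $$ (a, j) * P $$ (i, b) / p" if "a < D" "b < D" for a b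
      unfolding Q_def using that by (subst mult_mat_entry[OF rc lc]) (auto simp: r_def l_def)
    have PQ: "P * Q = Q" unfolding Q_def using Pr assoc_mult_mat[OF P rc lc] by simp
    have QP: "Q * P = Q" unfolding Q_def using lP assoc_mult_mat[OF rc lc P] by simp
    have Qr: "Q * r = r" unfolding Q_def using lr assoc_mult_mat[OF rc lc rc] rc by simp
    have lQ: "l * Q = l" unfolding Q_def using lr assoc_mult_mat[OF lc rc lc] lc by simp
    have QQ: "Q * Q = Q" using lQ assoc_mult_mat[OF rc lc Qc] unfolding Q_def by simp
    \<comment> \<open>P Q = Q P = Q Q = Q makes the difference idempotent. Its column j is zero, and
      columns of P that vanish stay zero because their entry in row i vanishes.\<close>
    define P' where "P' = P - Q"
    have P'c: "P' \<in> carrier_mat D D" unfolding P'_def using P Qc by auto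
    have PmQ: "P * (P - Q) = P - Q" using PP PQ mult_minus_distrib_mat[OF P P Qc] by simp
    have QmQ: "Q * (P - Q) = 0\<^sub>m D D" using QQ QP mult_minus_distrib_mat[OF Qc P Qc] Qc by simp
    have P'P': "P' * P' = P'"
      unfolding P'_def using minus_mult_distrib_mat[OF P Qc P'c[unfolded P'_def]] P Qc unfolding PmQ QmQ
      by (auto intro!: eq_matI)
    have P'z: "z a * P' $$ (a, b) = P' $$ (a, b) * z b" if ab: "a < D" "b < D" for a b
    proof -
      have "P $$ (i, b) \<noteq> 0 \<Longrightarrow> z i = z b" using Pz[OF i ab(2)] by simp
      moreover have "z i = z j" using Pz[OF i j] p0 by (simp add: p_def)
      ultimately have "z a * Q $$ (a, b) = Q $$ (a, b) * z b"
        unfolding Qe[OF ab] using Pz[OF ab(1) j] by (cases "P $$ (i, b) = 0") (auto simp: mult.assoc[symmetric])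
      then show ?thesis using ab P Qc Pz[OF ab] by (auto simp: P'_def)
    qed
    have "{b. b < D \<and> (\<exists>a<D. P' $$ (a, b) \<noteq> 0)} \<subset> {b. b < D \<and> (\<exists>a<D. P $$ (a, b) \<noteq> 0)}"
    proof
      show "{b. b < D \<and> (\<exists>a<D. P' $$ (a, b) \<noteq> 0)} \<subseteq> {b. b < D \<and> (\<exists>a<D. P $$ (a, b) \<noteq> 0)}"
      proof (clarify)
        fix b a assume "b < D" "a < D" "P' $$ (a, b) \<noteq> 0"
        then show "\<exists>a<D. P $$ (a, b) \<noteq> 0" using P Qc i
          by (cases "P $$ (i, b) = 0") (auto simp: P'_def Qe)
      qed
      have "j \<notin> {b. b < D \<and> (\<exists>a<D. P' $$ (a, b) \<noteq> 0)}"
        using P Qc p0 j by (auto simp: P'_def Qe p_def)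
      moreover have "j \<in> {b. b < D \<and> (\<exists>a<D. P $$ (a, b) \<noteq> 0)}" using p i j by auto
      ultimately show "{b. b < D \<and> (\<exists>a<D. P' $$ (a, b) \<noteq> 0)} \<noteq> {b. b < D \<and> (\<exists>a<D. P $$ (a, b) \<noteq> 0)}" by blast
    qed
    then have "card {b. b < D \<and> (\<exists>a<D. P' $$ (a, b) \<noteq> 0)} < card {b. b < D \<and> (\<exists>a<D. P $$ (a, b) \<noteq> 0)}"
      by (intro psubset_card_mono) auto
    from less.hyps[OF this z P'c P'P' P'z] obtain d R L y where spl: "splits D z P' d R L y" by blast
    have R: "R \<in> carrier_mat D d" and L: "L \<in> carrier_mat d D" and LR: "L * R = 1\<^sub>m d" and RL: "R * L = P'"
      and y: "parity d y" using spl by (simp_all add: splits_def)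
    have Rz: "z a * R $$ (a, b) = R $$ (a, b) * y b" if "a < D" "b < d" for a b
      using spl that by (simp add: splits_def)
    have Lz: "y a * L $$ (a, b) = L $$ (a, b) * z b" if "a < d" "b < D" for a b
      using spl that by (simp add: splits_def)
    have P'R: "P' * R = R" using assoc_mult_mat[OF R L R] LR RL R by simp
    have LP': "L * P' = L" using assoc_mult_mat[OF L R L] LR RL L by simp
    have P'r: "P' * r = 0\<^sub>m D 1"
      unfolding P'_def using minus_mult_distrib_mat[OF P Qc rc] Pr Qr rc by simp
    have lP': "l * P' = 0\<^sub>m 1 D"
      unfolding P'_def using mult_minus_distrib_mat[OF lc P Qc] lP lQ lc by simp
    have Lr: "L * r = 0\<^sub>m d 1"
      using assoc_mult_mat[OF L P'c rc] LP' P'r L by simp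
    have lR: "l * R = 0\<^sub>m 1 d"
      using assoc_mult_mat[OF lc P'c R] lP' P'R R by simp
    \<comment> \<open>P = P' + r l, so \<open>r\<close> is appended to R as a column and
      \<open>l\<close> to L as a row; the mixed products L r and l R vanish. The new coordinate has
      parity z j, which equals z i because the pivot is nonzero.\<close>
    define R1 where "R1 = mat D (Suc d) (\<lambda>(a, b). if b = d then r $$ (a, 0) else R $$ (a, b))"
    define L1 where "L1 = mat (Suc d) D (\<lambda>(a, b). if a = d then l $$ (0, b) else L $$ (a, b))"
    define y1 where "y1 = y(d := z j)"
    have R1c: "R1 \<in> carrier_mat D (Suc d)" and L1c: "L1 \<in> carrier_mat (Suc d) D"
      by (auto simp: R1_def L1_def)
    have f1: "L1 * R1 = 1\<^sub>m (Suc d)"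
    proof (rule eq_matI)
      fix a b assume "a < dim_row (1\<^sub>m (Suc d))" "b < dim_col (1\<^sub>m (Suc d))"
      then have ab: "a < Suc d" "b < Suc d" by auto
      have e: "(L1 * R1) $$ (a, b) = (\<Sum>k<D. L1 $$ (a, k) * R1 $$ (k, b))"
        using mult_mat_entry[OF L1c R1c ab] .
      consider "a < d" "b < d" | "a < d" "b = d" | "a = d" "b < d" | "a = d" "b = d" using ab by linarith
      then show "(L1 * R1) $$ (a, b) = 1\<^sub>m (Suc d) $$ (a, b)"
      proof cases
        case 1
        then show ?thesis using e LR mult_mat_entry[OF L R, of a b] by (simp add: L1_def R1_def)
      next
        case 2
        then show ?thesis using e Lr mult_mat_entry[OF L rc, of a 0] by (simp add: L1_def R1_def)
      next
        case 3
        then show ?thesis using e lR mult_mat_entry[OF lc R, of 0 b] by (simp add: L1_def R1_def)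
      next
        case 4
        then show ?thesis using e lr mult_mat_entry[OF lc rc, of 0 0] by (simp add: L1_def R1_def)
      qed
    qed (use L1c R1c in auto)
    have f2: "R1 * L1 = P"
    proof (rule eq_matI)
      fix a b assume "a < dim_row P" "b < dim_col P"
      then have ab: "a < D" "b < D" using P by auto
      have "(R1 * L1) $$ (a, b) = (\<Sum>k<d. R1 $$ (a, k) * L1 $$ (k, b)) + R1 $$ (a, d) * L1 $$ (d, b)"
        using mult_mat_entry[OF R1c L1c ab] by simp
      also have "\<dots> = (R * L) $$ (a, b) + (r * l) $$ (a, b)"
        using ab by (subst mult_mat_entry[OF R L ab], subst mult_mat_entry[OF rc lc ab]) (simp add: R1_def L1_def)
      also have "\<dots> = P $$ (a, b)" using ab P Qc unfolding RL Q_def[symmetric] P'_def by simp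
      finally show "(R1 * L1) $$ (a, b) = P $$ (a, b)" .
    qed (use L1c R1c P in auto)
    have f3: "parity (Suc d) y1" using y z j by (auto simp: parity_def y1_def less_Suc_eq)
    have f4: "z a * R1 $$ (a, b) = R1 $$ (a, b) * y1 b" if "a < D" "b < Suc d" for a b
      using that Rz[of a b] Pz[of a j] j by (auto simp: R1_def y1_def r_def)
    have f5: "y1 a * L1 $$ (a, b) = L1 $$ (a, b) * z b" if "a < Suc d" "b < D" for a b
    proof -
      have "z i = z j" using Pz[OF i j] p0 by (simp add: p_def)
      then show ?thesis
        using that Lz[of a b] Pz[of i b] i by (auto simp: L1_def y1_def l_def)
    qed
    have "splits D z P (Suc d) R1 L1 y1"
      unfolding splits_def using R1c L1c f1 f2 f3 f4 f5 by blast
    then show ?thesis by blast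
  qed
qed

section \<open>Decomposition into stable families\<close>

definition lwords :: "'n graded_space \<Rightarrow> nat \<Rightarrow> 'n list set" where
  "lwords H k = {w. set w \<subseteq> labels H \<and> k dvd length w}"

definition word_parity :: "'n graded_space \<Rightarrow> 'n list \<Rightarrow> nat" where
  "word_parity H w = sum_list (map (grade H) w)"

text \<open>A graded representation of the monoid \<open>lwords H k\<close>. It is not given by
  matrices of single letters: a compression to a subspace that is invariant only after blocking is
  multiplicative only on the blocked words.\<close>

definition word_family ::
  "'n graded_space \<Rightarrow> nat \<Rightarrow> nat \<Rightarrow> (nat \<Rightarrow> complex) \<Rightarrow> ('n list \<Rightarrow> complex mat) \<Rightarrow> bool" where
  "word_family H k d z M \<longleftrightarrow> parity d z \<and> M [] = 1\<^sub>m d \<and>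
     (\<forall>w\<in>lwords H k. M w \<in> carrier_mat d d \<and>
       (\<forall>i<d. \<forall>j<d. z i * M w $$ (i, j) = (-1) ^ word_parity H w * (M w $$ (i, j) * z j))) \<and>
     (\<forall>v\<in>lwords H k. \<forall>w\<in>lwords H k. M (v @ w) = M v * M w)"

text \<open>Irreducibility under the words of length m for every multiple m of k, i.e. under every
  further blocking.\<close>

definition stable_words ::
  "'n graded_space \<Rightarrow> nat \<Rightarrow> nat \<Rightarrow> (nat \<Rightarrow> complex) \<Rightarrow> ('n list \<Rightarrow> complex mat) \<Rightarrow> bool" where
  "stable_words H k d z M \<longleftrightarrow> (\<forall>m\<ge>1. k dvd m \<longrightarrow>
     (\<forall>U. subsp d U \<and> (\<forall>u\<in>U. pact z u \<in> U) \<and> (\<forall>w\<in>words H m. \<forall>u\<in>U. M w *\<^sub>v u \<in> U) \<longrightarrow>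
        U = {0\<^sub>v d} \<or> U = carrier_vec d))"

lemma lwords_mono: "k dvd m \<Longrightarrow> lwords H m \<subseteq> lwords H k"
  by (auto simp: lwords_def)

lemma lwords_append: "v \<in> lwords H k \<Longrightarrow> w \<in> lwords H k \<Longrightarrow> v @ w \<in> lwords H k"
  by (auto simp: lwords_def)

lemma word_family_mono: "word_family H k d z M \<Longrightarrow> k dvd m \<Longrightarrow> word_family H m d z M"
  using lwords_mono[of k m H] unfolding word_family_def by (meson subsetD)

lemma stable_words_mono: "stable_words H k d z M \<Longrightarrow> k dvd m \<Longrightarrow> stable_words H m d z M"
  unfolding stable_words_def by (simp add: dvd_trans[of k m])

section \<open>Traces, invariant subspaces and compressions of word families\<close>

lemma mat_trace_comm:
  assumes "A \<in> carrier_mat m n" "B \<in> carrier_mat n m"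
  shows "mat_trace (A * B) = mat_trace (B * A)"
proof -
  have "mat_trace (A * B) = (\<Sum>i<m. \<Sum>k<n. A $$ (i, k) * B $$ (k, i))"
    unfolding mat_trace_def using assms mult_mat_entry[OF assms] by (auto intro!: sum.cong simp del: index_mult_mat(1))
  also have "\<dots> = (\<Sum>k<n. \<Sum>i<m. B $$ (k, i) * A $$ (i, k))"
    by (subst sum.swap) (simp add: mult.commute)
  also have "\<dots> = mat_trace (B * A)"
    unfolding mat_trace_def using assms mult_mat_entry[OF assms(2,1)]
    by (auto intro!: sum.cong simp del: index_mult_mat(1))
  finally show ?thesis .
qed

lemma mat_trace_add:
  assumes "A \<in> carrier_mat n n" "B \<in> carrier_mat n n"
  shows "mat_trace (A + B) = mat_trace A + mat_trace B"
  using assms by (simp add: mat_trace_def sum.distrib)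

lemma mat_trace_one: "mat_trace (1\<^sub>m n) = of_nat n"
  by (simp add: mat_trace_def)

lemma invariant_lwords:
  assumes M: "word_family H k d z M" and km: "k dvd m" "m \<ge> 1" and U: "subsp d U"
    and inv: "\<And>w u. w \<in> words H m \<Longrightarrow> u \<in> U \<Longrightarrow> M w *\<^sub>v u \<in> U"
    and w: "w \<in> lwords H m" and u: "u \<in> U"
  shows "M w *\<^sub>v u \<in> U"
  using w
proof (induction "length w" arbitrary: w rule: less_induct)
  case less
  note Mm = word_family_mono[OF M km(1)]
  show ?case
  proof (cases "w = []")
    case True
    then show ?thesis using Mm u subsp_carrier[OF U u] by (simp add: word_family_def)
  next
    case False
    define a where "a = take m w"
    define b where "b = drop m w"
    have len: "m \<le> length w" using less.prems False by (auto simp: lwords_def intro: dvd_imp_le)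
    have a: "a \<in> words H m"
      using less.prems len by (auto simp: a_def words_def lwords_def dest: in_set_takeD)
    have b: "b \<in> lwords H m" "length b < length w"
      using less.prems len km(2) False by (auto simp: b_def lwords_def dvd_diff_nat dest: in_set_dropD)
    have a': "a \<in> lwords H m" using a by (simp add: words_def lwords_def)
    have "M w = M a * M b"
      using Mm a' b(1) unfolding word_family_def a_def b_def by (metis append_take_drop_id)
    moreover have "M a \<in> carrier_mat d d" "M b \<in> carrier_mat d d"
      using Mm a' b(1) by (auto simp: word_family_def)
    ultimately have "M w *\<^sub>v u = M a *\<^sub>v (M b *\<^sub>v u)"
      using subsp_carrier[OF U u] by (simp add: assoc_mult_mat_vec[where ?n\<^sub>1.0=d and ?n\<^sub>2.0=d and ?n\<^sub>3.0=d])
    then show ?thesis using inv[OF a less.hyps[OF b(2,1)]] by simp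
  qed
qed

text \<open>The hypothesis \<open>mult\<close> holds both for a projector onto an invariant subspace
  and for the complementary projector, so the lemma yields the sub- and the quotient family alike.
  The trace formula is cyclicity together with R L = P.\<close>

lemma compress_word_family:
  assumes M: "word_family H m d z M" and s: "splits d z P e R L y"
    and mult: "\<And>v w. v \<in> lwords H m \<Longrightarrow> w \<in> lwords H m \<Longrightarrow> P * M v * P * M w * P = P * M v * M w * P"
  shows "word_family H m e y (\<lambda>w. L * M w * R)"
    and "\<And>w. w \<in> lwords H m \<Longrightarrow> mat_trace (L * M w * R) = mat_trace (M w * P)"
proof -
  have R: "R \<in> carrier_mat d e" and L: "L \<in> carrier_mat e d" and LR: "L * R = 1\<^sub>m e" and RL: "R * L = P"
    and y: "parity e y" using s by (simp_all add: splits_def)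
  have Rz: "z i * R $$ (i, j) = 1 * (R $$ (i, j) * y j)" if "i < d" "j < e" for i j
    using s that by (simp add: splits_def)
  have Lz: "y i * L $$ (i, j) = 1 * (L $$ (i, j) * z j)" if "i < e" "j < d" for i j
    using s that by (simp add: splits_def)
  have P: "P \<in> carrier_mat d d" using RL R L by auto
  have Mc: "M w \<in> carrier_mat d d" if "w \<in> lwords H m" for w using M that by (simp add: word_family_def)
  have LP: "L * P = L" unfolding RL[symmetric] using assoc_mult_mat[OF L R L] LR L by simp
  have PR: "P * R = R" unfolding RL[symmetric] using assoc_mult_mat[OF R L R] LR R by simp
  show tr: "mat_trace (L * M w * R) = mat_trace (M w * P)" if "w \<in> lwords H m" for w
    using mat_trace_comm[OF L, of "M w * R"] Mc[OF that] R L RL by simp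
  show "word_family H m e y (\<lambda>w. L * M w * R)"
    unfolding word_family_def
  proof (intro conjI ballI allI impI)
    show "parity e y" by (rule y)
    show "L * M [] * R = 1\<^sub>m e" using M L LR by (simp add: word_family_def)
  next
    fix w assume w: "w \<in> lwords H m"
    show c: "L * M w * R \<in> carrier_mat e e" using L R Mc[OF w] by simp
    fix i j assume ij: "i < e" "j < e"
    show "y i * (L * M w * R) $$ (i, j) = (- 1) ^ word_parity H w * ((L * M w * R) $$ (i, j) * y j)"
    proof (rule graded_mat_vec_conv[OF c _ ij])
      fix v :: "complex vec" assume v: "v \<in> carrier_vec e"
      let ?s = "(- 1) ^ word_parity H w :: complex"
      have Mz: "z i * M w $$ (i, j) = ?s * (M w $$ (i, j) * z j)" if "i < d" "j < d" for i j
        using M w that by (simp add: word_family_def)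
      have act: "(L * M w * R) *\<^sub>v x = L *\<^sub>v (M w *\<^sub>v (R *\<^sub>v x))" if "x \<in> carrier_vec e" for x
        using that L R Mc[OF w]
        by (simp add: assoc_mult_mat_vec[where ?n\<^sub>1.0=e and ?n\<^sub>2.0=d and ?n\<^sub>3.0=e]
            assoc_mult_mat_vec[where ?n\<^sub>1.0=e and ?n\<^sub>2.0=d and ?n\<^sub>3.0=d])
      have Rv: "R *\<^sub>v x \<in> carrier_vec d" if "x \<in> carrier_vec e" for x using R that by simp
      have MRv: "M w *\<^sub>v (R *\<^sub>v x) \<in> carrier_vec d" if "x \<in> carrier_vec e" for x
        using Mc[OF w] R that by simp
      have "pact y (L *\<^sub>v (M w *\<^sub>v (R *\<^sub>v v))) = L *\<^sub>v (pact z (M w *\<^sub>v (R *\<^sub>v v)))"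
        by (subst graded_mat_vec[OF L Lz MRv[OF v]]) auto
      also have "pact z (M w *\<^sub>v (R *\<^sub>v v)) = ?s \<cdot>\<^sub>v (M w *\<^sub>v pact z (R *\<^sub>v v))"
        by (rule graded_mat_vec[OF Mc[OF w] Mz Rv[OF v]])
      also have "pact z (R *\<^sub>v v) = R *\<^sub>v pact y v"
        by (subst graded_mat_vec[OF R Rz v]) auto
      also have "L *\<^sub>v (?s \<cdot>\<^sub>v (M w *\<^sub>v (R *\<^sub>v pact y v))) = ?s \<cdot>\<^sub>v (L *\<^sub>v (M w *\<^sub>v (R *\<^sub>v pact y v)))"
        by (rule mult_mat_vec[OF L MRv]) (use v in simp)
      finally show "pact y (L * M w * R *\<^sub>v v) = ?s \<cdot>\<^sub>v (L * M w * R *\<^sub>v pact y v)"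
        using v by (simp add: act)
    qed
  next
    fix v w assume v: "v \<in> lwords H m" and w: "w \<in> lwords H m"
    note c = Mc[OF v] Mc[OF w] P L R
    have as: "A * B * C = A * (B * C)" if "A \<in> carrier_mat a b" "B \<in> carrier_mat b c'" "C \<in> carrier_mat c' e'"
      for A B C :: "complex mat" and a b c' e' using that by (rule assoc_mult_mat)
    \<comment> \<open>P is inserted through L P = L and P R = R; after \<open>mult\<close> has
      produced a P between the two factors, that P is read as R L.\<close>
    have "L * M (v @ w) * R = (L * P) * (M v * M w) * (P * R)"
      using M v w LP PR by (simp add: word_family_def)
    also have "\<dots> = L * (P * M v * M w * P) * R"
      using c by (simp add: as[where a=e and b=d and c'=d and e'=d] as[where a=e and b=d and c'=d and e'=e]
          as[where a=d and b=d and c'=d and e'=d] as[where a=d and b=d and c'=d and e'=e])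
    also have "P * M v * M w * P = P * M v * P * M w * P" using mult[OF v w] by simp
    also have "L * (P * M v * P * M w * P) * R = (L * P) * M v * P * M w * (P * R)"
      using c by (simp add: as[where a=e and b=d and c'=d and e'=d] as[where a=e and b=d and c'=d and e'=e]
          as[where a=d and b=d and c'=d and e'=d] as[where a=d and b=d and c'=d and e'=e])
    also have "\<dots> = L * M v * (R * L) * M w * R" unfolding LP PR RL ..
    also have "\<dots> = (L * M v * R) * (L * M w * R)"
      using c by (simp add: as[where a=e and b=d and c'=d and e'=d] as[where a=e and b=d and c'=d and e'=e]
          as[where a=d and b=d and c'=d and e'=d] as[where a=d and b=d and c'=d and e'=e]
          as[where a=d and b=e and c'=d and e'=d] as[where a=d and b=e and c'=d and e'=e]
          as[where a=d and b=d and c'=e and e'=e] as[where a=e and b=d and c'=e and e'=d] as[where a=e and b=d and c'=e and e'=e])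
    finally show "L * M (v @ w) * R = (L * M v * R) * (L * M w * R)" .
  qed
qed

lemma mat_eq_via_vec:
  assumes "A \<in> carrier_mat m n" "B \<in> carrier_mat m n"
    and eq: "\<And>v. v \<in> carrier_vec n \<Longrightarrow> A *\<^sub>v v = B *\<^sub>v (v :: complex vec)"
  shows "A = B"
proof (rule eq_matI)
  fix i j assume "i < dim_row B" "j < dim_col B"
  then have ij: "i < m" "j < n" using assms by auto
  have "A $$ (i, j) = (A *\<^sub>v unit_vec n j) $ i" using assms(1) ij by simp
  also have "\<dots> = (B *\<^sub>v unit_vec n j) $ i" by (simp add: eq)
  also have "\<dots> = B $$ (i, j)" using assms(2) ij by simp
  finally show "A $$ (i, j) = B $$ (i, j)" .
qed (use assms in auto)

text \<open>Only traces are compared: the matrices of the family are block triangular with respect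
  to the summands, and the off-diagonal blocks do not enter the coefficients of the state. The list
  is nonempty because the final tensor must have positive bond dimension.\<close>

definition stable_summands ::
  "'n graded_space \<Rightarrow> nat \<Rightarrow> ('n list \<Rightarrow> complex mat) \<Rightarrow>
    (nat \<times> (nat \<Rightarrow> complex) \<times> ('n list \<Rightarrow> complex mat)) list \<Rightarrow> bool" where
  "stable_summands H k M bs \<longleftrightarrow> bs \<noteq> [] \<and>
     (\<forall>(e, y, B)\<in>set bs. e \<ge> 1 \<and> word_family H k e y B \<and> stable_words H k e y B) \<and>
     (\<forall>w\<in>lwords H k. mat_trace (M w) = (\<Sum>(e, y, B)\<leftarrow>bs. mat_trace (B w)))"

lemma stable_summandsD:
  assumes "stable_summands H k M bs" "(e, y, B) \<in> set bs"
  shows "e \<ge> 1" "word_family H k e y B" "stable_words H k e y B"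
proof -
  have "\<forall>(e, y, B)\<in>set bs. e \<ge> 1 \<and> word_family H k e y B \<and> stable_words H k e y B"
    using assms(1) unfolding stable_summands_def by (elim conjE)
  from bspec[OF this assms(2)] show "e \<ge> 1" "word_family H k e y B" "stable_words H k e y B" by simp_all
qed

lemma stable_summands_trace:
  "stable_summands H k M bs \<Longrightarrow> w \<in> lwords H k \<Longrightarrow> mat_trace (M w) = (\<Sum>(e, y, B)\<leftarrow>bs. mat_trace (B w))"
  unfolding stable_summands_def by (elim conjE) (rule bspec)

text \<open>Induction on d. When stability fails at a multiple m of k, an invariant graded subspace
  and a complement give two smaller families over the words of length divisible by m. Their
  recursively found block lengths differ; stability under every further blocking permits replacing
  both by the product.\<close>

lemma stable_decomposition:
  fixes H :: "'n graded_space"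
  assumes "d \<ge> 1" "k \<ge> 1" "word_family H k d z M"
  shows "\<exists>k'\<ge>1. k dvd k' \<and> (\<exists>bs. stable_summands H k' M bs)"
  using assms
proof (induction d arbitrary: k z M rule: less_induct)
  case (less d)
  note d = less.prems(1) and k = less.prems(2) and M = less.prems(3)
  show ?case
  proof (cases "stable_words H k d z M")
    case True
    then show ?thesis using less.prems
      by (intro exI[of _ k] conjI exI[of _ "[(d, z, M)]"]) (auto simp: stable_summands_def)
  next
    case False
    then obtain m U where m: "m \<ge> 1" "k dvd m" and U: "subsp d U" and Uz: "\<And>u. u \<in> U \<Longrightarrow> pact z u \<in> U"
      and inv: "\<And>w u. w \<in> words H m \<Longrightarrow> u \<in> U \<Longrightarrow> M w *\<^sub>v u \<in> U"
      and ne: "U \<noteq> {0\<^sub>v d}" "U \<noteq> carrier_vec d"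
      unfolding stable_words_def by blast
    note Mm = word_family_mono[OF M m(2)]
    have z: "parity d z" using M by (simp add: word_family_def)
    have Mc: "M w \<in> carrier_mat d d" if "w \<in> lwords H m" for w using Mm that by (simp add: word_family_def)
    have inv': "M w *\<^sub>v u \<in> U" if "w \<in> lwords H m" "u \<in> U" for w u
      using invariant_lwords[OF M m(2,1) U inv that] .
    from homogeneous_projection[OF z U Uz] obtain P where P: "P \<in> carrier_mat d d"
      and PU: "\<And>v. v \<in> carrier_vec d \<Longrightarrow> P *\<^sub>v v \<in> U"
      and Pz: "\<And>v. v \<in> carrier_vec d \<Longrightarrow> pact z (P *\<^sub>v v) = P *\<^sub>v pact z v"
      and Pid: "\<And>u. u \<in> U \<Longrightarrow> P *\<^sub>v u = u" by blast
    define Q where "Q = 1\<^sub>m d - P"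
    have Q: "Q \<in> carrier_mat d d" using P by (simp add: Q_def minus_carrier_mat)
    have PP: "P * P = P"
      by (rule mat_eq_via_vec[where m=d and n=d]) (use P PU Pid in auto)
    \<comment> \<open>M w maps the range of P into U, where P is the identity.\<close>
    have PMP: "P * (M w * P) = M w * P" if "w \<in> lwords H m" for w
      by (rule mat_eq_via_vec[where m=d and n=d])
        (use P Mc[OF that] PU Pid inv'[OF that] in \<open>auto simp: assoc_mult_mat_vec[where ?n\<^sub>1.0=d and ?n\<^sub>2.0=d and ?n\<^sub>3.0=d]\<close>)
    have PQ: "P + Q = 1\<^sub>m d" using P by (auto simp: Q_def)
    have QP: "Q * P = 0\<^sub>m d d" using P PP unfolding Q_def
      by (subst minus_mult_distrib_mat[where nr=d and n=d and nc=d]) auto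
    have QQ: "Q * Q = Q"
      using P Q QP mult_minus_distrib_mat[OF Q one_carrier_mat P] unfolding Q_def[symmetric]
      by (auto simp: Q_def[symmetric])
    have Pze: "z i * P $$ (i, j) = P $$ (i, j) * z j" if "i < d" "j < d" for i j
      using graded_mat_vec_conv[OF P, of z 1 z, OF _ that] Pz P by auto
    have Qze: "z i * Q $$ (i, j) = Q $$ (i, j) * z j" if "i < d" "j < d" for i j
      using Pze[OF that] that P by (auto simp: Q_def algebra_simps)
    from homogeneous_splitting[OF z P PP Pze] obtain e1 R1 L1 y1 where s1: "splits d z P e1 R1 L1 y1" by blast
    from homogeneous_splitting[OF z Q QQ Qze] obtain e2 R2 L2 y2 where s2: "splits d z Q e2 R2 L2 y2" by blast
    have m1: "P * M v * P * M w * P = P * M v * M w * P" if "v \<in> lwords H m" "w \<in> lwords H m" for v w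
    proof -
      have "P * M v * P * M w * P = P * M v * (P * (M w * P))"
        using P Mc[OF that(1)] Mc[OF that(2)] by (simp add: assoc_mult_mat[where ?n\<^sub>1.0=d and ?n\<^sub>2.0=d and ?n\<^sub>3.0=d and ?n\<^sub>4.0=d])
      then show ?thesis unfolding PMP[OF that(2)]
        using P Mc[OF that(1)] Mc[OF that(2)] by (simp add: assoc_mult_mat[where ?n\<^sub>1.0=d and ?n\<^sub>2.0=d and ?n\<^sub>3.0=d and ?n\<^sub>4.0=d])
    qed
    have QMP: "Q * (M w * P) = 0\<^sub>m d d" if "w \<in> lwords H m" for w
    proof -
      have "Q * (M w * P) = Q * (P * (M w * P))" using PMP[OF that] by simp
      also have "\<dots> = Q * P * (M w * P)" using P Q Mc[OF that] by (subst assoc_mult_mat[where ?n\<^sub>1.0=d and ?n\<^sub>2.0=d and ?n\<^sub>3.0=d and ?n\<^sub>4.0=d]) auto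
      finally show ?thesis unfolding QP using P Mc[OF that] by simp
    qed
    \<comment> \<open>Q M P = 0 says that the range of P is invariant, so M induces a multiplicative
      family on the quotient; this is what \<open>mult\<close> requires for Q.\<close>
    have QMQ: "Q * M w * Q = Q * M w" if "w \<in> lwords H m" for w
    proof -
      have "Q * M w = Q * M w * (P + Q)" unfolding PQ using Q Mc[OF that] by simp
      also have "\<dots> = Q * M w * P + Q * M w * Q" using P Q Mc[OF that] by (intro mult_add_distrib_mat) auto
      also have "Q * M w * P = Q * (M w * P)" using P Q Mc[OF that] by (intro assoc_mult_mat) auto
      also note QMP[OF that]
      also have "0\<^sub>m d d + Q * M w * Q = Q * M w * Q" using Q Mc[OF that] by (intro left_add_zero_mat) auto
      finally show ?thesis by (rule sym)
    qed
    have m2: "Q * M v * Q * M w * Q = Q * M v * M w * Q" if "v \<in> lwords H m" "w \<in> lwords H m" for v w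
      unfolding QMQ[OF that(1)] ..
    define B1 where "B1 = (\<lambda>w. L1 * M w * R1)"
    define B2 where "B2 = (\<lambda>w. L2 * M w * R2)"
    have f1: "word_family H m e1 y1 B1" and t1: "\<And>w. w \<in> lwords H m \<Longrightarrow> mat_trace (B1 w) = mat_trace (M w * P)"
      using compress_word_family[OF Mm s1 m1] unfolding B1_def by auto
    have f2: "word_family H m e2 y2 B2" and t2: "\<And>w. w \<in> lwords H m \<Longrightarrow> mat_trace (B2 w) = mat_trace (M w * Q)"
      using compress_word_family[OF Mm s2 m2] unfolding B2_def by auto
    have tr: "mat_trace (M w) = mat_trace (B1 w) + mat_trace (B2 w)" if "w \<in> lwords H m" for w
    proof -
      have "mat_trace (M w) = mat_trace (M w * (P + Q))" unfolding PQ using Mc[OF that] by simp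
      also have "\<dots> = mat_trace (M w * P + M w * Q)"
        using P Q Mc[OF that] by (subst mult_add_distrib_mat) auto
      finally show ?thesis using P Q Mc[OF that] t1[OF that] t2[OF that]
        by (subst (asm) mat_trace_add[where n=d]) auto
    qed
    have nil: "[] \<in> lwords H m" by (simp add: lwords_def)
    \<comment> \<open>The trace identity at the empty word, where every family is the identity
      matrix, counts dimensions.\<close>
    have dd: "d = e1 + e2"
    proof -
      have "of_nat d = (of_nat e1 + of_nat e2 :: complex)"
        using tr[OF nil] M f1 f2 by (simp add: word_family_def mat_trace_one)
      then show ?thesis by (metis of_nat_add of_nat_eq_iff)
    qed
    have e1: "e1 \<noteq> 0"
    proof
      assume "e1 = 0"
      then have "P = 0\<^sub>m d d" using s1 by (auto simp: splits_def scalar_prod_def intro!: eq_matI)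
      then have "u = 0\<^sub>v d" if "u \<in> U" for u using Pid[OF that] subsp_carrier[OF U that]
        by (auto intro!: eq_vecI) (metis index_mult_mat_vec index_zero_mat(2) index_zero_vec(1) row_zero carrier_vecD scalar_prod_left_zero)
      with ne(1) subsp_zero[OF U] show False by blast
    qed
    have e2: "e2 \<noteq> 0"
    proof
      assume "e2 = 0"
      then have "Q = 0\<^sub>m d d" using s2 by (auto simp: splits_def scalar_prod_def intro!: eq_matI)
      then have "P = 1\<^sub>m d" using PQ P by simp
      then have "U = carrier_vec d" using PU U by (auto simp: subsp_def)
      with ne(2) show False by blast
    qed
    have lt: "e1 < d" "e2 < d" "e1 \<ge> 1" "e2 \<ge> 1" using dd e1 e2 by auto
    from less.IH[OF lt(1,3) m(1) f1] obtain k1 bs1 where k1: "k1 \<ge> 1" "m dvd k1"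
      and bs1: "stable_summands H k1 B1 bs1" by blast
    from less.IH[OF lt(2,4) m(1) f2] obtain k2 bs2 where k2: "k2 \<ge> 1" "m dvd k2"
      and bs2: "stable_summands H k2 B2 bs2" by blast
    have dv: "k1 dvd k1 * k2" "k2 dvd k1 * k2" "m dvd k1 * k2" "k dvd k1 * k2"
      using k1 m(2) by (auto intro: dvd_trans dvd_mult2)
    have fam: "e \<ge> 1 \<and> word_family H (k1 * k2) e y B \<and> stable_words H (k1 * k2) e y B"
      if "(e, y, B) \<in> set (bs1 @ bs2)" for e y B
    proof -
      have "(e, y, B) \<in> set bs1 \<or> (e, y, B) \<in> set bs2" using that by simp
      then show ?thesis
      proof
        assume "(e, y, B) \<in> set bs1"
        note D = stable_summandsD[OF bs1 this]
        show ?thesis using D(1) word_family_mono[OF D(2) dv(1)] stable_words_mono[OF D(3) dv(1)] by simp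
      next
        assume "(e, y, B) \<in> set bs2"
        note D = stable_summandsD[OF bs2 this]
        show ?thesis using D(1) word_family_mono[OF D(2) dv(2)] stable_words_mono[OF D(3) dv(2)] by simp
      qed
    qed
    have trs: "mat_trace (M w) = (\<Sum>(e, y, B)\<leftarrow>bs1 @ bs2. mat_trace (B w))" if w: "w \<in> lwords H (k1 * k2)" for w
    proof -
      have "w \<in> lwords H m" "w \<in> lwords H k1" "w \<in> lwords H k2" using w dv lwords_mono by blast+
      then show ?thesis using tr[of w] stable_summands_trace[OF bs1, of w] stable_summands_trace[OF bs2, of w] by simp
    qed
    have "stable_summands H (k1 * k2) M (bs1 @ bs2)"
      unfolding stable_summands_def
    proof (intro conjI ballI)
      show "bs1 @ bs2 \<noteq> []" using bs1 by (simp add: stable_summands_def)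
    next
      fix b assume "b \<in> set (bs1 @ bs2)"
      then show "case b of (e, y, B) \<Rightarrow> e \<ge> 1 \<and> word_family H (k1 * k2) e y B \<and> stable_words H (k1 * k2) e y B"
        using fam[of "fst b" "fst (snd b)" "snd (snd b)"] by (simp add: case_prod_beta)
    qed (rule trs)
    moreover have "k1 * k2 \<ge> 1" using k1 k2 by simp
    ultimately show ?thesis using dv(4) by blast
  qed
qed

section \<open>Rayleigh quotients and pivots\<close>

text \<open>Tychonoff for closed balls on J and singletons off J. Vectors and forms are represented
  by functions of prescribed support whenever compactness is at stake.\<close>

lemma compact_supported_box:
  "compact {f :: 'i \<Rightarrow> complex. (\<forall>i. i \<notin> J \<longrightarrow> f i = 0) \<and> (\<forall>i\<in>J. cmod (f i) \<le> B)}"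
proof -
  let ?K = "\<lambda>i. if i \<in> J then cball 0 B else {0 :: complex}"
  have "compactin (product_topology (\<lambda>_. euclidean) UNIV) (PiE UNIV ?K)"
    by (subst compactin_PiE) auto
  then have "compact (PiE UNIV ?K)" by (simp add: euclidean_product_topology)
  also have "PiE UNIV ?K = {f. (\<forall>i. i \<notin> J \<longrightarrow> f i = 0) \<and> (\<forall>i\<in>J. cmod (f i) \<le> B)}"
    by (auto simp: PiE_def Pi_def extensional_def split: if_splits)
  finally show ?thesis .
qed

text \<open>The quotient k / h attains its maximum t on the compact unit sphere, and homogeneity of
  degree two carries the inequality to all other functions. The general shape of h and k covers a
  single form as well as a form evaluated on pairs of vectors.\<close>

lemma rayleigh:
  fixes h k :: "(nat \<Rightarrow> complex) \<Rightarrow> real"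
  assumes m: "m > 0"
    and ch: "continuous_on UNIV h" and ck: "continuous_on UNIV k"
    and sh: "\<And>c f. h (\<lambda>i. complex_of_real c * f i) = c\<^sup>2 * h f"
    and sk: "\<And>c f. k (\<lambda>i. complex_of_real c * f i) = c\<^sup>2 * k f"
    and pos: "\<And>f i. (\<forall>i\<ge>m. f i = 0) \<Longrightarrow> f i \<noteq> 0 \<Longrightarrow> h f > 0"
  shows "\<exists>t f0. (\<forall>i\<ge>m. f0 i = 0) \<and> (\<exists>i. f0 i \<noteq> 0) \<and> k f0 = t * h f0 \<and>
    (\<forall>f. (\<forall>i\<ge>m. f i = 0) \<longrightarrow> k f \<le> t * h f)"
proof -
  define n2 where "n2 f = (\<Sum>i<m. (cmod (f i))\<^sup>2)" for f :: "nat \<Rightarrow> complex"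
  define S where "S = {f :: nat \<Rightarrow> complex. (\<forall>i. i \<notin> {..<m} \<longrightarrow> f i = 0) \<and> (\<forall>i\<in>{..<m}. cmod (f i) \<le> 1)}
    \<inter> {f. n2 f = 1}"
  have cn2: "continuous_on UNIV n2" unfolding n2_def
    by (intro continuous_intros continuous_on_product_coordinates)
  have "closed {f. n2 f = 1}"
    using cn2 by (intro closed_Collect_eq) (auto intro: continuous_intros)
  then have cS: "compact S" unfolding S_def using compact_supported_box by (intro compact_Int_closed)
  have Spos: "h f > 0" if "f \<in> S" for f
  proof -
    have "\<exists>i. f i \<noteq> 0"
    proof (rule ccontr)
      assume "\<not> ?thesis"
      then have "n2 f = 0" by (simp add: n2_def)
      then show False using that by (simp add: S_def)
    qed
    then show ?thesis using pos that by (auto simp: S_def)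
  qed
  have "n2 (\<lambda>i. if i = 0 then 1 else 0) = (\<Sum>i<m. if i = 0 then 1 else 0)"
    unfolding n2_def by (rule sum.cong) auto
  then have "(\<lambda>i. if i = 0 then 1 else 0) \<in> S"
    using m by (auto simp: S_def)
  then have ne: "S \<noteq> {}" by blast
  have "continuous_on S (\<lambda>f. k f / h f)"
    using Spos by (intro continuous_intros continuous_on_subset[OF ch] continuous_on_subset[OF ck]) force+
  from continuous_attains_sup[OF cS ne this] obtain f0 where f0: "f0 \<in> S"
    and mx: "\<And>f. f \<in> S \<Longrightarrow> k f / h f \<le> k f0 / h f0" by blast
  define t where "t = k f0 / h f0"
  have "k f \<le> t * h f" if supp: "\<forall>i\<ge>m. f i = 0" for f
  proof (cases "\<exists>i. f i \<noteq> 0")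
    case False
    then have "f = (\<lambda>i. complex_of_real 0 * f i)" by auto
    then show ?thesis using sh[of 0 f] sk[of 0 f] by simp
  next
    case True
    then obtain i where i: "f i \<noteq> 0" by blast
    have im: "i < m" using i supp not_le by blast
    have "0 < (cmod (f i))\<^sup>2" using i by simp
    also have "\<dots> \<le> n2 f" unfolding n2_def using im by (intro member_le_sum) auto
    finally have p: "n2 f > 0" .
    define c where "c = 1 / sqrt (n2 f)"
    define g where "g = (\<lambda>i. complex_of_real c * f i)"
    have c2: "c\<^sup>2 * n2 f = 1" and c0: "c\<^sup>2 > 0" using p by (auto simp: c_def power_divide)
    have n1: "n2 g = 1"
      using c2 unfolding n2_def g_def by (simp add: norm_mult power_mult_distrib sum_distrib_left)
    have "cmod (g j) \<le> 1" if "j < m" for j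
    proof -
      have "(cmod (g j))\<^sup>2 \<le> n2 g" unfolding n2_def using that by (intro member_le_sum) auto
      then show ?thesis unfolding n1 by (simp add: power_le_one_iff abs_square_le_1[symmetric])
    qed
    then have "g \<in> S" using n1 supp by (auto simp: S_def g_def)
    from mx[OF this] Spos[OF this] have "k g \<le> t * h g" by (simp add: t_def field_simps)
    then have "c\<^sup>2 * k f \<le> c\<^sup>2 * (t * h f)" unfolding g_def sh sk by (simp add: algebra_simps)
    then show ?thesis using c0 by (metis mult_le_cancel_left_pos)
  qed
  moreover have "k f0 = t * h f0" using Spos[OF f0] by (simp add: t_def)
  moreover have "\<exists>i. f0 i \<noteq> 0"
  proof (rule ccontr)
    assume "\<not> ?thesis"
    then have "n2 f0 = 0" by (simp add: n2_def)
    then show False using f0 by (simp add: S_def)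
  qed
  ultimately show ?thesis using f0 by (intro exI[of _ t] exI[of _ f0]) (auto simp: S_def)
qed

text \<open>The number of pivots replaces the dimension: it is strictly monotone on subspaces.\<close>

definition pivots :: "nat \<Rightarrow> complex vec set \<Rightarrow> nat set" where
  "pivots D U = {i. i < D \<and> (\<exists>u\<in>U. u $ i \<noteq> 0 \<and> (\<forall>j<i. u $ j = 0))}"

lemma finite_pivots: "finite (pivots D U)"
  by (simp add: pivots_def)

lemma pivots_mono: "U \<subseteq> V \<Longrightarrow> pivots D U \<subseteq> pivots D V"
  by (auto simp: pivots_def)

text \<open>Gaussian elimination: a vector of V outside U is cleared entry by entry with vectors of
  U that have the same pivot. It stays outside U and ends up as zero, a contradiction.\<close>

lemma pivots_eq_imp_eq:
  assumes U: "subsp D U" and V: "subsp D V" and UV: "U \<subseteq> V" and eq: "pivots D V \<subseteq> pivots D U"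
  shows "V \<subseteq> U"
proof (rule ccontr)
  assume "\<not> V \<subseteq> U"
  have "\<exists>v. v \<in> V \<and> v \<notin> U \<and> (\<forall>j<i. v $ j = 0)" if "i \<le> D" for i
    using that
  proof (induction i)
    case 0
    then show ?case using \<open>\<not> V \<subseteq> U\<close> by auto
  next
    case (Suc i)
    then obtain v where v: "v \<in> V" "v \<notin> U" and z: "\<And>j. j < i \<Longrightarrow> v $ j = 0" by auto
    show ?case
    proof (cases "v $ i = 0")
      case True
      then show ?thesis using v z by (auto simp: less_Suc_eq)
    next
      case False
      then have "i \<in> pivots D V" using v z Suc.prems by (auto simp: pivots_def)
      then obtain u where u: "u \<in> U" "u $ i \<noteq> 0" "\<And>j. j < i \<Longrightarrow> u $ j = 0"
        using eq by (auto simp: pivots_def)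
      define c where "c = v $ i / u $ i"
      have dim: "u \<in> carrier_vec D" "v \<in> carrier_vec D" using u v U V subsp_carrier by blast+
      have cu: "c \<cdot>\<^sub>v u \<in> U" using U u by (simp add: subsp_smult)
      have "v - c \<cdot>\<^sub>v u \<in> V" using V v(1) cu UV by (meson subsetD subsp_minus)
      moreover have "v - c \<cdot>\<^sub>v u \<notin> U"
      proof
        assume "v - c \<cdot>\<^sub>v u \<in> U"
        then have "(v - c \<cdot>\<^sub>v u) + c \<cdot>\<^sub>v u \<in> U" using U cu by (simp add: subsp_add)
        moreover have "(v - c \<cdot>\<^sub>v u) + c \<cdot>\<^sub>v u = v" using dim by (intro eq_vecI) auto
        ultimately show False using v by simp
      qed
      moreover have "(v - c \<cdot>\<^sub>v u) $ j = 0" if "j < Suc i" for j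
        using that u z dim Suc.prems by (cases "j = i") (auto simp: c_def)
      ultimately show ?thesis by blast
    qed
  qed
  from this[of D] obtain v where v: "v \<in> V" "v \<notin> U" and z: "\<And>j. j < D \<Longrightarrow> v $ j = 0" by auto
  have "v = 0\<^sub>v D" using subsp_carrier[OF V v(1)] z by (intro eq_vecI) auto
  then show False using v(2) subsp_zero[OF U] by simp
qed

section \<open>Sesquilinear forms\<close>

text \<open>Linear in the first and conjugate linear in the second argument. The coefficients are a
  function on index pairs rather than a matrix, so that the product topology is at hand.\<close>

definition sform :: "nat \<Rightarrow> (nat \<times> nat \<Rightarrow> complex) \<Rightarrow> complex vec \<Rightarrow> complex vec \<Rightarrow> complex" where
  "sform D F u v = (\<Sum>i<D. \<Sum>k<D. F (i, k) * u $ i * cnj (v $ k))"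

lemma sform_add_left: "u \<in> carrier_vec D \<Longrightarrow> v \<in> carrier_vec D \<Longrightarrow> sform D F (u + v) w = sform D F u w + sform D F v w"
  by (simp add: sform_def sum.distrib algebra_simps)

lemma sform_add_right: "u \<in> carrier_vec D \<Longrightarrow> v \<in> carrier_vec D \<Longrightarrow> sform D F w (u + v) = sform D F w u + sform D F w v"
  by (simp add: sform_def sum.distrib algebra_simps)

lemma sform_smult_left: "u \<in> carrier_vec D \<Longrightarrow> sform D F (c \<cdot>\<^sub>v u) w = c * sform D F u w"
  by (simp add: sform_def sum_distrib_left algebra_simps)

lemma sform_smult_right: "u \<in> carrier_vec D \<Longrightarrow> sform D F w (c \<cdot>\<^sub>v u) = cnj c * sform D F w u"
  by (simp add: sform_def sum_distrib_left algebra_simps)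

lemma sform_diff_left: "u \<in> carrier_vec D \<Longrightarrow> v \<in> carrier_vec D \<Longrightarrow> sform D F (u - v) w = sform D F u w - sform D F v w"
  by (simp add: sform_def sum_subtractf algebra_simps)

lemma sform_diff_right: "u \<in> carrier_vec D \<Longrightarrow> v \<in> carrier_vec D \<Longrightarrow> sform D F w (u - v) = sform D F w u - sform D F w v"
  by (simp add: sform_def sum_subtractf algebra_simps)

lemmas sform_simps = sform_add_left sform_add_right sform_smult_left sform_smult_right
  sform_diff_left sform_diff_right

lemma sform_lin: "sform D (\<lambda>p. a * F p + b * G p) u v = a * sform D F u v + b * sform D G u v"
  by (simp add: sform_def sum_distrib_left sum.distrib algebra_simps)

lemma sform_unit:
  assumes "i < D" "k < D"
  shows "sform D F (unit_vec D i) (unit_vec D k) = F (i, k)"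
proof -
  have "sform D F (unit_vec D i) (unit_vec D k) = (\<Sum>a<D. if a = i then F (i, k) else 0)"
    unfolding sform_def
  proof (rule sum.cong[OF refl])
    fix a assume a: "a \<in> {..<D}"
    have "(\<Sum>b<D. F (a, b) * unit_vec D i $ a * cnj (unit_vec D k $ b)) =
       (\<Sum>b<D. if b = k then (if a = i then F (a, k) else 0) else 0)"
      using a assms by (intro sum.cong) auto
    then show "(\<Sum>b<D. F (a, b) * unit_vec D i $ a * cnj (unit_vec D k $ b)) = (if a = i then F (i, k) else 0)"
      using assms by simp
  qed
  then show ?thesis using assms by simp
qed

lemma sform_hermitian:
  assumes "\<And>i k. i < D \<Longrightarrow> k < D \<Longrightarrow> F (k, i) = cnj (F (i, k))"
  shows "sform D F v u = cnj (sform D F u v)"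
proof -
  have "sform D F v u = (\<Sum>i<D. \<Sum>k<D. F (i, k) * v $ i * cnj (u $ k))" by (simp add: sform_def)
  also have "\<dots> = (\<Sum>k<D. \<Sum>i<D. F (i, k) * v $ i * cnj (u $ k))" by (rule sum.swap)
  also have "\<dots> = cnj (sform D F u v)"
    unfolding sform_def cnj_sum
  proof (intro sum.cong refl)
    fix i k assume "i \<in> {..<D}" "k \<in> {..<D}"
    then have "F (k, i) = cnj (F (i, k))" by (intro assms) auto
    then show "F (k, i) * v $ k * cnj (u $ i) = cnj (F (i, k) * u $ i * cnj (v $ k))" by simp
  qed
  finally show ?thesis .
qed

text \<open>Parallelogram law and absolute homogeneity pass to linear combinations such as the gap r
  F - dual F and suffice for the null set of a nonnegative function to be a subspace.\<close>

definition quadr :: "nat \<Rightarrow> (complex vec \<Rightarrow> real) \<Rightarrow> bool" where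
  "quadr D q \<longleftrightarrow> (\<forall>u\<in>carrier_vec D. \<forall>v\<in>carrier_vec D. q (u + v) + q (u - v) = 2 * q u + 2 * q v) \<and>
     (\<forall>u\<in>carrier_vec D. \<forall>c. q (c \<cdot>\<^sub>v u) = (cmod c)\<^sup>2 * q u)"

lemma quadr_sform: "quadr D (\<lambda>u. Re (sform D F u u))"
  unfolding quadr_def
proof (intro conjI ballI allI)
  fix u v :: "complex vec" assume uv: "u \<in> carrier_vec D" "v \<in> carrier_vec D"
  show "Re (sform D F (u + v) (u + v)) + Re (sform D F (u - v) (u - v)) = 2 * Re (sform D F u u) + 2 * Re (sform D F v v)"
    using uv by (simp add: sform_simps)
next
  fix u :: "complex vec" and c assume u: "u \<in> carrier_vec D"
  have "c * cnj c = complex_of_real ((cmod c)\<^sup>2)" by (simp only: complex_norm_square)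
  moreover have "sform D F (c \<cdot>\<^sub>v u) (c \<cdot>\<^sub>v u) = (c * cnj c) * sform D F u u"
    using u by (simp add: sform_simps)
  ultimately show "Re (sform D F (c \<cdot>\<^sub>v u) (c \<cdot>\<^sub>v u)) = (cmod c)\<^sup>2 * Re (sform D F u u)"
    by simp
qed

lemma quadr_lin: "quadr D p \<Longrightarrow> quadr D q \<Longrightarrow> quadr D (\<lambda>u. a * p u + b * q u)"
proof -
  assume p: "quadr D p" and q: "quadr D q"
  show ?thesis unfolding quadr_def
  proof (intro conjI ballI allI)
    fix u v :: "complex vec" assume uv: "u \<in> carrier_vec D" "v \<in> carrier_vec D"
    have 1: "p (u + v) = 2 * p u + 2 * p v - p (u - v)" "q (u + v) = 2 * q u + 2 * q v - q (u - v)"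
      using p q uv unfolding quadr_def by (simp_all add: eq_diff_eq)
    show "a * p (u + v) + b * q (u + v) + (a * p (u - v) + b * q (u - v)) =
       2 * (a * p u + b * q u) + 2 * (a * p v + b * q v)"
      unfolding 1 by (simp add: algebra_simps)
  next
    fix u :: "complex vec" and c assume u: "u \<in> carrier_vec D"
    have 1: "p (c \<cdot>\<^sub>v u) = (cmod c)\<^sup>2 * p u" "q (c \<cdot>\<^sub>v u) = (cmod c)\<^sup>2 * q u"
      using p q u by (auto simp: quadr_def)
    show "a * p (c \<cdot>\<^sub>v u) + b * q (c \<cdot>\<^sub>v u) = (cmod c)\<^sup>2 * (a * p u + b * q u)"
      unfolding 1 by (simp add: algebra_simps)
  qed
qed

text \<open>If q vanishes at u and v, the nonnegative numbers q (u + v) and q (u - v) have sum zero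
  by the parallelogram law.\<close>

lemma subsp_null:
  assumes q: "quadr D q" and pos: "\<And>u. u \<in> carrier_vec D \<Longrightarrow> q u \<ge> 0"
  shows "subsp D {u \<in> carrier_vec D. q u = 0}"
proof -
  have s: "q (c \<cdot>\<^sub>v u) = (cmod c)\<^sup>2 * q u" if "u \<in> carrier_vec D" for c u
    using q that by (auto simp: quadr_def)
  have a: "q (u + v) = 0" if "u \<in> carrier_vec D" "v \<in> carrier_vec D" "q u = 0" "q v = 0" for u v
  proof -
    have "q (u + v) + q (u - v) = 0" using q that by (auto simp: quadr_def)
    then show ?thesis using pos[of "u + v"] pos[of "u - v"] that by simp
  qed
  have "q (0 \<cdot>\<^sub>v 0\<^sub>v D) = 0" by (subst s) auto
  moreover have "0 \<cdot>\<^sub>v 0\<^sub>v D = (0\<^sub>v D :: complex vec)" by (intro eq_vecI) auto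
  ultimately show ?thesis unfolding subsp_def using s a by auto
qed

lemma continuous_sform_vec:
  "continuous_on UNIV (\<lambda>f :: nat \<Rightarrow> complex. Re (sform D F (vec D f) (vec D f)))"
  unfolding sform_def by (simp, intro continuous_intros continuous_on_product_coordinates)

abbreviation qform :: "nat \<Rightarrow> (nat \<times> nat \<Rightarrow> complex) \<Rightarrow> complex vec \<Rightarrow> real" where
  "qform D F u \<equiv> Re (sform D F u u)"

definition hermitian_form :: "nat \<Rightarrow> (nat \<times> nat \<Rightarrow> complex) \<Rightarrow> bool" where
  "hermitian_form D F \<longleftrightarrow> (\<forall>i<D. \<forall>k<D. F (k, i) = cnj (F (i, k)))"

definition even_form :: "nat \<Rightarrow> (nat \<Rightarrow> complex) \<Rightarrow> (nat \<times> nat \<Rightarrow> complex) \<Rightarrow> bool" where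
  "even_form D z F \<longleftrightarrow> (\<forall>i<D. \<forall>k<D. z i * F (i, k) * z k = F (i, k))"

lemma hermitian_sform: "hermitian_form D F \<Longrightarrow> sform D F v u = cnj (sform D F u v)"
  unfolding hermitian_form_def by (rule sform_hermitian) blast

lemma hermitian_formD: "hermitian_form D F \<Longrightarrow> i < D \<Longrightarrow> k < D \<Longrightarrow> F (k, i) = cnj (F (i, k))"
  unfolding hermitian_form_def by blast

lemma hermitian_lin:
  assumes "hermitian_form D F" "hermitian_form D G"
  shows "hermitian_form D (\<lambda>p. complex_of_real a * F p + complex_of_real b * G p)"
  unfolding hermitian_form_def
proof (intro allI impI)
  fix i k assume "i < D" "k < D"
  from hermitian_formD[OF assms(1) this] hermitian_formD[OF assms(2) this]
  show "complex_of_real a * F (k, i) + complex_of_real b * G (k, i) =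
    cnj (complex_of_real a * F (i, k) + complex_of_real b * G (i, k))" by simp
qed

lemma sform_pact:
  assumes z: "parity D z" and u: "u \<in> carrier_vec D" "v \<in> carrier_vec D"
  shows "sform D F (pact z u) (pact z v) = sform D (\<lambda>(i, k). z i * F (i, k) * z k) u v"
  unfolding sform_def
proof (intro sum.cong refl)
  fix i k assume ik: "i \<in> {..<D}" "k \<in> {..<D}"
  then have "cnj (z k) = z k" using z by (auto simp: parity_def)
  then show "F (i, k) * pact z u $ i * cnj (pact z v $ k) = (case (i, k) of (i, k) \<Rightarrow> z i * F (i, k) * z k) * u $ i * cnj (v $ k)"
    using u ik by simp
qed

lemma even_form_pact:
  assumes "parity D z" "even_form D z F" "u \<in> carrier_vec D" "v \<in> carrier_vec D"
  shows "sform D F (pact z u) (pact z v) = sform D F u v"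
  unfolding sform_pact[OF assms(1,3,4)] unfolding sform_def
  using assms(2) by (intro sum.cong refl) (simp add: even_form_def)

lemma polarization:
  assumes F: "hermitian_form D F"
    and z: "\<And>u. u \<in> carrier_vec D \<Longrightarrow> qform D F u = 0"
    and u: "u \<in> carrier_vec D" and v: "v \<in> carrier_vec D"
  shows "sform D F u v = 0"
proof -
  have re: "Re (sform D F u w) = 0" if w: "w \<in> carrier_vec D" for w
  proof -
    have "qform D F (u + w) = 0" using u w by (intro z) simp
    moreover have "sform D F (u + w) (u + w) = sform D F u u + sform D F u w + (cnj (sform D F u w) + sform D F w w)"
      using u w hermitian_sform[OF F, of w u] by (simp add: sform_simps)
    ultimately show ?thesis using z[OF u] z[OF w] by simp
  qed
  have "Re (sform D F u (\<i> \<cdot>\<^sub>v v)) = 0" using v by (intro re) simp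
  then have "Im (sform D F u v) = 0" using v by (simp add: sform_simps)
  then show ?thesis using re[OF v] by (simp add: complex_eq_iff)
qed

text \<open>Serves to find an admissible starting value of r for the minimisation, and later to
  lower r when the gap is positive definite.\<close>

lemma rayleigh_sform:
  assumes D: "D > 0" and F: "\<And>u. u \<in> carrier_vec D \<Longrightarrow> u \<noteq> 0\<^sub>v D \<Longrightarrow> qform D F u > 0"
  shows "\<exists>t. \<forall>u\<in>carrier_vec D. qform D G u \<le> t * qform D F u"
proof -
  define h k where "h = (\<lambda>f. qform D F (vec D f))" and "k = (\<lambda>f. qform D G (vec D f))"
  have sc: "vec D (\<lambda>i. complex_of_real c * f i) = complex_of_real c \<cdot>\<^sub>v vec D f" for c f
    by (intro eq_vecI) auto
  have q: "qform D X (complex_of_real c \<cdot>\<^sub>v u) = c\<^sup>2 * qform D X u" if "u \<in> carrier_vec D" for X c u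
    using quadr_sform[of D X] that by (simp add: quadr_def)
  have "\<exists>t f0. (\<forall>i\<ge>D. f0 i = 0) \<and> (\<exists>i. f0 i \<noteq> 0) \<and> k f0 = t * h f0 \<and> (\<forall>f. (\<forall>i\<ge>D. f i = 0) \<longrightarrow> k f \<le> t * h f)"
  proof (rule rayleigh[OF D])
    show "continuous_on UNIV h" "continuous_on UNIV k" unfolding h_def k_def by (rule continuous_sform_vec)+
    show "h (\<lambda>i. complex_of_real c * f i) = c\<^sup>2 * h f" "k (\<lambda>i. complex_of_real c * f i) = c\<^sup>2 * k f" for c f
      unfolding h_def k_def sc by (auto intro!: q)
    fix f :: "nat \<Rightarrow> complex" and i assume "\<forall>i\<ge>D. f i = 0" "f i \<noteq> 0"
    then have "i < D" by (metis not_le)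
    with \<open>f i \<noteq> 0\<close> have "vec D f $ i \<noteq> 0" by simp
    with \<open>i < D\<close> have "vec D f \<noteq> 0\<^sub>v D" by (metis index_zero_vec(1))
    then show "h f > 0" unfolding h_def by (intro F) auto
  qed
  then obtain t where t: "\<And>f. (\<forall>i\<ge>D. f i = 0) \<Longrightarrow> k f \<le> t * h f" by blast
  have "qform D G u \<le> t * qform D F u" if u: "u \<in> carrier_vec D" for u
  proof -
    define f where "f i = (if i < D then u $ i else 0)" for i
    have "vec D f = u" using u by (intro eq_vecI) (auto simp: f_def)
    then show ?thesis using t[of f] by (simp add: h_def k_def f_def)
  qed
  then show ?thesis by blast
qed

lemma sum_swap4:
  "(\<Sum>j\<in>S. \<Sum>l\<in>S. \<Sum>a\<in>T. \<Sum>b\<in>T. X a b j l) = (\<Sum>a\<in>T. \<Sum>b\<in>T. \<Sum>j\<in>S. \<Sum>l\<in>S. X a b j l)"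
  for X :: "'a \<Rightarrow> 'a \<Rightarrow> 'b \<Rightarrow> 'b \<Rightarrow> 'c :: comm_monoid_add"
proof -
  have 1: "(\<Sum>l\<in>S. \<Sum>a\<in>T. \<Sum>b\<in>T. Y a b l) = (\<Sum>a\<in>T. \<Sum>b\<in>T. \<Sum>l\<in>S. Y a b l)"
    for Y :: "'a \<Rightarrow> 'a \<Rightarrow> 'b \<Rightarrow> 'c"
    by (subst sum.swap, rule sum.cong[OF refl], rule sum.swap)
  show ?thesis unfolding 1 ..
qed

section \<open>A positive definite eigenform\<close>

text \<open>The index set is abstract so that the results apply both to words of length k and to
  words of length 2 k. The assumption \<open>nonzero\<close> makes the Perron value
  positive.\<close>

locale graded_family =
  fixes I :: "'a set" and A :: "'a \<Rightarrow> complex mat" and z :: "nat \<Rightarrow> complex" and s :: "'a \<Rightarrow> complex" and D :: nat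
  assumes finI: "finite I" and D0: "D > 0" and Ac: "\<And>i. i \<in> I \<Longrightarrow> A i \<in> carrier_mat D D"
    and z: "parity D z" and s: "\<And>i. i \<in> I \<Longrightarrow> s i \<in> {1, -1}"
    and gr: "\<And>i a b. i \<in> I \<Longrightarrow> a < D \<Longrightarrow> b < D \<Longrightarrow> z a * A i $$ (a, b) = s i * (A i $$ (a, b) * z b)"
    and nonzero: "\<exists>i\<in>I. A i \<noteq> 0\<^sub>m D D"
begin

abbreviation "C \<equiv> (carrier_vec D :: complex vec set)"
abbreviation "sf \<equiv> sform D"
abbreviation "qf \<equiv> qform D"

lemma Av [simp]: "i \<in> I \<Longrightarrow> u \<in> C \<Longrightarrow> A i *\<^sub>v u \<in> C"
  using Ac by (metis mult_mat_vec_carrier)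

lemma pact_A: "i \<in> I \<Longrightarrow> u \<in> C \<Longrightarrow> pact z (A i *\<^sub>v u) = s i \<cdot>\<^sub>v (A i *\<^sub>v pact z u)"
  by (rule graded_mat_vec[OF Ac gr])

text \<open>On the row vectors of entries of F this is right multiplication by the transfer matrix.\<close>

definition dual_map :: "(nat \<times> nat \<Rightarrow> complex) \<Rightarrow> nat \<times> nat \<Rightarrow> complex" where
  "dual_map F = (\<lambda>(j, l). if j < D \<and> l < D
     then (\<Sum>i\<in>I. \<Sum>a<D. \<Sum>b<D. F (a, b) * A i $$ (a, j) * cnj (A i $$ (b, l))) else 0)"

lemma sform_dual:
  assumes u: "u \<in> C" and v: "v \<in> C"
  shows "sf (dual_map F) u v = (\<Sum>i\<in>I. sf F (A i *\<^sub>v u) (A i *\<^sub>v v))"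
proof -
  let ?S = "{..<D}"
  let ?X = "\<lambda>i a b j l. F (a, b) * A i $$ (a, j) * cnj (A i $$ (b, l)) * u $ j * cnj (v $ l)"
  have "sf (dual_map F) u v = (\<Sum>j\<in>?S. \<Sum>l\<in>?S. \<Sum>i\<in>I. \<Sum>a\<in>?S. \<Sum>b\<in>?S. ?X i a b j l)"
    unfolding sform_def dual_map_def by (intro sum.cong refl) (simp add: sum_distrib_right)
  also have "\<dots> = (\<Sum>j\<in>?S. \<Sum>i\<in>I. \<Sum>l\<in>?S. \<Sum>a\<in>?S. \<Sum>b\<in>?S. ?X i a b j l)"
    by (intro sum.cong refl sum.swap)
  also have "\<dots> = (\<Sum>i\<in>I. \<Sum>j\<in>?S. \<Sum>l\<in>?S. \<Sum>a\<in>?S. \<Sum>b\<in>?S. ?X i a b j l)"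
    by (rule sum.swap)
  also have "\<dots> = (\<Sum>i\<in>I. sf F (A i *\<^sub>v u) (A i *\<^sub>v v))"
  proof (rule sum.cong[OF refl])
    fix i assume i: "i \<in> I"
    have "(\<Sum>j\<in>?S. \<Sum>l\<in>?S. \<Sum>a\<in>?S. \<Sum>b\<in>?S. ?X i a b j l) =
      (\<Sum>a\<in>?S. \<Sum>b\<in>?S. \<Sum>j\<in>?S. \<Sum>l\<in>?S. ?X i a b j l)"
      by (rule sum_swap4)
    also have "\<dots> = sf F (A i *\<^sub>v u) (A i *\<^sub>v v)"
      unfolding sform_def
    proof (intro sum.cong refl)
      fix a b assume ab: "a \<in> ?S" "b \<in> ?S"
      then have e: "(A i *\<^sub>v u) $ a = (\<Sum>j<D. A i $$ (a, j) * u $ j)" "(A i *\<^sub>v v) $ b = (\<Sum>l<D. A i $$ (b, l) * v $ l)"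
        using mult_vec_entry[OF Ac[OF i]] u v by auto
      show "(\<Sum>j\<in>?S. \<Sum>l\<in>?S. ?X i a b j l) = F (a, b) * (A i *\<^sub>v u) $ a * cnj ((A i *\<^sub>v v) $ b)"
        unfolding e cnj_sum mult.assoc sum_product unfolding sum_distrib_left
        by (intro sum.cong refl) (simp add: algebra_simps)
    qed
    finally show "(\<Sum>j\<in>?S. \<Sum>l\<in>?S. \<Sum>a\<in>?S. \<Sum>b\<in>?S. ?X i a b j l) = sf F (A i *\<^sub>v u) (A i *\<^sub>v v)" .
  qed
  finally show ?thesis .
qed

lemma qform_dual: "u \<in> C \<Longrightarrow> qf (dual_map F) u = (\<Sum>i\<in>I. qf F (A i *\<^sub>v u))"
  by (simp add: sform_dual)

lemma hermitian_dual:
  assumes F: "hermitian_form D F"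
  shows "hermitian_form D (dual_map F)"
  unfolding hermitian_form_def
proof (intro allI impI)
  fix i k assume ik: "i < D" "k < D"
  have "sf (dual_map F) (unit_vec D k) (unit_vec D i) = cnj (sf (dual_map F) (unit_vec D i) (unit_vec D k))"
    unfolding sform_dual[OF unit_vec_carrier unit_vec_carrier] cnj_sum
    by (intro sum.cong refl hermitian_sform[OF F])
  then show "dual_map F (k, i) = cnj (dual_map F (i, k))" using ik by (simp add: sform_unit)
qed

lemma s_sq: "i \<in> I \<Longrightarrow> s i * cnj (s i) = 1"
  using s by fastforce

text \<open>Each sign s i enters once directly and once conjugated and therefore cancels: even odd
  matrices preserve the parity of forms.\<close>

lemma dual_pact:
  assumes u: "u \<in> C" "v \<in> C"
    and F: "\<And>u v. u \<in> C \<Longrightarrow> v \<in> C \<Longrightarrow> sf F (pact z u) (pact z v) = c * sf F u v"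
  shows "sf (dual_map F) (pact z u) (pact z v) = c * sf (dual_map F) u v"
proof -
  have "sf F (A i *\<^sub>v pact z u) (A i *\<^sub>v pact z v) = c * sf F (A i *\<^sub>v u) (A i *\<^sub>v v)" if i: "i \<in> I" for i
  proof -
    have "c * sf F (A i *\<^sub>v u) (A i *\<^sub>v v) = sf F (pact z (A i *\<^sub>v u)) (pact z (A i *\<^sub>v v))"
      using F i u by simp
    also have "\<dots> = s i * cnj (s i) * sf F (A i *\<^sub>v pact z u) (A i *\<^sub>v pact z v)"
      using i u by (simp add: pact_A sform_simps)
    finally show ?thesis using s_sq[OF i] by simp
  qed
  then show ?thesis using u by (simp add: sform_dual sum_distrib_left)
qed

lemma pact_unit: "i < D \<Longrightarrow> pact z (unit_vec D i) = z i \<cdot>\<^sub>v unit_vec D i"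
  by (intro eq_vecI) (auto simp: unit_vec_def)

lemma even_form_iff:
  "even_form D z F \<longleftrightarrow> (\<forall>u\<in>C. \<forall>v\<in>C. sf F (pact z u) (pact z v) = sf F u v)"
proof
  assume "even_form D z F"
  then show "\<forall>u\<in>C. \<forall>v\<in>C. sf F (pact z u) (pact z v) = sf F u v"
    using even_form_pact[OF z] by blast
next
  assume r: "\<forall>u\<in>C. \<forall>v\<in>C. sf F (pact z u) (pact z v) = sf F u v"
  show "even_form D z F" unfolding even_form_def
  proof (intro allI impI)
    fix i k assume ik: "i < D" "k < D"
    have "cnj (z k) = z k" using z ik by (auto simp: parity_def)
    with r[rule_format, OF unit_vec_carrier unit_vec_carrier, of i k] ik
    show "z i * F (i, k) * z k = F (i, k)" by (simp add: pact_unit sform_simps sform_unit mult.commute)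
  qed
qed

lemma even_dual: "even_form D z F \<Longrightarrow> even_form D z (dual_map F)"
  using dual_pact[of _ _ F 1] by (simp add: even_form_iff)


text \<open>The slice of trace one of the cone of even positive semidefinite forms. The support
  condition leaves only the D x D entries free, which is used for compactness.\<close>

definition cone :: "(nat \<times> nat \<Rightarrow> complex) set" where
  "cone = {F. (\<forall>p. p \<notin> {..<D} \<times> {..<D} \<longrightarrow> F p = 0) \<and> hermitian_form D F \<and> even_form D z F \<and>
     (\<forall>u\<in>C. 0 \<le> qf F u) \<and> (\<Sum>i<D. Re (F (i, i))) = 1}"

text \<open>Positivity is tested on the sum of unit vector i and c times unit vector k, where the
  phase c turns the two mixed terms into minus the modulus of F (i, k). Hence twice that modulus is
  at most the sum of two diagonal entries, each at most the trace 1.\<close>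

lemma cone_bound:
  assumes F: "F \<in> cone" and i: "i < D" and k: "k < D"
  shows "cmod (F (i, k)) \<le> 1"
proof -
  have herm: "hermitian_form D F" and pos: "\<And>u. u \<in> C \<Longrightarrow> 0 \<le> qf F u" and tr: "(\<Sum>i<D. Re (F (i, i))) = 1"
    using F by (auto simp: cone_def)
  have dg: "0 \<le> Re (F (j, j))" if "j < D" for j
    using pos[OF unit_vec_carrier, of j] that by (simp add: sform_unit)
  have dg1: "Re (F (j, j)) \<le> 1" if "j < D" for j
  proof -
    have "Re (F (j, j)) \<le> (\<Sum>i<D. Re (F (i, i)))"
      by (rule member_le_sum[of j "{..<D}" "\<lambda>i. Re (F (i, i))"]) (use that dg in auto)
    then show ?thesis using tr by simp
  qed
  define m where "m = cmod (F (i, k))"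
  show ?thesis
  proof (cases "m = 0")
    case False
    define c where "c = - (F (i, k) / complex_of_real m)"
    have mm: "F (i, k) * cnj (F (i, k)) = complex_of_real (m * m)"
      unfolding m_def by (metis complex_norm_square power2_eq_square of_real_power)
    have cc: "c * cnj c = 1" using False mm by (simp add: c_def)
    have cF: "cnj c * F (i, k) = - complex_of_real m"
      using False mm by (simp add: c_def mult.commute)
    have cF': "c * cnj (F (i, k)) = - complex_of_real m"
      using arg_cong[OF cF, of cnj] by simp
    have "sf F (unit_vec D i + c \<cdot>\<^sub>v unit_vec D k) (unit_vec D i + c \<cdot>\<^sub>v unit_vec D k) =
      F (i, i) + cnj c * F (i, k) + (c * cnj (F (i, k)) + c * cnj c * F (k, k))"
      using i k hermitian_formD[OF herm i k]
      by (simp add: sform_simps sform_unit algebra_simps)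
    also have "\<dots> = F (i, i) + F (k, k) - 2 * complex_of_real m" unfolding cc cF cF' by simp
    finally have "0 \<le> Re (F (i, i)) + Re (F (k, k)) - 2 * m"
      using pos[of "unit_vec D i + c \<cdot>\<^sub>v unit_vec D k"] by simp
    then show ?thesis using dg1[OF i] dg1[OF k] by (simp add: m_def)
  qed (simp add: m_def)
qed

text \<open>Every condition on the pair of r and F is closed, and \<open>cone_bound\<close> places F
  in a compact box.\<close>

lemma compact_feasible:
  "compact {x. fst x \<in> {0..r0} \<and> snd x \<in> cone \<and> (\<forall>u\<in>C. (\<Sum>i\<in>I. qf (snd x) (A i *\<^sub>v u)) \<le> fst x * qf (snd x) u)}"
  (is "compact ?K")
proof -
  define box where "box = {F :: nat \<times> nat \<Rightarrow> complex. (\<forall>p. p \<notin> {..<D} \<times> {..<D} \<longrightarrow> F p = 0) \<and>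
    (\<forall>p\<in>{..<D} \<times> {..<D}. cmod (F p) \<le> 1)}"
  define S1 where "S1 = (\<Inter>i\<in>{..<D}. \<Inter>k\<in>{..<D}. {x :: real \<times> (nat \<times> nat \<Rightarrow> complex). snd x (k, i) = cnj (snd x (i, k))})"
  define S2 where "S2 = (\<Inter>i\<in>{..<D}. \<Inter>k\<in>{..<D}. {x :: real \<times> (nat \<times> nat \<Rightarrow> complex). z i * snd x (i, k) * z k = snd x (i, k)})"
  define S3 where "S3 = (\<Inter>u\<in>C. {x :: real \<times> (nat \<times> nat \<Rightarrow> complex). 0 \<le> qf (snd x) u})"
  define S4 where "S4 = {x :: real \<times> (nat \<times> nat \<Rightarrow> complex). (\<Sum>i<D. Re (snd x (i, i))) = 1}"
  define S5 where "S5 = (\<Inter>u\<in>C. {x :: real \<times> (nat \<times> nat \<Rightarrow> complex). (\<Sum>i\<in>I. qf (snd x) (A i *\<^sub>v u)) \<le> fst x * qf (snd x) u})"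
  have cf: "continuous_on UNIV (\<lambda>x :: real \<times> (nat \<times> nat \<Rightarrow> complex). snd x p)" for p
    by (rule continuous_on_product_then_coordinatewise) (intro continuous_intros)
  have cs: "continuous_on UNIV (\<lambda>x :: real \<times> (nat \<times> nat \<Rightarrow> complex). sf (snd x) u v)" for u v
    unfolding sform_def by (intro continuous_intros cf)
  have "closed S1" unfolding S1_def
    by (intro closed_INT ballI closed_Collect_eq continuous_intros cf)
  moreover have "closed S2" unfolding S2_def
    by (intro closed_INT ballI closed_Collect_eq continuous_intros cf)
  moreover have "closed S3" unfolding S3_def
    by (intro closed_INT ballI closed_Collect_le continuous_intros cs)
  moreover have "closed S4" unfolding S4_def
    by (intro closed_Collect_eq continuous_intros cf)
  moreover have "closed S5" unfolding S5_def
    by (intro closed_INT ballI closed_Collect_le continuous_intros cs)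
  ultimately have cl: "closed (S1 \<inter> S2 \<inter> S3 \<inter> S4 \<inter> S5)" by (intro closed_Int)
  have "compact ({0..r0} \<times> box)" unfolding box_def by (intro compact_Times compact_supported_box) auto
  then have "compact (({0..r0} \<times> box) \<inter> (S1 \<inter> S2 \<inter> S3 \<inter> S4 \<inter> S5))" using cl by (rule compact_Int_closed)
  also have "({0..r0} \<times> box) \<inter> (S1 \<inter> S2 \<inter> S3 \<inter> S4 \<inter> S5) = ?K"
  proof (intro equalityI subsetI)
    fix x assume x: "x \<in> ({0..r0} \<times> box) \<inter> (S1 \<inter> S2 \<inter> S3 \<inter> S4 \<inter> S5)"
    then have "snd x \<in> box" "fst x \<in> {0..r0}" by (auto simp: mem_Times_iff)
    moreover have "snd x \<in> cone"
      using x \<open>snd x \<in> box\<close> unfolding S1_def S2_def S3_def S4_def cone_def hermitian_form_def even_form_def box_def by blast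
    moreover have "\<forall>u\<in>C. (\<Sum>i\<in>I. qf (snd x) (A i *\<^sub>v u)) \<le> fst x * qf (snd x) u"
      using x unfolding S5_def by blast
    ultimately show "x \<in> ?K" by blast
  next
    fix x assume x: "x \<in> ?K"
    then have cone: "snd x \<in> cone" by simp
    then have "snd x \<in> box" using cone_bound[OF cone] by (auto simp: box_def cone_def)
    moreover have "x \<in> S1 \<inter> S2 \<inter> S3 \<inter> S4"
      using cone unfolding S1_def S2_def S3_def S4_def cone_def hermitian_form_def even_form_def by blast
    moreover have "x \<in> S5" using x unfolding S5_def by blast
    ultimately show "x \<in> ({0..r0} \<times> box) \<inter> (S1 \<inter> S2 \<inter> S3 \<inter> S4 \<inter> S5)"
      using x by (simp add: mem_Times_iff)
  qed
  finally show ?thesis .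
qed

text \<open>A Collatz-Wielandt argument for the positive map \<open>dual_map\<close>. Irreducibility
  enters twice: it makes the gap vanish at a suitable minimiser, and it makes the minimiser definite
  because its null space is invariant.\<close>

lemma perron_form:
  assumes irr: "\<And>U. subsp D U \<Longrightarrow> (\<And>u. u \<in> U \<Longrightarrow> pact z u \<in> U) \<Longrightarrow> (\<And>i u. i \<in> I \<Longrightarrow> u \<in> U \<Longrightarrow> A i *\<^sub>v u \<in> U) \<Longrightarrow>
     U = {0\<^sub>v D} \<or> U = C"
  shows "\<exists>r F. r > 0 \<and> hermitian_form D F \<and> even_form D z F \<and> (\<forall>u\<in>C. u \<noteq> 0\<^sub>v D \<longrightarrow> qf F u > 0) \<and>
    (\<forall>u\<in>C. \<forall>v\<in>C. (\<Sum>i\<in>I. sf F (A i *\<^sub>v u) (A i *\<^sub>v v)) = complex_of_real r * sf F u v)"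
proof -
  \<comment> \<open>The identity form scaled to trace one; it shows that the set of feasible pairs
    is nonempty.\<close>
  define F0 where "F0 = (\<lambda>(i, k). if i = k \<and> i < D then complex_of_real (1 / D) else 0)"
  have F0q: "sf F0 u u = complex_of_real (1 / D * (\<Sum>i<D. (cmod (u $ i))\<^sup>2))" if "u \<in> C" for u
  proof -
    have "sf F0 u u = (\<Sum>i<D. complex_of_real (1 / D) * (u $ i * cnj (u $ i)))"
      unfolding sform_def
    proof (rule sum.cong[OF refl])
      fix i assume "i \<in> {..<D}"
      have "(\<Sum>k<D. F0 (i, k) * u $ i * cnj (u $ k)) = (\<Sum>k<D. if k = i then complex_of_real (1 / D) * (u $ i * cnj (u $ i)) else 0)"
        using \<open>i \<in> {..<D}\<close> by (intro sum.cong) (auto simp: F0_def)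
      then show "(\<Sum>k<D. F0 (i, k) * u $ i * cnj (u $ k)) = complex_of_real (1 / D) * (u $ i * cnj (u $ i))"
        using \<open>i \<in> {..<D}\<close> by simp
    qed
    also have "\<dots> = (\<Sum>i<D. complex_of_real (1 / D) * complex_of_real ((cmod (u $ i))\<^sup>2))"
      by (simp only: complex_norm_square)
    finally show ?thesis by (simp add: sum_distrib_left)
  qed
  have F0pos: "qf F0 u > 0" if u: "u \<in> C" "u \<noteq> 0\<^sub>v D" for u
  proof -
    obtain i where i: "i < D" "u $ i \<noteq> 0" using u by (metis carrier_vecD eq_vecI index_zero_vec)
    then have "0 < (\<Sum>i<D. (cmod (u $ i))\<^sup>2)" by (intro sum_pos2[of _ i]) auto
    then show ?thesis unfolding F0q[OF u(1)] using D0 by simp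
  qed
  have F0nn: "qf F0 u \<ge> 0" if "u \<in> C" for u
    unfolding F0q[OF that] by (simp add: sum_nonneg)
  have F0c: "F0 \<in> cone"
    unfolding cone_def hermitian_form_def even_form_def
    using F0nn z D0 by (auto simp: F0_def parity_def)
  from rayleigh_sform[OF D0 F0pos, of "dual_map F0"] obtain t where
    t: "\<And>u. u \<in> C \<Longrightarrow> qf (dual_map F0) u \<le> t * qf F0 u" by blast
  \<comment> \<open>Values of r above r0 are irrelevant for the minimum, which confines r to a
    compact interval.\<close>
  define r0 where "r0 = max 0 t"
  let ?ok = "\<lambda>r F. F \<in> cone \<and> (\<forall>u\<in>C. (\<Sum>i\<in>I. qf F (A i *\<^sub>v u)) \<le> r * qf F u)"
  let ?K = "{x. fst x \<in> {0..r0} \<and> snd x \<in> cone \<and> (\<forall>u\<in>C. (\<Sum>i\<in>I. qf (snd x) (A i *\<^sub>v u)) \<le> fst x * qf (snd x) u)}"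
  have ok0: "?ok r0 F0"
  proof (intro conjI ballI F0c)
    fix u assume u: "u \<in> C"
    have "t * qf F0 u \<le> r0 * qf F0 u" using F0nn[OF u] by (intro mult_right_mono) (simp add: r0_def)
    with t[OF u] show "(\<Sum>i\<in>I. qf F0 (A i *\<^sub>v u)) \<le> r0 * qf F0 u" by (simp add: qform_dual[OF u, symmetric])
  qed
  have "(r0, F0) \<in> ?K" using ok0 by (simp add: r0_def)
  then have ne: "?K \<noteq> {}" by blast
  have cont: "continuous_on ?K fst" by (intro continuous_intros)
  from continuous_attains_inf[OF compact_feasible ne cont]
  obtain x where x: "x \<in> ?K" and xmin': "\<forall>y\<in>?K. fst x \<le> fst y" by (rule bexE)
  note xmin = bspec[OF xmin']
  define r where "r = fst x"
  have r0: "r \<ge> 0" "r \<le> r0" using x by (auto simp: r_def)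
  have rmin: "r \<le> r'" if "0 \<le> r'" "?ok r' F" for r' F
  proof (cases "r' \<le> r0")
    case True
    then have "(r', F) \<in> ?K" using that by simp
    from xmin[OF this] show ?thesis by (simp add: r_def)
  qed (use r0 in simp)
  \<comment> \<open>Among the minimisers of r choose one whose gap r F - dual F has the smallest null space. Passing
    to F + dual F shows that this null space is invariant, hence trivial, and a positive definite
    gap would allow a smaller r.\<close>
  define gap where "gap F u = r * qf F u + (-1) * qf (dual_map F) u" for F u
  define N where "N F = {u \<in> C. gap F u = 0}" for F
  have gq: "quadr D (gap F)" for F unfolding gap_def by (intro quadr_lin quadr_sform)
  have gnn: "gap F u \<ge> 0" if "?ok r F" "u \<in> C" for F u
    using that unfolding gap_def by (simp add: qform_dual)
  have Nsub: "subsp D (N F)" if "?ok r F" for F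
    unfolding N_def using gq gnn[OF that] by (rule subsp_null)
  have "?ok r (snd x)" using x by (simp add: r_def)
  from ex_has_least_nat[of "?ok r", OF this, of "\<lambda>F. card (pivots D (N F))"]
  obtain F where F: "?ok r F" and Fmin: "\<And>G. ?ok r G \<Longrightarrow> card (pivots D (N F)) \<le> card (pivots D (N G))"
    by blast
  have herm: "hermitian_form D F" and even: "even_form D z F" and pos: "\<And>u. u \<in> C \<Longrightarrow> 0 \<le> qf F u"
    and tr: "(\<Sum>i<D. Re (F (i, i))) = 1" and supp: "\<And>p. p \<notin> {..<D} \<times> {..<D} \<Longrightarrow> F p = 0"
    using F by (auto simp: cone_def)
  have le: "qf (dual_map F) u \<le> r * qf F u" if "u \<in> C" for u using F that by (simp add: qform_dual)
  have dpos: "0 \<le> qf (dual_map F) u" if "u \<in> C" for u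
    unfolding qform_dual[OF that] using pos that by (intro sum_nonneg) simp
  have evq: "qf G (pact z u) = qf G u" if "even_form D z G" "u \<in> C" for G u
    using even_form_pact[OF z that(1) that(2,2)] by simp
  \<comment> \<open>The trace of F + dual F, since F has trace one; dividing by it brings the sum
    back into \<open>cone\<close>.\<close>
  define c where "c = 1 + (\<Sum>i<D. Re (dual_map F (i, i)))"
  have "0 \<le> (\<Sum>i<D. Re (dual_map F (i, i)))"
  proof (rule sum_nonneg)
    fix i assume "i \<in> {..<D}"
    then show "0 \<le> Re (dual_map F (i, i))" using dpos[OF unit_vec_carrier, of i] by (simp add: sform_unit)
  qed
  then have c0: "c > 0" by (simp add: c_def)
  define a where "a = complex_of_real (1 / c)"
  define G where "G = (\<lambda>p. a * F p + a * dual_map F p)"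
  have qG: "qf G u = (qf F u + qf (dual_map F) u) / c" for u
    unfolding G_def sform_lin by (simp add: a_def add_divide_distrib)
  have Gc: "G \<in> cone"
  proof -
    have "hermitian_form D G" unfolding G_def a_def by (rule hermitian_lin[OF herm hermitian_dual[OF herm]])
    moreover have "even_form D z G"
    proof -
      have "z i * G (i, k) * z k = G (i, k)" if ik: "i < D" "k < D" for i k
      proof -
        have "z i * G (i, k) * z k = a * (z i * F (i, k) * z k) + a * (z i * dual_map F (i, k) * z k)"
          by (simp add: G_def algebra_simps)
        moreover have "z i * F (i, k) * z k = F (i, k)"
          using even ik unfolding even_form_def by blast
        moreover have "z i * dual_map F (i, k) * z k = dual_map F (i, k)"
          using even_dual[OF even] ik unfolding even_form_def by blast
        ultimately show ?thesis by (simp only: G_def)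
      qed
      then show ?thesis by (simp add: even_form_def)
    qed
    moreover have "(\<Sum>i<D. Re (G (i, i))) = 1"
    proof -
      have "(\<Sum>i<D. Re (G (i, i))) = (\<Sum>i<D. (Re (F (i, i)) + Re (dual_map F (i, i))) / c)"
        by (intro sum.cong) (auto simp: G_def a_def add_divide_distrib)
      also have "\<dots> = c / c" unfolding sum_divide_distrib[symmetric] sum.distrib tr c_def ..
      finally show ?thesis using c0 by simp
    qed
    moreover have "\<forall>u\<in>C. 0 \<le> qf G u" using pos dpos c0 by (simp add: qG)
    moreover have "\<forall>p. p \<notin> {..<D} \<times> {..<D} \<longrightarrow> G p = 0"
      using supp by (auto simp: G_def dual_map_def)
    ultimately show ?thesis by (simp add: cone_def)
  qed
  \<comment> \<open>The gap is linear in F and compatible with \<open>dual_map\<close>, so the gap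
    of G is, up to the factor c, the gap of F plus its image. Both parts are nonnegative, hence a
    null vector of G is null for F together with all its images.\<close>
  have gapG: "gap G u = (gap F u + (\<Sum>i\<in>I. gap F (A i *\<^sub>v u))) / c" if u: "u \<in> C" for u
  proof -
    define Y where "Y = (\<Sum>i\<in>I. qf (dual_map F) (A i *\<^sub>v u))"
    have 1: "qf (dual_map G) u = (qf (dual_map F) u + Y) / c"
      unfolding qform_dual[OF u, of G] qform_dual[OF u, of F] qG Y_def sum.distrib sum_divide_distrib[symmetric] ..
    have 2: "(\<Sum>i\<in>I. gap F (A i *\<^sub>v u)) = r * qf (dual_map F) u + (-1) * Y"
      unfolding gap_def sum.distrib sum_distrib_left[symmetric] qform_dual[OF u, of F] Y_def ..
    show ?thesis unfolding 2 unfolding gap_def 1 qG using c0 by (simp add: field_simps)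
  qed
  have G: "?ok r G"
  proof (intro conjI ballI Gc)
    fix u assume u: "u \<in> C"
    have "0 \<le> gap G u" unfolding gapG[OF u] using gnn[OF F] u c0 by (simp add: sum_nonneg)
    then show "(\<Sum>i\<in>I. qf G (A i *\<^sub>v u)) \<le> r * qf G u" using u by (simp add: gap_def qform_dual)
  qed
  have NG: "u \<in> N F \<and> (\<forall>i\<in>I. A i *\<^sub>v u \<in> N F)" if "u \<in> N G" for u
  proof -
    have u: "u \<in> C" and "gap G u = 0" using that by (auto simp: N_def)
    then have 0: "gap F u + (\<Sum>i\<in>I. gap F (A i *\<^sub>v u)) = 0" using gapG[OF u] c0 by simp
    have 1: "0 \<le> gap F u" "\<And>i. i \<in> I \<Longrightarrow> 0 \<le> gap F (A i *\<^sub>v u)" using gnn[OF F] u by auto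
    have "0 \<le> (\<Sum>i\<in>I. gap F (A i *\<^sub>v u))" using 1(2) by (rule sum_nonneg)
    then have 2: "gap F u = 0" "(\<Sum>i\<in>I. gap F (A i *\<^sub>v u)) = 0" using 0 1(1) by linarith+
    then have "\<forall>i\<in>I. gap F (A i *\<^sub>v u) = 0" using sum_nonneg_eq_0_iff[OF finI, of "\<lambda>i. gap F (A i *\<^sub>v u)"] 1 by simp
    then show ?thesis using u 2 by (auto simp: N_def)
  qed
  have sub: "N G \<subseteq> N F" using NG by blast
  have "pivots D (N G) = pivots D (N F)"
    using Fmin[OF G] pivots_mono[OF sub] finite_pivots by (metis card_seteq)
  then have NFG: "N F \<subseteq> N G" by (intro pivots_eq_imp_eq[OF Nsub[OF G] Nsub[OF F] sub]) simp
  have NA: "A i *\<^sub>v u \<in> N F" if "i \<in> I" "u \<in> N F" for i u using NG NFG that by blast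
  have Nz: "pact z u \<in> N F" if "u \<in> N F" for u
    using that evq[OF even, of u] evq[OF even_dual[OF even], of u] by (simp add: N_def gap_def)
  have Nall: "N F = C"
  proof (rule ccontr)
    assume "N F \<noteq> C"
    then have N0: "N F = {0\<^sub>v D}" using irr[OF Nsub[OF F] Nz NA] by blast
    define Gm where "Gm = (\<lambda>p. complex_of_real r * F p + (-1) * dual_map F p)"
    have qm: "qf Gm u = gap F u" for u unfolding Gm_def sform_lin by (simp add: gap_def)
    have gpos: "qf Gm u > 0" if "u \<in> C" "u \<noteq> 0\<^sub>v D" for u
    proof -
      have "u \<notin> N F" using that N0 by simp
      then show ?thesis using gnn[OF F that(1)] that(1) unfolding qm by (auto simp: N_def)
    qed
    from rayleigh_sform[OF D0 gpos, of F] obtain t where t: "\<And>u. u \<in> C \<Longrightarrow> qf F u \<le> t * gap F u"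
      unfolding qm by blast
    have "\<exists>i<D. Re (F (i, i)) > 0"
    proof (rule ccontr)
      assume "\<not> ?thesis"
      then have "(\<Sum>i<D. Re (F (i, i))) \<le> 0" by (intro sum_nonpos) (metis lessThan_iff not_less)
      then show False using tr by simp
    qed
    then obtain i where i: "i < D" and "Re (F (i, i)) > 0" by blast
    define e where "e = (unit_vec D i :: complex vec)"
    have e: "e \<in> C" and qe: "qf F e > 0" using i \<open>Re (F (i, i)) > 0\<close> by (auto simp: e_def sform_unit)
    have "0 < t * gap F e" using t[OF e] qe by linarith
    then have t0: "t > 0" using gnn[OF F e] by (simp add: zero_less_mult_iff)
    \<comment> \<open>F is at most t times (r F - dual F); solving for dual F gives the bound (r -
      1/t) F, against the minimality of r.\<close>
    define r' where "r' = r - 1 / t"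
    have r': "qf (dual_map F) u \<le> r' * qf F u" if "u \<in> C" for u
    proof -
      have "qf F u / t \<le> gap F u" using t[OF that] t0 by (simp add: field_simps)
      then show ?thesis by (simp add: gap_def r'_def algebra_simps)
    qed
    have "0 \<le> r' * qf F e" using r'[OF e] dpos[OF e] by linarith
    then have "0 \<le> r'" using qe by (simp add: zero_le_mult_iff)
    moreover have "?ok r' F" using F r' by (simp add: qform_dual)
    ultimately have "r \<le> r'" by (rule rmin)
    then show False using t0 by (simp add: r'_def)
  qed
  have eqq: "qf (dual_map F) u = r * qf F u" if "u \<in> C" for u
  proof -
    have "u \<in> N F" using that Nall by simp
    then show ?thesis by (simp add: N_def gap_def)
  qed
  have main: "(\<Sum>i\<in>I. sf F (A i *\<^sub>v u) (A i *\<^sub>v v)) = complex_of_real r * sf F u v" if "u \<in> C" "v \<in> C" for u v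
  proof -
    \<comment> \<open>So far equality holds only for equal arguments; polarization of the hermitian
      difference extends it to the sesquilinear forms.\<close>
    define X where "X = (\<lambda>p. 1 * dual_map F p + (- complex_of_real r) * F p)"
    have "hermitian_form D X" unfolding X_def
      using hermitian_lin[OF hermitian_dual[OF herm] herm, of 1 "- r"] by simp
    moreover have "qf X w = 0" if "w \<in> C" for w unfolding X_def sform_lin using eqq[OF that] by simp
    ultimately have "sf X u v = 0" using that by (rule polarization)
    then show ?thesis unfolding X_def sform_lin using that by (simp add: sform_dual)
  qed
  define M where "M = {u \<in> C. qf F u = 0}"
  have Msub: "subsp D M" unfolding M_def by (rule subsp_null[OF quadr_sform pos])
  have "M = {0\<^sub>v D} \<or> M = C"
  proof (rule irr[OF Msub])
    show "pact z u \<in> M" if "u \<in> M" for u using that evq[OF even, of u] by (simp add: M_def)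
    fix i u assume i: "i \<in> I" and "u \<in> M"
    then have u: "u \<in> C" "qf F u = 0" by (auto simp: M_def)
    then have "(\<Sum>i\<in>I. qf F (A i *\<^sub>v u)) = 0" using eqq[OF u(1)] by (simp add: qform_dual)
    then have "\<forall>i\<in>I. qf F (A i *\<^sub>v u) = 0" using sum_nonneg_eq_0_iff[OF finI, of "\<lambda>i. qf F (A i *\<^sub>v u)"] pos u by simp
    then show "A i *\<^sub>v u \<in> M" using i u by (simp add: M_def)
  qed
  moreover have "M \<noteq> C"
  proof
    assume "M = C"
    then have "Re (F (i, i)) = 0" if "i < D" for i
    proof -
      have "unit_vec D i \<in> M" using \<open>M = C\<close> by simp
      then show ?thesis using that by (simp add: M_def sform_unit)
    qed
    then show False using tr by simp
  qed
  ultimately have M0: "M = {0\<^sub>v D}" by blast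
  have def: "qf F u > 0" if "u \<in> C" "u \<noteq> 0\<^sub>v D" for u
  proof -
    have "u \<notin> M" using that M0 by simp
    then show ?thesis using pos[OF that(1)] that(1) by (auto simp: M_def)
  qed
  have "r > 0"
  proof (rule ccontr)
    assume "\<not> r > 0"
    then have r: "r = 0" using r0 by simp
    from nonzero obtain i where i: "i \<in> I" "A i \<noteq> 0\<^sub>m D D" by blast
    have "A i *\<^sub>v u = 0\<^sub>v D" if u: "u \<in> C" for u
    proof (rule ccontr)
      assume "A i *\<^sub>v u \<noteq> 0\<^sub>v D"
      then have "0 < qf F (A i *\<^sub>v u)" using i u by (intro def) auto
      also have "\<dots> \<le> (\<Sum>i\<in>I. qf F (A i *\<^sub>v u))"
        by (rule member_le_sum[OF i(1) _ finI]) (use pos u in simp)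
      finally show False using eqq[OF u] u r by (simp add: qform_dual)
    qed
    then have "A i $$ (a, b) = 0" if "a < D" "b < D" for a b
    proof -
      have "A i $$ (a, b) = (A i *\<^sub>v unit_vec D b) $ a" using Ac[OF i(1)] that by simp
      also have "\<dots> = 0" using \<open>\<And>u. u \<in> C \<Longrightarrow> A i *\<^sub>v u = 0\<^sub>v D\<close>[OF unit_vec_carrier] that by simp
      finally show ?thesis .
    qed
    then have "A i = 0\<^sub>m D D" using Ac[OF i(1)] by (intro eq_matI) auto
    with i show False by simp
  qed
  then show ?thesis using herm even def main by blast
qed

end

section \<open>Eigenforms of modulus one\<close>

lemma linear_matrix:
  fixes f :: "complex vec \<Rightarrow> complex vec"
  assumes c: "\<And>u. u \<in> carrier_vec D \<Longrightarrow> f u \<in> carrier_vec D"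
    and add: "\<And>u v. u \<in> carrier_vec D \<Longrightarrow> v \<in> carrier_vec D \<Longrightarrow> f (u + v) = f u + f v"
    and smult: "\<And>a u. u \<in> carrier_vec D \<Longrightarrow> f (a \<cdot>\<^sub>v u) = a \<cdot>\<^sub>v f u"
  shows "\<exists>G\<in>carrier_mat D D. \<forall>u\<in>carrier_vec D. G *\<^sub>v u = f u"
proof -
  define G where "G = mat D D (\<lambda>(a, b). f (unit_vec D b) $ a)"
  have G: "G \<in> carrier_mat D D" by (simp add: G_def)
  have unit: "G *\<^sub>v unit_vec D b = f (unit_vec D b)" if "b < D" for b
    using that c[OF unit_vec_carrier, of b] G by (intro eq_vecI) (auto simp: G_def)
  have "G *\<^sub>v u = f u" if "u \<in> carrier_vec D" "\<forall>i<D. k \<le> i \<longrightarrow> u $ i = 0" "k \<le> D" for u k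
    using that
  proof (induction k arbitrary: u)
    case 0
    then have u: "u = 0 \<cdot>\<^sub>v u" by (intro eq_vecI) auto
    have "G *\<^sub>v u = 0 \<cdot>\<^sub>v (G *\<^sub>v u)" by (subst u) (rule mult_mat_vec[OF G 0(1)])
    moreover have "f u = 0 \<cdot>\<^sub>v f u" by (subst u) (rule smult[OF 0(1)])
    moreover have "0 \<cdot>\<^sub>v w = 0\<^sub>v D" if "w \<in> carrier_vec D" for w :: "complex vec"
      using that by (intro eq_vecI) auto
    ultimately show ?case using c[OF 0(1)] mult_mat_vec_carrier[OF G 0(1)] by simp
  next
    case (Suc k)
    define u' where "u' = vec D (\<lambda>i. if i = k then 0 else u $ i)"
    have u': "u' \<in> carrier_vec D" by (simp add: u'_def)
    have dec: "u = u' + u $ k \<cdot>\<^sub>v unit_vec D k" using Suc.prems by (intro eq_vecI) (auto simp: u'_def)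
    have IH: "G *\<^sub>v u' = f u'" by (rule Suc.IH[OF u']) (use Suc.prems in \<open>auto simp: u'_def\<close>)
    have "G *\<^sub>v u = G *\<^sub>v u' + u $ k \<cdot>\<^sub>v (G *\<^sub>v unit_vec D k)"
      by (subst dec) (use u' in \<open>simp add: mult_add_distrib_mat_vec[OF G] mult_mat_vec[OF G]\<close>)
    also have "\<dots> = f u' + u $ k \<cdot>\<^sub>v f (unit_vec D k)" using unit[of k] Suc.prems IH by simp
    also have "\<dots> = f (u' + u $ k \<cdot>\<^sub>v unit_vec D k)" using u' by (simp add: add smult)
    also have "\<dots> = f u" unfolding dec[symmetric] ..
    finally show ?case .
  qed
  from this[of _ D] have "\<forall>u\<in>carrier_vec D. G *\<^sub>v u = f u" by auto
  with G show ?thesis by blast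
qed

lemma linear_coefficient_zero:
  fixes a b :: real
  assumes "\<And>s. a * s\<^sup>2 + b * s \<ge> 0" and "a \<ge> 0"
  shows "b = 0"
proof (rule ccontr)
  assume b: "b \<noteq> 0"
  \<comment> \<open>Dividing by a + 1 instead of a covers a = 0 as well; at -x the expression is
    minus the square of x.\<close>
  define x where "x = b / (a + 1)"
  have bx: "b = x * (a + 1)" using assms(2) by (simp add: x_def)
  have "a * (- x)\<^sup>2 + b * (- x) = - x\<^sup>2" unfolding bx by (simp add: algebra_simps power2_eq_square)
  with assms(1)[of "- x"] have "x\<^sup>2 \<le> 0" by linarith
  then have "x = 0" by simp
  with bx b show False by simp
qed

lemma two_dim_dependence: "\<exists>a b :: complex. (a \<noteq> 0 \<or> b \<noteq> 0) \<and> a * p + b * q = 0"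
proof (cases "p = 0")
  case False
  then show ?thesis by (intro exI[of _ "- q"] exI[of _ p]) simp
qed (intro exI[of _ 1] exI[of _ 0], simp)

lemma three_vectors_dependence:
  fixes x0 x1 x2 y0 y1 y2 :: complex
  shows "\<exists>a b c. (a \<noteq> 0 \<or> b \<noteq> 0 \<or> c \<noteq> 0) \<and> a * x0 + b * x1 + c * x2 = 0 \<and> a * y0 + b * y1 + c * y2 = 0"
proof -
  consider "x0 \<noteq> 0" | "x0 = 0" "x1 \<noteq> 0" | "x0 = 0" "x1 = 0" by blast
  then show ?thesis
  proof cases
    case 1
    obtain b c where bc: "b \<noteq> 0 \<or> c \<noteq> 0" "b * (y1 - x1 * y0 / x0) + c * (y2 - x2 * y0 / x0) = 0"
      using two_dim_dependence by blast
    define a where "a = - (b * x1 + c * x2) / x0"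
    have "a * x0 + b * x1 + c * x2 = 0" using 1 by (simp add: a_def)
    moreover have "a * y0 + b * y1 + c * y2 = b * (y1 - x1 * y0 / x0) + c * (y2 - x2 * y0 / x0)"
      using 1 by (simp add: a_def field_simps)
    ultimately show ?thesis using bc by metis
  next
    case 2
    obtain a c where ac: "a \<noteq> 0 \<or> c \<noteq> 0" "a * y0 + c * (y2 - x2 * y1 / x1) = 0"
      using two_dim_dependence by blast
    define b where "b = - (c * x2) / x1"
    have "a * x0 + b * x1 + c * x2 = 0" using 2 by (simp add: b_def)
    moreover have "a * y0 + b * y1 + c * y2 = a * y0 + c * (y2 - x2 * y1 / x1)"
      using 2 by (simp add: b_def field_simps)
    ultimately show ?thesis using ac by metis
  next
    case 3
    obtain a b where "a \<noteq> 0 \<or> b \<noteq> 0" "a * y0 + b * y1 = 0" using two_dim_dependence by blast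
    then show ?thesis using 3 by (intro exI[of _ a] exI[of _ b] exI[of _ 0]) simp
  qed
qed

definition word_act :: "('a \<Rightarrow> complex mat) \<Rightarrow> 'a list \<Rightarrow> complex vec \<Rightarrow> complex vec" where
  "word_act A w u = foldr (\<lambda>i v. A i *\<^sub>v v) w u"

text \<open>The case m = 1 of \<open>stable\<close> is irreducibility, while larger m rule out
  periodicity. The form h is a Perron form after the matrices have been scaled so that its
  eigenvalue is 1.\<close>

locale stable_family = graded_family +
  fixes h :: "nat \<times> nat \<Rightarrow> complex"
  assumes stable: "\<And>m U. m \<ge> 1 \<Longrightarrow> subsp D U \<Longrightarrow> (\<And>u. u \<in> U \<Longrightarrow> pact z u \<in> U) \<Longrightarrow>
      (\<And>w u. set w \<subseteq> I \<Longrightarrow> length w = m \<Longrightarrow> u \<in> U \<Longrightarrow> word_act A w u \<in> U) \<Longrightarrow>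
      U = {0\<^sub>v D} \<or> U = carrier_vec D"
    and h_herm: "hermitian_form D h" and h_even: "even_form D z h"
    and h_pos: "\<And>u. u \<in> carrier_vec D \<Longrightarrow> u \<noteq> 0\<^sub>v D \<Longrightarrow> qform D h u > 0"
    and h_inv: "\<And>u v. u \<in> carrier_vec D \<Longrightarrow> v \<in> carrier_vec D \<Longrightarrow>
      (\<Sum>i\<in>I. sform D h (A i *\<^sub>v u) (A i *\<^sub>v v)) = sform D h u v"
begin

lemma irreducible:
  assumes "subsp D U" "\<And>u. u \<in> U \<Longrightarrow> pact z u \<in> U" "\<And>i u. i \<in> I \<Longrightarrow> u \<in> U \<Longrightarrow> A i *\<^sub>v u \<in> U"
  shows "U = {0\<^sub>v D} \<or> U = C"
proof (rule stable[of 1 U])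
  fix w u assume w: "set w \<subseteq> I" "length w = 1" and u: "u \<in> U"
  then obtain i where "w = [i]" "i \<in> I" by (metis One_nat_def length_0_conv length_Suc_conv list.set_intros(1) subsetD)
  then show "word_act A w u \<in> U" using assms(3) u by (simp add: word_act_def)
qed (use assms in auto)

lemma h_nn: "u \<in> C \<Longrightarrow> qf h u \<ge> 0"
proof (cases "u = 0\<^sub>v D")
  case True
  then have "sf h u u = 0" by (simp add: sform_def)
  then show ?thesis by simp
qed (use h_pos in force)

lemma h_zero: "u \<in> C \<Longrightarrow> qf h u = 0 \<Longrightarrow> u = 0\<^sub>v D"
  using h_pos by force

lemma h_qinv: "u \<in> C \<Longrightarrow> (\<Sum>i\<in>I. qf h (A i *\<^sub>v u)) = qf h u"
  using h_inv[of u u] by (metis Re_sum)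

lemma h_scale: "u \<in> C \<Longrightarrow> qf h (c \<cdot>\<^sub>v u) = (cmod c)\<^sup>2 * qf h u"
  using quadr_sform[of D h] by (simp add: quadr_def)

text \<open>By invariance of h a vector killed by all A i has h-norm zero. In
  \<open>commuting_scalar\<close> this keeps the chain of eigenspaces from dying out.\<close>

lemma exists_nonzero_image:
  assumes "u \<in> C" "u \<noteq> 0\<^sub>v D"
  shows "\<exists>i\<in>I. A i *\<^sub>v u \<noteq> 0\<^sub>v D"
proof (rule ccontr)
  assume "\<not> ?thesis"
  then have "A i *\<^sub>v u = 0\<^sub>v D" if "i \<in> I" for i using that by blast
  then have "(\<Sum>i\<in>I. qf h (A i *\<^sub>v u)) = 0" by (simp add: sform_def)
  then show False using h_qinv[OF assms(1)] h_pos[OF assms] by simp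
qed

text \<open>Equality is tested on vectors because entries of a form at indices beyond D are
  arbitrary; \<open>vanishes\<close> is the matching notion of zero.\<close>

definition eigenform :: "(nat \<times> nat \<Rightarrow> complex) \<Rightarrow> complex \<Rightarrow> bool" where
  "eigenform g lam \<longleftrightarrow> (\<forall>u\<in>C. \<forall>v\<in>C. sf (dual_map g) u v = lam * sf g u v)"

lemma eigenformD: "eigenform g lam \<Longrightarrow> u \<in> C \<Longrightarrow> v \<in> C \<Longrightarrow> (\<Sum>i\<in>I. sf g (A i *\<^sub>v u) (A i *\<^sub>v v)) = lam * sf g u v"
  by (simp add: eigenform_def sform_dual)

definition vanishes :: "(nat \<times> nat \<Rightarrow> complex) \<Rightarrow> bool" where
  "vanishes g \<longleftrightarrow> (\<forall>u\<in>C. \<forall>v\<in>C. sf g u v = 0)"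

text \<open>t is the norm of g relative to h, attained at some pair. A pair is encoded as one
  function on 2 D coordinates so that \<open>rayleigh\<close> applies.\<close>

lemma rayleigh_pairs:
  "\<exists>t u v. u \<in> C \<and> v \<in> C \<and> (u \<noteq> 0\<^sub>v D \<or> v \<noteq> 0\<^sub>v D) \<and> 2 * Re (sf g u v) = t * (qf h u + qf h v) \<and>
    (\<forall>u\<in>C. \<forall>v\<in>C. 2 * Re (sf g u v) \<le> t * (qf h u + qf h v))"
proof -
  define a b where "a = (\<lambda>f :: nat \<Rightarrow> complex. vec D f)" and "b = (\<lambda>f :: nat \<Rightarrow> complex. vec D (\<lambda>i. f (D + i)))"
  define hh kk where "hh = (\<lambda>f. qf h (a f) + qf h (b f))" and "kk = (\<lambda>f. 2 * Re (sf g (a f) (b f)))"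
  have ac: "a f \<in> C" "b f \<in> C" for f by (auto simp: a_def b_def)
  have sc: "a (\<lambda>i. complex_of_real c * f i) = complex_of_real c \<cdot>\<^sub>v a f"
    "b (\<lambda>i. complex_of_real c * f i) = complex_of_real c \<cdot>\<^sub>v b f" for c f
    unfolding a_def b_def by (auto intro!: eq_vecI)
  have "\<exists>t f0. (\<forall>i\<ge>2 * D. f0 i = 0) \<and> (\<exists>i. f0 i \<noteq> 0) \<and> kk f0 = t * hh f0 \<and>
    (\<forall>f. (\<forall>i\<ge>2 * D. f i = 0) \<longrightarrow> kk f \<le> t * hh f)"
  proof (rule rayleigh)
    show "2 * D > 0" using D0 by simp
    show "continuous_on UNIV hh" "continuous_on UNIV kk"
      unfolding hh_def kk_def a_def b_def sform_def
      by (simp_all, (intro continuous_intros continuous_on_product_coordinates)+)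
    show "hh (\<lambda>i. complex_of_real c * f i) = c\<^sup>2 * hh f" for c f
      unfolding hh_def sc using h_scale[OF ac(1)] h_scale[OF ac(2)] by (simp add: algebra_simps)
    show "kk (\<lambda>i. complex_of_real c * f i) = c\<^sup>2 * kk f" for c f
      unfolding kk_def sc using ac by (simp add: sform_simps power2_eq_square)
    fix f :: "nat \<Rightarrow> complex" and i assume f: "\<forall>i\<ge>2 * D. f i = 0" "f i \<noteq> 0"
    then have i: "i < 2 * D" by (metis not_le)
    have "a f \<noteq> 0\<^sub>v D \<or> b f \<noteq> 0\<^sub>v D"
    proof (cases "i < D")
      case True
      then have "a f $ i \<noteq> 0" using f by (simp add: a_def)
      with True show ?thesis by (metis index_zero_vec(1))
    next
      case False
      then have "b f $ (i - D) \<noteq> 0" "i - D < D" using f i by (auto simp: b_def)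
      then show ?thesis by (metis index_zero_vec(1))
    qed
    then show "hh f > 0" unfolding hh_def
      using h_pos[OF ac(1), of f] h_pos[OF ac(2), of f] h_nn[OF ac(1), of f] h_nn[OF ac(2), of f] by linarith
  qed
  then obtain t f0 where f0: "\<forall>i\<ge>2 * D. f0 i = 0" "\<exists>i. f0 i \<noteq> 0" and eq: "kk f0 = t * hh f0"
    and le: "\<And>f. (\<forall>i\<ge>2 * D. f i = 0) \<Longrightarrow> kk f \<le> t * hh f" by blast
  from f0 obtain i where i: "f0 i \<noteq> 0" "i < 2 * D" by (metis not_le)
  have "a f0 \<noteq> 0\<^sub>v D \<or> b f0 \<noteq> 0\<^sub>v D"
  proof (cases "i < D")
    case True
    then have "a f0 $ i \<noteq> 0" using i by (simp add: a_def)
    with True show ?thesis by (metis index_zero_vec(1))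
  next
    case False
    then have "b f0 $ (i - D) \<noteq> 0" "i - D < D" using i by (auto simp: b_def)
    then show ?thesis by (metis index_zero_vec(1))
  qed
  moreover have "2 * Re (sf g u v) \<le> t * (qf h u + qf h v)" if uv: "u \<in> C" "v \<in> C" for u v
  proof -
    define f where "f i = (if i < D then u $ i else if i < 2 * D then v $ (i - D) else 0)" for i
    have "a f = u" "b f = v" using uv by (auto simp: a_def b_def f_def intro!: eq_vecI)
    then show ?thesis using le[of f] by (simp add: f_def kk_def hh_def)
  qed
  ultimately show ?thesis using eq ac unfolding kk_def hh_def by blast
qed

text \<open>The form q in the proof is nonnegative and preserved by (u, v) to (A u, lam A v), so its null
  pairs form an invariant subspace; this subspace is the graph of G.\<close>

lemma intertwiner:
  assumes g: "eigenform g lam" and lam: "cmod lam = 1" and ne: "\<not> vanishes g"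
    and par: "\<And>u v. u \<in> C \<Longrightarrow> v \<in> C \<Longrightarrow> sf g (pact z u) (pact z v) = \<sigma> * sf g u v" and \<sigma>: "\<sigma> \<in> {1, -1}"
  shows "\<exists>G t. G \<in> carrier_mat D D \<and> t > 0 \<and> (\<forall>u\<in>C. G *\<^sub>v u = 0\<^sub>v D \<longrightarrow> u = 0\<^sub>v D) \<and>
    (\<forall>i\<in>I. \<forall>u\<in>C. G *\<^sub>v (A i *\<^sub>v u) = lam \<cdot>\<^sub>v (A i *\<^sub>v (G *\<^sub>v u))) \<and>
    (\<forall>u\<in>C. G *\<^sub>v pact z u = \<sigma> \<cdot>\<^sub>v pact z (G *\<^sub>v u)) \<and>
    (\<forall>u\<in>C. \<forall>y\<in>C. sf g u y = complex_of_real t * sf h (G *\<^sub>v u) y)"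
proof -
  from rayleigh_pairs[of g] obtain t u0 v0 where uv0: "u0 \<in> C" "v0 \<in> C" "u0 \<noteq> 0\<^sub>v D \<or> v0 \<noteq> 0\<^sub>v D"
    and eq0: "2 * Re (sf g u0 v0) = t * (qf h u0 + qf h v0)"
    and le: "\<And>u v. u \<in> C \<Longrightarrow> v \<in> C \<Longrightarrow> 2 * Re (sf g u v) \<le> t * (qf h u + qf h v)" by blast
  have t0: "t > 0"
  proof -
    from ne obtain u v where uv: "u \<in> C" "v \<in> C" "sf g u v \<noteq> 0" by (auto simp: vanishes_def)
    \<comment> \<open>Multiplying v by c turns the value of g into the square of the modulus of c,
      so the maximum t is positive.\<close>
    define c where "c = sf g u v"
    have c: "c \<noteq> 0" using uv by (simp add: c_def)
    have "sf g u (c \<cdot>\<^sub>v v) = complex_of_real ((cmod c)\<^sup>2)"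
      using uv unfolding complex_norm_square by (simp add: sform_simps c_def)
    then have "2 * (cmod c)\<^sup>2 \<le> t * (qf h u + qf h (c \<cdot>\<^sub>v v))" using le[of u "c \<cdot>\<^sub>v v"] uv by simp
    moreover have "0 < (cmod c)\<^sup>2" using c by simp
    ultimately have "0 < t * (qf h u + qf h (c \<cdot>\<^sub>v v))" by linarith
    moreover have "qf h u + qf h (c \<cdot>\<^sub>v v) \<ge> 0" using h_nn[of u] h_nn[of "c \<cdot>\<^sub>v v"] uv by simp
    ultimately show ?thesis by (simp add: zero_less_mult_iff)
  qed
  define q where "q u v = t * (qf h u + qf h v) - 2 * Re (sf g u v)" for u v
  have qnn: "q u v \<ge> 0" if "u \<in> C" "v \<in> C" for u v using le[OF that] by (simp add: q_def)
  have qpar: "q (u + u') (v + v') + q (u - u') (v - v') = 2 * q u v + 2 * q u' v'"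
    if "u \<in> C" "v \<in> C" "u' \<in> C" "v' \<in> C" for u v u' v'
    using that unfolding q_def by (simp add: sform_simps algebra_simps)
  have qadd: "q (u + u') (v + v') = 0" "q (u - u') (v - v') = 0"
    if "u \<in> C" "v \<in> C" "u' \<in> C" "v' \<in> C" "q u v = 0" "q u' v' = 0" for u v u' v'
    using qpar[of u v u' v'] qnn[of "u + u'" "v + v'"] qnn[of "u - u'" "v - v'"] that by simp_all
  have qscale: "q (c \<cdot>\<^sub>v u) (c \<cdot>\<^sub>v v) = (cmod c)\<^sup>2 * q u v" if "u \<in> C" "v \<in> C" for c u v
  proof -
    have "sf g (c \<cdot>\<^sub>v u) (c \<cdot>\<^sub>v v) = complex_of_real ((cmod c)\<^sup>2) * sf g u v"
      using that unfolding complex_norm_square by (simp add: sform_simps)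
    then show ?thesis using that by (simp add: q_def h_scale algebra_simps)
  qed
  \<comment> \<open>Summed over i, the h-terms are preserved and the conjugate of lam in the second
    slot cancels the eigenvalue. So nonnegative terms add up to q u v = 0.\<close>
  have qA: "q (A i *\<^sub>v u) (lam \<cdot>\<^sub>v (A i *\<^sub>v v)) = 0" if i: "i \<in> I" and uv: "u \<in> C" "v \<in> C" "q u v = 0" for i u v
  proof -
    have l: "cnj lam * lam = 1" using lam complex_norm_square[of lam] by (simp add: mult.commute)
    have "(\<Sum>i\<in>I. sf g (A i *\<^sub>v u) (lam \<cdot>\<^sub>v (A i *\<^sub>v v))) = cnj lam * (\<Sum>i\<in>I. sf g (A i *\<^sub>v u) (A i *\<^sub>v v))"
      using uv by (simp add: sum_distrib_left sform_simps)
    also have "\<dots> = sf g u v" unfolding eigenformD[OF g uv(1,2)] mult.assoc[symmetric] l by simp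
    finally have 1: "(\<Sum>i\<in>I. Re (sf g (A i *\<^sub>v u) (lam \<cdot>\<^sub>v (A i *\<^sub>v v)))) = Re (sf g u v)" by (metis Re_sum)
    have 2: "(\<Sum>i\<in>I. qf h (lam \<cdot>\<^sub>v (A i *\<^sub>v v))) = qf h v"
      using uv lam h_qinv[OF uv(2)] by (simp add: h_scale)
    have "(\<Sum>i\<in>I. q (A i *\<^sub>v u) (lam \<cdot>\<^sub>v (A i *\<^sub>v v))) = q u v"
      unfolding q_def sum_subtractf sum_distrib_left[symmetric] sum.distrib 1 2 h_qinv[OF uv(1)] ..
    then have "(\<Sum>i\<in>I. q (A i *\<^sub>v u) (lam \<cdot>\<^sub>v (A i *\<^sub>v v))) = 0" using uv by simp
    then have "\<forall>i\<in>I. q (A i *\<^sub>v u) (lam \<cdot>\<^sub>v (A i *\<^sub>v v)) = 0"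
      using uv by (subst (asm) sum_nonneg_eq_0_iff[OF finI]) (auto intro!: qnn)
    then show ?thesis using i by blast
  qed
  have qZ: "q (pact z u) (\<sigma> \<cdot>\<^sub>v pact z v) = q u v" if "u \<in> C" "v \<in> C" for u v
  proof -
    have "cnj \<sigma> * \<sigma> = 1" "cmod \<sigma> = 1" using \<sigma> by auto
    then have "sf g (pact z u) (\<sigma> \<cdot>\<^sub>v pact z v) = sf g u v"
      using that by (simp add: sform_simps par mult.assoc[symmetric])
    moreover have "qf h (\<sigma> \<cdot>\<^sub>v pact z v) = qf h v"
      using that \<open>cmod \<sigma> = 1\<close> even_form_pact[OF z h_even that(2,2)] by (simp add: h_scale)
    ultimately show ?thesis using that even_form_pact[OF z h_even that(1,1)] by (simp add: q_def)
  qed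
  \<comment> \<open>Over the zero vector lies only the zero vector, so the null pairs form the graph
    of a function; the symmetric statement below makes it injective.\<close>
  have q0: "v = 0\<^sub>v D" if "v \<in> C" "q (0\<^sub>v D) v = 0" for v
  proof -
    have "sf X (0\<^sub>v D) y = 0" for X y by (simp add: sform_def)
    then have "t * qf h v = 0" using that by (simp add: q_def)
    then show ?thesis using t0 h_zero[OF that(1)] by simp
  qed
  have q0': "u = 0\<^sub>v D" if "u \<in> C" "q u (0\<^sub>v D) = 0" for u
  proof -
    have "sf X y (0\<^sub>v D) = 0" for X y by (simp add: sform_def)
    then have "t * qf h u = 0" using that by (simp add: q_def)
    then show ?thesis using t0 h_zero[OF that(1)] by simp
  qed
  define U where "U = {u \<in> C. \<exists>v\<in>C. q u v = 0}"
  have "U = {0\<^sub>v D} \<or> U = C"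
  proof (rule irreducible)
    show "subsp D U" unfolding subsp_def
    proof (intro conjI ballI allI)
      show "U \<subseteq> C" by (auto simp: U_def)
      have "q (0\<^sub>v D) (0\<^sub>v D) = 0" by (simp add: q_def sform_def)
      then show "0\<^sub>v D \<in> U" by (auto simp: U_def)
      show "u + u' \<in> U" if "u \<in> U" "u' \<in> U" for u u'
      proof -
        from that obtain v v' where "u \<in> C" "u' \<in> C" "v \<in> C" "v' \<in> C" "q u v = 0" "q u' v' = 0"
          by (auto simp: U_def)
        then have "q (u + u') (v + v') = 0" "v + v' \<in> C" "u + u' \<in> C" by (auto intro: qadd)
        then show ?thesis unfolding U_def by blast
      qed
      show "c \<cdot>\<^sub>v u \<in> U" if "u \<in> U" for c u
      proof -
        from that obtain v where "u \<in> C" "v \<in> C" "q u v = 0" by (auto simp: U_def)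
        then have "q (c \<cdot>\<^sub>v u) (c \<cdot>\<^sub>v v) = 0" "c \<cdot>\<^sub>v v \<in> C" "c \<cdot>\<^sub>v u \<in> C" by (auto simp: qscale)
        then show ?thesis unfolding U_def by blast
      qed
    qed
    show "pact z u \<in> U" if "u \<in> U" for u
    proof -
      from that obtain v where "u \<in> C" "v \<in> C" "q u v = 0" by (auto simp: U_def)
      then have "q (pact z u) (\<sigma> \<cdot>\<^sub>v pact z v) = 0" "pact z u \<in> C" "\<sigma> \<cdot>\<^sub>v pact z v \<in> C" by (auto simp: qZ)
      then show ?thesis unfolding U_def by blast
    qed
    show "A i *\<^sub>v u \<in> U" if "i \<in> I" "u \<in> U" for i u
    proof -
      from that obtain v where "u \<in> C" "v \<in> C" "q u v = 0" by (auto simp: U_def)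
      then have "q (A i *\<^sub>v u) (lam \<cdot>\<^sub>v (A i *\<^sub>v v)) = 0" "A i *\<^sub>v u \<in> C" "lam \<cdot>\<^sub>v (A i *\<^sub>v v) \<in> C"
        using that by (auto simp: qA)
      then show ?thesis unfolding U_def by blast
    qed
  qed
  moreover have "u0 \<in> U" "u0 \<noteq> 0\<^sub>v D"
  proof -
    have 0: "q u0 v0 = 0" using eq0 by (simp add: q_def)
    then show "u0 \<in> U" using uv0 by (auto simp: U_def)
    show "u0 \<noteq> 0\<^sub>v D"
    proof
      assume "u0 = 0\<^sub>v D"
      then show False using uv0 q0[OF uv0(2)] 0 by simp
    qed
  qed
  ultimately have UC: "U = C" by blast
  define f where "f u = (SOME v. v \<in> C \<and> q u v = 0)" for u
  have f: "f u \<in> C" "q u (f u) = 0" if "u \<in> C" for u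
  proof -
    have "\<exists>v. v \<in> C \<and> q u v = 0" using that UC by (auto simp: U_def)
    from someI_ex[OF this] show "f u \<in> C" "q u (f u) = 0" by (auto simp: f_def)
  qed
  have fu: "f u = v" if "u \<in> C" "v \<in> C" "q u v = 0" for u v
  proof -
    have "q (u - u) (f u - v) = 0" using that f by (intro qadd) auto
    then have "f u - v = 0\<^sub>v D" using that f[OF that(1)] by (intro q0) (auto simp: minus_cancel_vec)
    moreover have "f u = v + (f u - v)" using that f[OF that(1)] by (intro eq_vecI) auto
    ultimately show ?thesis using that by simp
  qed
  have "\<exists>G\<in>carrier_mat D D. \<forall>u\<in>C. G *\<^sub>v u = f u"
  proof (rule linear_matrix)
    show "f u \<in> C" if "u \<in> C" for u using f that by simp
    show "f (u + v) = f u + f v" if "u \<in> C" "v \<in> C" for u v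
      using that f by (intro fu qadd) auto
    show "f (a \<cdot>\<^sub>v u) = a \<cdot>\<^sub>v f u" if "u \<in> C" for a u
      using that f by (intro fu) (auto simp: qscale)
  qed
  then obtain G where G: "G \<in> carrier_mat D D" and Gf: "\<And>u. u \<in> C \<Longrightarrow> G *\<^sub>v u = f u" by blast
  have inj: "u = 0\<^sub>v D" if "u \<in> C" "f u = 0\<^sub>v D" for u using q0'[OF that(1)] f(2)[OF that(1)] that(2) by simp
  have fA: "f (A i *\<^sub>v u) = lam \<cdot>\<^sub>v (A i *\<^sub>v f u)" if "i \<in> I" "u \<in> C" for i u
    using that f by (intro fu qA) auto
  have fZ: "f (pact z u) = \<sigma> \<cdot>\<^sub>v pact z (f u)" if "u \<in> C" for u
    using that f by (intro fu) (auto simp: qZ)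
  \<comment> \<open>q vanishes at (u, f u) and is nonnegative along the line in direction y, so its
    first order term there is zero. This gives the real part of the identity, and the multiple of y
    by the imaginary unit gives the imaginary part.\<close>
  have rep: "sf g u y = complex_of_real t * sf h (f u) y" if u: "u \<in> C" and y: "y \<in> C" for u y
  proof -
    have re: "Re (complex_of_real t * sf h (f u) y - sf g u y) = 0" if y: "y \<in> C" for y
    proof -
      let ?b = "2 * Re (complex_of_real t * sf h (f u) y - sf g u y)"
      have "?b = 0"
      proof (rule linear_coefficient_zero)
        show "t * qf h y \<ge> 0" using t0 h_nn[OF y] by simp
        fix s :: real
        have hs: "sf h y (f u) = cnj (sf h (f u) y)" by (rule hermitian_sform[OF h_herm])
        have "q u (f u + complex_of_real s \<cdot>\<^sub>v y) = q u (f u) + t * qf h y * s\<^sup>2 + ?b * s"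
          using f[OF u] u y unfolding q_def by (simp add: sform_simps hs power2_eq_square algebra_simps)
        then show "t * qf h y * s\<^sup>2 + ?b * s \<ge> 0" using f[OF u] u y qnn[of u "f u + complex_of_real s \<cdot>\<^sub>v y"] by simp
      qed
      then show ?thesis by simp
    qed
    have "Re (complex_of_real t * sf h (f u) (\<i> \<cdot>\<^sub>v y) - sf g u (\<i> \<cdot>\<^sub>v y)) = 0" using y by (intro re) simp
    then have "Im (complex_of_real t * sf h (f u) y - sf g u y) = 0" using y by (simp add: sform_simps)
    with re[OF y] show ?thesis by (simp add: complex_eq_iff)
  qed
  have "\<forall>u\<in>C. G *\<^sub>v u = 0\<^sub>v D \<longrightarrow> u = 0\<^sub>v D" using inj by (simp add: Gf)
  moreover have "\<forall>i\<in>I. \<forall>u\<in>C. G *\<^sub>v (A i *\<^sub>v u) = lam \<cdot>\<^sub>v (A i *\<^sub>v (G *\<^sub>v u))" by (simp add: Gf fA)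
  moreover have "\<forall>u\<in>C. G *\<^sub>v pact z u = \<sigma> \<cdot>\<^sub>v pact z (G *\<^sub>v u)" by (simp add: Gf fZ)
  moreover have "\<forall>u\<in>C. \<forall>y\<in>C. sf g u y = complex_of_real t * sf h (G *\<^sub>v u) y" by (simp add: Gf rep)
  ultimately show ?thesis using G t0 by blast
qed


text \<open>A maps the eigenspace of G for \<open>\<nu>\<close> to that for \<open>lam * \<nu>\<close>. As G has finitely many eigenvalues, lam
  is an m-th root of unity, and then the eigenspaces are invariant under words of length m.\<close>

lemma commuting_scalar:
  assumes G: "G \<in> carrier_mat D D" and inj: "\<And>u. u \<in> C \<Longrightarrow> G *\<^sub>v u = 0\<^sub>v D \<Longrightarrow> u = 0\<^sub>v D"
    and GZ: "\<And>u. u \<in> C \<Longrightarrow> G *\<^sub>v pact z u = pact z (G *\<^sub>v u)"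
    and GA: "\<And>i u. i \<in> I \<Longrightarrow> u \<in> C \<Longrightarrow> G *\<^sub>v (A i *\<^sub>v u) = lam \<cdot>\<^sub>v (A i *\<^sub>v (G *\<^sub>v u))"
    and lam: "cmod lam = 1"
  shows "lam = 1 \<and> (\<exists>c. c \<noteq> 0 \<and> (\<forall>u\<in>C. G *\<^sub>v u = c \<cdot>\<^sub>v u))"
proof -
  define E where "E \<nu> = {u \<in> C. G *\<^sub>v u = \<nu> \<cdot>\<^sub>v u}" for \<nu>
  have Esub: "subsp D (E \<nu>)" for \<nu>
    unfolding subsp_def
  proof (intro conjI ballI allI)
    show "E \<nu> \<subseteq> C" by (auto simp: E_def)
    have "G *\<^sub>v 0\<^sub>v D = 0\<^sub>v D" using G by (intro eq_vecI) auto
    moreover have "\<nu> \<cdot>\<^sub>v 0\<^sub>v D = 0\<^sub>v D" by (intro eq_vecI) auto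
    ultimately show "0\<^sub>v D \<in> E \<nu>" by (simp add: E_def)
    show "u + v \<in> E \<nu>" if "u \<in> E \<nu>" "v \<in> E \<nu>" for u v
      using that by (auto simp: E_def mult_add_distrib_mat_vec[OF G] smult_add_distrib_vec)
    show "c \<cdot>\<^sub>v u \<in> E \<nu>" if "u \<in> E \<nu>" for c u
      using that by (auto simp: E_def mult_mat_vec[OF G] smult_smult_assoc mult.commute)
  qed
  from spectrum_non_empty[OF G D0] obtain \<mu> where "eigenvalue G \<mu>" by (auto simp: spectrum_def)
  then obtain e where e: "e \<in> C" "e \<noteq> 0\<^sub>v D" "G *\<^sub>v e = \<mu> \<cdot>\<^sub>v e"
    using G by (auto simp: eigenvalue_def eigenvector_def)
  have \<mu>0: "\<mu> \<noteq> 0"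
  proof
    assume "\<mu> = 0"
    then have "G *\<^sub>v e = 0\<^sub>v D" using e by (auto intro!: eq_vecI)
    then show False using inj e by blast
  qed
  have EA: "A i *\<^sub>v u \<in> E (lam * \<nu>)" if "i \<in> I" "u \<in> E \<nu>" for i u \<nu>
  proof -
    have u: "u \<in> C" "G *\<^sub>v u = \<nu> \<cdot>\<^sub>v u" using that by (auto simp: E_def)
    then show ?thesis using that GA[OF that(1) u(1)]
      by (simp add: E_def mult_mat_vec[OF Ac[OF that(1)]] smult_smult_assoc)
  qed
  have EW: "word_act A w u \<in> E (lam ^ length w * \<nu>)" if "set w \<subseteq> I" "u \<in> E \<nu>" for w u \<nu>
    using that
  proof (induction w)
    case (Cons i w)
    then have "A i *\<^sub>v word_act A w u \<in> E (lam * (lam ^ length w * \<nu>))" by (intro EA) auto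
    then show ?case by (simp add: word_act_def mult.assoc)
  qed (simp add: word_act_def)
  \<comment> \<open>Every power of lam times \<mu> is an eigenvalue of G, since some letter maps a
    given eigenvector to a nonzero one. Finiteness of the spectrum then forces a repetition.\<close>
  have EN: "\<exists>u. u \<in> E (lam ^ n * \<mu>) \<and> u \<noteq> 0\<^sub>v D" for n
  proof (induction n)
    case 0
    then show ?case using e by (auto simp: E_def)
  next
    case (Suc n)
    then obtain u where u: "u \<in> E (lam ^ n * \<mu>)" "u \<noteq> 0\<^sub>v D" by blast
    then obtain i where i: "i \<in> I" "A i *\<^sub>v u \<noteq> 0\<^sub>v D" using exists_nonzero_image[of u] by (auto simp: E_def)
    then show ?case using EA[OF i(1) u(1)] by (auto simp: mult.assoc)
  qed
  have "lam ^ n * \<mu> \<in> spectrum G" for n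
    using EN[of n] G by (auto simp: spectrum_def eigenvalue_def eigenvector_def E_def)
  then have "range (\<lambda>n. lam ^ n * \<mu>) \<subseteq> spectrum G" by blast
  then have "finite (range (\<lambda>n. lam ^ n * \<mu>))" using card_finite_spectrum(1)[OF G] finite_subset by blast
  then have "\<not> inj (\<lambda>n. lam ^ n * \<mu>)" using finite_imageD infinite_UNIV_nat by blast
  then obtain a b :: nat where ab: "a < b" "lam ^ a * \<mu> = lam ^ b * \<mu>"
    unfolding inj_def by (metis linorder_neqE_nat)
  define m where "m = b - a"
  have "lam ^ b = lam ^ a * lam ^ m" using ab by (simp add: m_def power_add[symmetric])
  moreover have "lam \<noteq> 0" using lam by auto
  ultimately have lm: "lam ^ m = 1" using ab \<mu>0 by simp
  have "E \<mu> = {0\<^sub>v D} \<or> E \<mu> = C"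
  proof (rule stable[of m, OF _ Esub])
    show "m \<ge> 1" using ab by (simp add: m_def)
    show "pact z u \<in> E \<mu>" if "u \<in> E \<mu>" for u
      using that GZ[of u] by (auto simp: E_def pact_smult)
    show "word_act A w u \<in> E \<mu>" if "set w \<subseteq> I" "length w = m" "u \<in> E \<mu>" for w u
      using EW[OF that(1,3)] that(2) lm by simp
  qed
  moreover have "e \<in> E \<mu>" using e by (simp add: E_def)
  ultimately have EC: "E \<mu> = C" using e by blast
  then have sc: "G *\<^sub>v u = \<mu> \<cdot>\<^sub>v u" if "u \<in> C" for u using that by (auto simp: E_def)
  \<comment> \<open>Now that G is scalar it commutes with A i, so on a nonzero image of e the
    twisted relation leaves only lam = 1.\<close>
  obtain i where i: "i \<in> I" "A i *\<^sub>v e \<noteq> 0\<^sub>v D" using exists_nonzero_image[OF e(1,2)] by blast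
  define x where "x = A i *\<^sub>v e"
  have x: "x \<in> C" "x \<noteq> 0\<^sub>v D" using i e by (auto simp: x_def)
  have "\<mu> \<cdot>\<^sub>v x = (lam * \<mu>) \<cdot>\<^sub>v x"
    using GA[OF i(1) e(1)] sc[OF x(1)] e(1) unfolding e(3)
    by (simp add: x_def mult_mat_vec[OF Ac[OF i(1)]] smult_smult_assoc)
  moreover obtain a where "a < D" "x $ a \<noteq> 0" using x by (metis carrier_vecD eq_vecI index_zero_vec)
  ultimately have "\<mu> * x $ a = lam * \<mu> * x $ a" using x by (metis carrier_vecD index_smult_vec(1))
  then have "lam = 1" using \<mu>0 \<open>x $ a \<noteq> 0\<close> by simp
  with sc \<mu>0 show ?thesis by blast
qed

section \<open>Even and odd eigenforms, their uniqueness, and the boundedness of iterates\<close>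

definition homogeneous :: "complex \<Rightarrow> (nat \<times> nat \<Rightarrow> complex) \<Rightarrow> bool" where
  "homogeneous \<sigma> g \<longleftrightarrow> (\<forall>u\<in>C. \<forall>v\<in>C. sf g (pact z u) (pact z v) = \<sigma> * sf g u v)"

lemma even_eigenform:
  assumes g: "eigenform g lam" "cmod lam = 1" "\<not> vanishes g" "homogeneous 1 g"
  shows "lam = 1 \<and> (\<exists>c. \<forall>u\<in>C. \<forall>v\<in>C. sf g u v = c * sf h u v)"
proof -
  from intertwiner[OF g(1-3), of 1] g(4) obtain G t where G: "G \<in> carrier_mat D D"
    and inj: "\<And>u. u \<in> C \<Longrightarrow> G *\<^sub>v u = 0\<^sub>v D \<Longrightarrow> u = 0\<^sub>v D"
    and GA: "\<And>i u. i \<in> I \<Longrightarrow> u \<in> C \<Longrightarrow> G *\<^sub>v (A i *\<^sub>v u) = lam \<cdot>\<^sub>v (A i *\<^sub>v (G *\<^sub>v u))"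
    and GZ: "\<And>u. u \<in> C \<Longrightarrow> G *\<^sub>v pact z u = 1 \<cdot>\<^sub>v pact z (G *\<^sub>v u)"
    and rep: "\<And>u y. u \<in> C \<Longrightarrow> y \<in> C \<Longrightarrow> sf g u y = complex_of_real t * sf h (G *\<^sub>v u) y"
    unfolding homogeneous_def by blast
  have GZ': "G *\<^sub>v pact z u = pact z (G *\<^sub>v u)" if "u \<in> C" for u using GZ[OF that] by simp
  from commuting_scalar[OF G inj GZ' GA g(2)] obtain c where l: "lam = 1" and c: "\<And>u. u \<in> C \<Longrightarrow> G *\<^sub>v u = c \<cdot>\<^sub>v u"
    by blast
  have "sf g u v = (complex_of_real t * c) * sf h u v" if "u \<in> C" "v \<in> C" for u v
    using rep[OF that] that by (simp add: c sform_simps)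
  with l show ?thesis by blast
qed

text \<open>A product of two odd intertwiners commutes with Z and is scalar. Applied to G1 G1 and G1
  G2 this shows that G1 annihilates a combination of G1 and G2, and injectivity of G1 makes them
  proportional. Taking both forms equal gives that the eigenvalue squares to 1.\<close>

lemma odd_eigenforms:
  assumes g1: "eigenform g1 l1" "cmod l1 = 1" "\<not> vanishes g1" "homogeneous (-1) g1"
    and g2: "eigenform g2 l2" "cmod l2 = 1" "\<not> vanishes g2" "homogeneous (-1) g2"
  shows "l1 * l2 = 1 \<and> (\<exists>c. \<forall>u\<in>C. \<forall>v\<in>C. sf g2 u v = c * sf g1 u v)"
proof -
  from intertwiner[OF g1(1-3), of "-1"] g1(4) obtain G1 t1 where G1: "G1 \<in> carrier_mat D D"
    and t1: "t1 > 0" and inj1: "\<And>u. u \<in> C \<Longrightarrow> G1 *\<^sub>v u = 0\<^sub>v D \<Longrightarrow> u = 0\<^sub>v D"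
    and GA1: "\<And>i u. i \<in> I \<Longrightarrow> u \<in> C \<Longrightarrow> G1 *\<^sub>v (A i *\<^sub>v u) = l1 \<cdot>\<^sub>v (A i *\<^sub>v (G1 *\<^sub>v u))"
    and GZ1: "\<And>u. u \<in> C \<Longrightarrow> G1 *\<^sub>v pact z u = (-1) \<cdot>\<^sub>v pact z (G1 *\<^sub>v u)"
    and rep1: "\<And>u y. u \<in> C \<Longrightarrow> y \<in> C \<Longrightarrow> sf g1 u y = complex_of_real t1 * sf h (G1 *\<^sub>v u) y"
    unfolding homogeneous_def by blast
  from intertwiner[OF g2(1-3), of "-1"] g2(4) obtain G2 t2 where G2: "G2 \<in> carrier_mat D D"
    and t2: "t2 > 0" and inj2: "\<And>u. u \<in> C \<Longrightarrow> G2 *\<^sub>v u = 0\<^sub>v D \<Longrightarrow> u = 0\<^sub>v D"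
    and GA2: "\<And>i u. i \<in> I \<Longrightarrow> u \<in> C \<Longrightarrow> G2 *\<^sub>v (A i *\<^sub>v u) = l2 \<cdot>\<^sub>v (A i *\<^sub>v (G2 *\<^sub>v u))"
    and GZ2: "\<And>u. u \<in> C \<Longrightarrow> G2 *\<^sub>v pact z u = (-1) \<cdot>\<^sub>v pact z (G2 *\<^sub>v u)"
    and rep2: "\<And>u y. u \<in> C \<Longrightarrow> y \<in> C \<Longrightarrow> sf g2 u y = complex_of_real t2 * sf h (G2 *\<^sub>v u) y"
    unfolding homogeneous_def by blast
  have product: "l1 * l = 1 \<and> (\<exists>c. c \<noteq> 0 \<and> (\<forall>u\<in>C. G1 *\<^sub>v (G *\<^sub>v u) = c \<cdot>\<^sub>v u))"
    if G: "G \<in> carrier_mat D D" and inj: "\<And>u. u \<in> C \<Longrightarrow> G *\<^sub>v u = 0\<^sub>v D \<Longrightarrow> u = 0\<^sub>v D"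
    and GA: "\<And>i u. i \<in> I \<Longrightarrow> u \<in> C \<Longrightarrow> G *\<^sub>v (A i *\<^sub>v u) = l \<cdot>\<^sub>v (A i *\<^sub>v (G *\<^sub>v u))"
    and GZ: "\<And>u. u \<in> C \<Longrightarrow> G *\<^sub>v pact z u = (-1) \<cdot>\<^sub>v pact z (G *\<^sub>v u)" and l: "cmod l = 1" for G l
  proof -
    have Gc: "G *\<^sub>v u \<in> C" if "u \<in> C" for u using G that by simp
    have act: "(G1 * G) *\<^sub>v u = G1 *\<^sub>v (G *\<^sub>v u)" if "u \<in> C" for u
      using G1 G that by (rule assoc_mult_mat_vec)
    have "l1 * l = 1 \<and> (\<exists>c. c \<noteq> 0 \<and> (\<forall>u\<in>C. (G1 * G) *\<^sub>v u = c \<cdot>\<^sub>v u))"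
    proof (rule commuting_scalar)
      show "G1 * G \<in> carrier_mat D D" using G1 G by simp
      show "u = 0\<^sub>v D" if "u \<in> C" "(G1 * G) *\<^sub>v u = 0\<^sub>v D" for u
        using that inj1[OF Gc] inj by (simp add: act)
      show "(G1 * G) *\<^sub>v pact z u = pact z ((G1 * G) *\<^sub>v u)" if "u \<in> C" for u
      proof -
        have "G1 *\<^sub>v (G *\<^sub>v pact z u) = (-1) \<cdot>\<^sub>v (G1 *\<^sub>v pact z (G *\<^sub>v u))"
          using that Gc[OF that] by (simp only: GZ mult_mat_vec[OF G1] pact_carrier)
        also have "\<dots> = pact z (G1 *\<^sub>v (G *\<^sub>v u))"
          unfolding GZ1[OF Gc[OF that]] smult_smult_assoc by simp
        finally show ?thesis using that by (simp add: act)
      qed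
      show "(G1 * G) *\<^sub>v (A i *\<^sub>v u) = (l1 * l) \<cdot>\<^sub>v (A i *\<^sub>v ((G1 * G) *\<^sub>v u))" if i: "i \<in> I" and u: "u \<in> C" for i u
      proof -
        have "G1 *\<^sub>v (G *\<^sub>v (A i *\<^sub>v u)) = l \<cdot>\<^sub>v (G1 *\<^sub>v (A i *\<^sub>v (G *\<^sub>v u)))"
          unfolding GA[OF i u] using i Gc[OF u] by (intro mult_mat_vec[OF G1]) simp
        also have "\<dots> = (l1 * l) \<cdot>\<^sub>v (A i *\<^sub>v (G1 *\<^sub>v (G *\<^sub>v u)))"
          unfolding GA1[OF i Gc[OF u]] smult_smult_assoc by (simp add: mult.commute)
        finally show ?thesis using i u by (simp add: act)
      qed
      show "cmod (l1 * l) = 1" using l g1(2) by (simp add: norm_mult)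
    qed
    then show ?thesis using act by auto
  qed
  from product[OF G1 inj1 GA1 GZ1 g1(2)] obtain c1 where c1: "c1 \<noteq> 0" "\<And>u. u \<in> C \<Longrightarrow> G1 *\<^sub>v (G1 *\<^sub>v u) = c1 \<cdot>\<^sub>v u"
    by blast
  from product[OF G2 inj2 GA2 GZ2 g2(2)] obtain c2 where l12: "l1 * l2 = 1"
    and c2: "c2 \<noteq> 0" "\<And>u. u \<in> C \<Longrightarrow> G1 *\<^sub>v (G2 *\<^sub>v u) = c2 \<cdot>\<^sub>v u"
    by blast
  have G21: "c1 \<cdot>\<^sub>v (G2 *\<^sub>v u) = c2 \<cdot>\<^sub>v (G1 *\<^sub>v u)" if u: "u \<in> C" for u
  proof -
    let ?x = "c1 \<cdot>\<^sub>v (G2 *\<^sub>v u) - c2 \<cdot>\<^sub>v (G1 *\<^sub>v u)"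
    have c: "G1 *\<^sub>v u \<in> C" "G2 *\<^sub>v u \<in> C" using G1 G2 u by auto
    have "G1 *\<^sub>v ?x = c1 \<cdot>\<^sub>v (c2 \<cdot>\<^sub>v u) - c2 \<cdot>\<^sub>v (c1 \<cdot>\<^sub>v u)"
      using c u c1(2) c2(2) by (simp add: mult_minus_distrib_mat_vec[OF G1] mult_mat_vec[OF G1])
    also have "\<dots> = 0\<^sub>v D" using u by (intro eq_vecI) auto
    finally have z: "G1 *\<^sub>v ?x = 0\<^sub>v D" .
    have "?x \<in> C" using c by simp
    from inj1[OF this z] have x0: "?x = 0\<^sub>v D" .
    have "c1 \<cdot>\<^sub>v (G2 *\<^sub>v u) = c2 \<cdot>\<^sub>v (G1 *\<^sub>v u) + ?x"
    proof -
      have "a = b + (a - b)" if "a \<in> C" "b \<in> C" for a b using that by (intro eq_vecI) auto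
      then show ?thesis using c by simp
    qed
    also have "\<dots> = c2 \<cdot>\<^sub>v (G1 *\<^sub>v u)" unfolding x0 using c by (intro right_zero_vec) simp
    finally show ?thesis .
  qed
  have "sf g2 u v = (complex_of_real t2 * c2 / (c1 * complex_of_real t1)) * sf g1 u v" if u: "u \<in> C" and v: "v \<in> C" for u v
  proof -
    have c: "G1 *\<^sub>v u \<in> C" "G2 *\<^sub>v u \<in> C" using G1 G2 u by auto
    have "c1 * sf h (G2 *\<^sub>v u) v = c2 * sf h (G1 *\<^sub>v u) v"
      using arg_cong[OF G21[OF u], of "\<lambda>x. sf h x v"] c by (simp add: sform_simps)
    then have "sf h (G2 *\<^sub>v u) v = c2 / c1 * sf h (G1 *\<^sub>v u) v" using c1(1) by (simp add: field_simps)
    then show ?thesis using t1 by (simp add: rep1[OF u v] rep2[OF u v])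
  qed
  with l12 show ?thesis by blast
qed

text \<open>The component of parity \<sigma> of g under conjugation by Z; the coefficients 1/2 make
  the two components add up to g.\<close>

definition part :: "complex \<Rightarrow> (nat \<times> nat \<Rightarrow> complex) \<Rightarrow> nat \<times> nat \<Rightarrow> complex" where
  "part \<sigma> g = (\<lambda>p. (1/2) * g p + (\<sigma>/2) * (case p of (i, k) \<Rightarrow> z i * g (i, k) * z k))"

lemma sform_part:
  "u \<in> C \<Longrightarrow> v \<in> C \<Longrightarrow> sf (part \<sigma> g) u v = (sf g u v + \<sigma> * sf g (pact z u) (pact z v)) / 2"
  unfolding part_def sform_lin by (simp add: sform_pact[OF z] field_simps)

lemma part_sum: "u \<in> C \<Longrightarrow> v \<in> C \<Longrightarrow> sf g u v = sf (part 1 g) u v + sf (part (-1) g) u v"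
  by (simp add: sform_part add_divide_distrib diff_divide_distrib)

lemma homogeneous_part: "\<sigma> \<in> {1, -1} \<Longrightarrow> homogeneous \<sigma> (part \<sigma> g)"
  unfolding homogeneous_def by (auto simp: sform_part pact_pact[OF z] field_simps)

lemma eigenform_part:
  assumes g: "eigenform g lam" and \<sigma>: "\<sigma> \<in> {1, -1}"
  shows "eigenform (part \<sigma> g) lam"
  unfolding eigenform_def
proof (intro ballI)
  fix u v assume uv: "u \<in> C" "v \<in> C"
  have Z: "sf g (pact z (A i *\<^sub>v u)) (pact z (A i *\<^sub>v v)) = sf g (A i *\<^sub>v pact z u) (A i *\<^sub>v pact z v)" if i: "i \<in> I" for i
  proof -
    have "cnj (s i) * (s i * x) = x" "s i * (cnj (s i) * x) = x" for x
      using s_sq[OF i] by (metis mult.assoc mult.commute mult_1)+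
    then show ?thesis using i uv by (simp add: pact_A sform_simps)
  qed
  have "sf (dual_map (part \<sigma> g)) u v = (\<Sum>i\<in>I. (sf g (A i *\<^sub>v u) (A i *\<^sub>v v) + \<sigma> * sf g (A i *\<^sub>v pact z u) (A i *\<^sub>v pact z v)) / 2)"
    unfolding sform_dual[OF uv] using uv by (intro sum.cong) (auto simp: sform_part Z)
  also have "\<dots> = ((\<Sum>i\<in>I. sf g (A i *\<^sub>v u) (A i *\<^sub>v v)) + \<sigma> * (\<Sum>i\<in>I. sf g (A i *\<^sub>v pact z u) (A i *\<^sub>v pact z v))) / 2"
    unfolding sum_divide_distrib[symmetric] sum.distrib sum_distrib_left[symmetric] ..
  also have "\<dots> = lam * sf (part \<sigma> g) u v"
    using uv by (simp add: eigenformD[OF g] sform_part algebra_simps)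
  finally show "sf (dual_map (part \<sigma> g)) u v = lam * sf (part \<sigma> g) u v" .
qed

text \<open>One of the two parity components does not vanish and is again an eigenform: an even one
  forces lam = 1, and an odd one is paired with itself.\<close>

lemma peripheral_eigenform_square:
  assumes g: "eigenform g lam" and lam: "cmod lam = 1" and ne: "\<not> vanishes g"
  shows "lam * lam = 1"
proof (cases "vanishes (part 1 g)")
  case False
  then show ?thesis using even_eigenform[OF eigenform_part[OF g] lam False homogeneous_part] by simp
next
  case True
  have no: "\<not> vanishes (part (-1) g)"
  proof
    assume "vanishes (part (-1) g)"
    with True have "vanishes g" unfolding vanishes_def by (simp add: part_sum[of _ _ g])
    with ne show False by simp
  qed
  note e = eigenform_part[OF g, of "-1", simplified] lam no homogeneous_part[of "-1" g, simplified]
  from odd_eigenforms[OF e e] show ?thesis by simp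
qed

text \<open>Even parts of fixed forms are multiples of h and odd parts are multiples of one form k,
  so fixed forms lie in the span of h and k.\<close>

lemma fixed_forms_dependent:
  assumes g: "eigenform g0 1" "eigenform g1 1" "eigenform g2 1"
  shows "\<exists>a b c. (a \<noteq> 0 \<or> b \<noteq> 0 \<or> c \<noteq> 0) \<and>
    (\<forall>u\<in>C. \<forall>v\<in>C. a * sf g0 u v + b * sf g1 u v + c * sf g2 u v = 0)"
proof -
  have ev: "\<exists>x. \<forall>u\<in>C. \<forall>v\<in>C. sf (part 1 g) u v = x * sf h u v" if g: "eigenform g 1" for g
  proof (cases "vanishes (part 1 g)")
    case True
    then show ?thesis unfolding vanishes_def by (intro exI[of _ 0]) simp
  next
    case False
    then show ?thesis using even_eigenform[OF eigenform_part[OF g] _ False homogeneous_part] by simp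
  qed
  \<comment> \<open>k is the nonvanishing odd part of some fixed form if there is one; otherwise any
    k serves, with factor 0.\<close>
  have "\<exists>k. \<forall>g. eigenform g 1 \<longrightarrow> (\<exists>y. \<forall>u\<in>C. \<forall>v\<in>C. sf (part (-1) g) u v = y * sf k u v)"
  proof (cases "\<exists>k. eigenform k 1 \<and> \<not> vanishes (part (-1) k)")
    case True
    then obtain k where k: "eigenform k 1" "\<not> vanishes (part (-1) k)" by blast
    show ?thesis
    proof (intro exI[of _ "part (-1) k"] allI impI)
      fix g assume g: "eigenform g 1"
      show "\<exists>y. \<forall>u\<in>C. \<forall>v\<in>C. sf (part (-1) g) u v = y * sf (part (-1) k) u v"
      proof (cases "vanishes (part (-1) g)")
        case True
        then show ?thesis unfolding vanishes_def by (intro exI[of _ 0]) simp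
      next
        case False
        from odd_eigenforms[OF eigenform_part[OF k(1)] _ k(2) homogeneous_part eigenform_part[OF g] _ False homogeneous_part]
        show ?thesis by simp
      qed
    qed
  next
    case False
    then show ?thesis unfolding vanishes_def by (metis mult_zero_left)
  qed
  then obtain k where od: "\<And>g. eigenform g 1 \<Longrightarrow> \<exists>y. \<forall>u\<in>C. \<forall>v\<in>C. sf (part (-1) g) u v = y * sf k u v" by blast
  have dec: "\<exists>x y. \<forall>u\<in>C. \<forall>v\<in>C. sf g u v = x * sf h u v + y * sf k u v" if g: "eigenform g 1" for g
  proof -
    from ev[OF g] od[OF g] obtain x y where "\<forall>u\<in>C. \<forall>v\<in>C. sf (part 1 g) u v = x * sf h u v"
      "\<forall>u\<in>C. \<forall>v\<in>C. sf (part (-1) g) u v = y * sf k u v" by blast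
    then show ?thesis by (intro exI[of _ x] exI[of _ y]) (simp add: part_sum[of _ _ g])
  qed
  from dec[OF g(1)] obtain x0 y0 where 0: "\<And>u v. u \<in> C \<Longrightarrow> v \<in> C \<Longrightarrow> sf g0 u v = x0 * sf h u v + y0 * sf k u v" by blast
  from dec[OF g(2)] obtain x1 y1 where 1: "\<And>u v. u \<in> C \<Longrightarrow> v \<in> C \<Longrightarrow> sf g1 u v = x1 * sf h u v + y1 * sf k u v" by blast
  from dec[OF g(3)] obtain x2 y2 where 2: "\<And>u v. u \<in> C \<Longrightarrow> v \<in> C \<Longrightarrow> sf g2 u v = x2 * sf h u v + y2 * sf k u v" by blast
  obtain a b c where abc: "a \<noteq> 0 \<or> b \<noteq> 0 \<or> c \<noteq> 0" "a * x0 + b * x1 + c * x2 = 0" "a * y0 + b * y1 + c * y2 = 0"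
    using three_vectors_dependence[of x0 x1 x2 y0 y1 y2] by (elim exE conjE) (rule that)
  have "a * sf g0 u v + b * sf g1 u v + c * sf g2 u v = 0" if "u \<in> C" "v \<in> C" for u v
  proof -
    have "a * sf g0 u v + b * sf g1 u v + c * sf g2 u v =
      (a * x0 + b * x1 + c * x2) * sf h u v + (a * y0 + b * y1 + c * y2) * sf k u v"
      using that by (simp add: 0 1 2 algebra_simps)
    then show ?thesis using abc by simp
  qed
  with abc(1) show ?thesis by blast
qed

text \<open>Invariance of h makes \<open>dual_map\<close> a contraction for the norm relative to
  h.\<close>

lemma dual_map_bound:
  assumes b: "\<forall>u\<in>C. \<forall>v\<in>C. 2 * Re (sf g u v) \<le> t * (qf h u + qf h v)"
  shows "\<forall>u\<in>C. \<forall>v\<in>C. 2 * Re (sf (dual_map g) u v) \<le> t * (qf h u + qf h v)"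
proof (intro ballI)
  fix u v assume uv: "u \<in> C" "v \<in> C"
  have "2 * Re (sf (dual_map g) u v) = (\<Sum>i\<in>I. 2 * Re (sf g (A i *\<^sub>v u) (A i *\<^sub>v v)))"
    using uv by (simp add: sform_dual sum_distrib_left)
  also have "\<dots> \<le> (\<Sum>i\<in>I. t * (qf h (A i *\<^sub>v u) + qf h (A i *\<^sub>v v)))"
    using uv b by (intro sum_mono) simp
  also have "\<dots> = t * (qf h u + qf h v)"
    unfolding sum_distrib_left[symmetric] sum.distrib h_qinv[OF uv(1)] h_qinv[OF uv(2)] ..
  finally show "2 * Re (sf (dual_map g) u v) \<le> t * (qf h u + qf h v)" .
qed

lemma dual_iterates_bounded:
  "\<exists>t. \<forall>n. \<forall>u\<in>C. \<forall>v\<in>C. 2 * Re (sf ((dual_map ^^ n) g) u v) \<le> t * (qf h u + qf h v)"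
proof -
  from rayleigh_pairs[of g] obtain t where t: "\<forall>u\<in>C. \<forall>v\<in>C. 2 * Re (sf g u v) \<le> t * (qf h u + qf h v)" by blast
  have "\<forall>u\<in>C. \<forall>v\<in>C. 2 * Re (sf ((dual_map ^^ n) g) u v) \<le> t * (qf h u + qf h v)" for n
  proof (induction n)
    case (Suc n)
    then show ?case unfolding funpow.simps o_def by (rule dual_map_bound)
  qed (use t in simp)
  then show ?thesis by blast
qed

lemma unbounded_multiples:
  fixes x y :: real
  assumes "\<And>n :: nat. y + real n * x \<le> t"
  shows "x \<le> 0"
proof (rule ccontr)
  assume "\<not> x \<le> 0"
  then have x: "x > 0" by simp
  then obtain n :: nat where "t - y < real n * x" using reals_Archimedean3 by blast
  with assms[of n] show False by simp
qed

text \<open>Along a Jordan chain the n-th iterate of g2 is g2 + n g1, which is bounded only if g1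
  vanishes.\<close>

lemma no_jordan_chain:
  assumes g1: "eigenform g1 1" and g2: "\<And>u v. u \<in> C \<Longrightarrow> v \<in> C \<Longrightarrow> sf (dual_map g2) u v = sf g2 u v + sf g1 u v"
  shows "vanishes g1"
proof -
  have it: "sf ((dual_map ^^ n) g2) u v = sf g2 u v + of_nat n * sf g1 u v" if "u \<in> C" "v \<in> C" for n u v
    using that
  proof (induction n arbitrary: u v)
    case (Suc n)
    have "sf ((dual_map ^^ Suc n) g2) u v = (\<Sum>i\<in>I. sf ((dual_map ^^ n) g2) (A i *\<^sub>v u) (A i *\<^sub>v v))"
      using Suc.prems by (simp add: sform_dual)
    also have "\<dots> = (\<Sum>i\<in>I. sf g2 (A i *\<^sub>v u) (A i *\<^sub>v v)) + of_nat n * (\<Sum>i\<in>I. sf g1 (A i *\<^sub>v u) (A i *\<^sub>v v))"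
      using Suc by (simp add: sum.distrib sum_distrib_left)
    also have "\<dots> = sf g2 u v + sf g1 u v + of_nat n * sf g1 u v"
      unfolding eigenformD[OF g1 Suc.prems] using g2[OF Suc.prems] Suc.prems by (simp add: sform_dual)
    finally show ?case by (simp add: algebra_simps)
  qed simp
  from dual_iterates_bounded[of g2] obtain t where
    t: "\<And>n u v. u \<in> C \<Longrightarrow> v \<in> C \<Longrightarrow> 2 * Re (sf ((dual_map ^^ n) g2) u v) \<le> t * (qf h u + qf h v)" by blast
  have le: "Re (sf g1 u v) \<le> 0" if uv: "u \<in> C" "v \<in> C" for u v
  proof (rule unbounded_multiples)
    show "Re (sf g2 u v) + real n * Re (sf g1 u v) \<le> t * (qf h u + qf h v) / 2" for n
      using t[OF uv, of n] unfolding it[OF uv] by simp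
  qed
  \<comment> \<open>The bound on the iterates is one-sided; replacing v by its negative supplies the
    opposite inequality.\<close>
  have re: "Re (sf g1 u v) = 0" if uv: "u \<in> C" "v \<in> C" for u v
    using le[OF uv] le[of u "(-1) \<cdot>\<^sub>v v"] uv by (simp add: sform_simps)
  show ?thesis unfolding vanishes_def
  proof (intro ballI)
    fix u v assume uv: "u \<in> C" "v \<in> C"
    have "Im (sf g1 u v) = 0" using re[of u "\<i> \<cdot>\<^sub>v v"] uv by (simp add: sform_simps)
    then show "sf g1 u v = 0" using re[OF uv] by (simp add: complex_eq_iff)
  qed
qed

text \<open>The n-th iterate is the form times the n-th power of lam, which would exceed the uniform
  bound if lam had modulus above one.\<close>

lemma eigenform_le_1:
  assumes g: "eigenform g lam" and ne: "\<not> vanishes g"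
  shows "cmod lam \<le> 1"
proof (rule ccontr)
  assume "\<not> cmod lam \<le> 1"
  then have l: "cmod lam > 1" by simp
  have it: "sf ((dual_map ^^ n) g) u v = lam ^ n * sf g u v" if "u \<in> C" "v \<in> C" for n u v
    using that
  proof (induction n arbitrary: u v)
    case (Suc n)
    then have "sf ((dual_map ^^ Suc n) g) u v = (\<Sum>i\<in>I. sf ((dual_map ^^ n) g) (A i *\<^sub>v u) (A i *\<^sub>v v))"
      by (simp add: sform_dual)
    also have "\<dots> = lam ^ n * (\<Sum>i\<in>I. sf g (A i *\<^sub>v u) (A i *\<^sub>v v))"
      using Suc by (simp add: sum_distrib_left)
    finally show ?case unfolding eigenformD[OF g Suc.prems] by simp
  qed simp
  from dual_iterates_bounded[of g] obtain t where
    t: "\<And>n u v. u \<in> C \<Longrightarrow> v \<in> C \<Longrightarrow> 2 * Re (sf ((dual_map ^^ n) g) u v) \<le> t * (qf h u + qf h v)" by blast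
  from ne obtain u v where uv: "u \<in> C" "v \<in> C" and x: "sf g u v \<noteq> 0" by (auto simp: vanishes_def)
  define x where "x = sf g u v"
  have x0: "cmod x > 0" using x by (simp add: x_def)
  have bd: "cmod lam ^ n * cmod x \<le> t * (qf h u + qf h v) / 2" for n
  proof -
    define w where "w = lam ^ n * x"
    \<comment> \<open>The phase of w, moved to v, makes the value of the iterate real and equal to
      its modulus without changing the h-norm of v.\<close>
    define c where "c = w / complex_of_real (cmod w)"
    have w0: "w \<noteq> 0" using l x0 by (auto simp: w_def)
    have c1: "cmod c = 1" using w0 by (simp add: c_def norm_divide)
    have "cnj c * w = complex_of_real (cmod w)"
      using w0 complex_norm_square[of w] by (simp add: c_def power2_eq_square field_simps)
    then have "Re (sf ((dual_map ^^ n) g) u (c \<cdot>\<^sub>v v)) = cmod w"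
      using uv by (simp add: sform_simps it x_def[symmetric] w_def[symmetric])
    moreover have "qf h (c \<cdot>\<^sub>v v) = qf h v" using uv c1 by (simp add: h_scale)
    ultimately have "2 * cmod w \<le> t * (qf h u + qf h v)" using t[of u "c \<cdot>\<^sub>v v" n] uv by simp
    then show ?thesis by (simp add: w_def norm_mult norm_power)
  qed
  obtain n where "t * (qf h u + qf h v) / 2 / cmod x < cmod lam ^ n" using real_arch_pow[OF l] by blast
  then have "t * (qf h u + qf h v) / 2 < cmod lam ^ n * cmod x" using x0 by (simp add: pos_divide_less_eq)
  with bd[of n] show False by simp
qed

end

section \<open>The transfer matrix\<close>

lemma cscalar_self_zero:
  fixes v :: "complex vec"
  assumes "v \<bullet>c v = 0"
  shows "v = 0\<^sub>v (dim_vec v)"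
proof -
  have "v \<bullet>c v = (\<Sum>i<dim_vec v. v $ i * cnj (v $ i))"
    by (simp add: scalar_prod_def atLeast0LessThan)
  also have "\<dots> = complex_of_real (\<Sum>i<dim_vec v. (cmod (v $ i))\<^sup>2)"
    unfolding of_real_sum by (intro sum.cong refl) (simp only: complex_norm_square)
  finally have "(\<Sum>i<dim_vec v. (cmod (v $ i))\<^sup>2) = 0" using assms by (metis of_real_eq_0_iff)
  then have "\<forall>i<dim_vec v. v $ i = 0" by (subst (asm) sum_nonneg_eq_0_iff) auto
  then show ?thesis by (intro eq_vecI) auto
qed

lemma order_linear_factors:
  "Polynomial.order (a :: complex) (\<Prod>b\<leftarrow>bs. [:- b, 1:]) = count_list bs a"
proof (induction bs)
  case (Cons b bs)
  have "(\<Prod>b\<leftarrow>bs. [:- b, 1 :: complex:]) \<noteq> 0" for bs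
    by (induction bs) (simp, simp only: list.map prod_list.Cons, intro no_zero_divisors, simp_all)
  then have "[:- b, 1:] * (\<Prod>b\<leftarrow>bs. [:- b, 1 :: complex:]) \<noteq> 0" by (intro no_zero_divisors) simp_all
  then have "Polynomial.order a (\<Prod>b\<leftarrow>b # bs. [:- b, 1:]) = Polynomial.order a [:- b, 1:] + Polynomial.order a (\<Prod>b\<leftarrow>bs. [:- b, 1:])"
    unfolding list.map prod_list.Cons by (rule order_mult)
  moreover have "Polynomial.order a [:- b, 1:] = (if b = a then 1 else 0)"
  proof (cases "b = a")
    case True
    then show ?thesis using order_power_n_n[of a 1] by simp
  next
    case False
    then show ?thesis by (simp add: order_0I)
  qed
  ultimately show ?case using Cons.IH by simp
qed simp

text \<open>The Schur decomposition accepts the eigenvalues in any order; this supplies one in which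
  three ones come first.\<close>

lemma three_ones_first:
  assumes "count_list as (1 :: complex) \<ge> 3"
  shows "\<exists>bs. mset as = mset (1 # 1 # 1 # bs)"
proof -
  have "replicate_mset 3 1 \<subseteq># mset as"
    using assms by (simp add: count_mset count_le_replicate_mset_subset_eq[symmetric])
  then obtain M where "mset as = replicate_mset 3 1 + M" by (metis subset_mset.le_iff_add)
  moreover obtain bs where "M = mset bs" by (metis ex_mset)
  ultimately show ?thesis by (intro exI[of _ bs]) (simp add: numeral_3_eq_3)
qed

text \<open>Undoes row-major flattening, in the index convention of
  \<open>kronecker\<close>.\<close>

definition vec_form :: "nat \<Rightarrow> complex vec \<Rightarrow> nat \<times> nat \<Rightarrow> complex" where
  "vec_form D x = (\<lambda>(i, k). x $ (i * D + k))"

lemma pair_index_less: "i < D \<Longrightarrow> k < D \<Longrightarrow> i * D + k < D * (D :: nat)"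
proof -
  assume "i < D" "k < D"
  then have "i * D + k < Suc i * D" by simp
  also have "\<dots> \<le> D * D" using \<open>i < D\<close> by (intro mult_le_mono1) simp
  finally show ?thesis .
qed

lemma sum_square_index: "(\<Sum>p<D * D. f p) = (\<Sum>i<D. \<Sum>k<D. f (i * D + k :: nat))"
  for f :: "nat \<Rightarrow> 'b :: comm_monoid_add"
proof -
  have "(\<Sum>p<D * D. f p) = (\<Sum>i<D. sum f {i * D..<i * D + D})" by (rule sum.nat_group[symmetric])
  also have "\<dots> = (\<Sum>i<D. \<Sum>k<D. f (i * D + k))"
  proof (rule sum.cong[OF refl])
    fix i
    have "sum f {i * D..<i * D + D} = sum f {0 + i * D..<D + i * D}" by (simp add: add.commute)
    also have "\<dots> = (\<Sum>k = 0..<D. f (k + i * D))" by (rule sum.shift_bounds_nat_ivl)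
    finally show "sum f {i * D..<i * D + D} = (\<Sum>k<D. f (i * D + k))" by (simp add: atLeast0LessThan add.commute)
  qed
  finally show ?thesis .
qed

lemma sform_vec_form_lin:
  assumes "x \<in> carrier_vec (D * D)" "y \<in> carrier_vec (D * D)"
  shows "sform D (vec_form D (a \<cdot>\<^sub>v x + b \<cdot>\<^sub>v y)) u v = a * sform D (vec_form D x) u v + b * sform D (vec_form D y) u v"
proof -
  have "sform D (vec_form D (a \<cdot>\<^sub>v x + b \<cdot>\<^sub>v y)) u v = sform D (\<lambda>p. a * vec_form D x p + b * vec_form D y p) u v"
    unfolding sform_def using assms by (intro sum.cong refl) (simp add: vec_form_def pair_index_less)
  then show ?thesis by (simp add: sform_lin)
qed

lemma vec_form_zero:
  assumes x: "x \<in> carrier_vec (D * D)" and z: "\<And>u v. u \<in> carrier_vec D \<Longrightarrow> v \<in> carrier_vec D \<Longrightarrow> sform D (vec_form D x) u v = 0"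
  shows "x = 0\<^sub>v (D * D)"
proof (rule eq_vecI)
  fix p assume "p < dim_vec (0\<^sub>v (D * D) :: complex vec)"
  then have p: "p < D * D" by simp
  then have D: "D > 0" by (cases D) auto
  have d: "p div D < D" "p mod D < D" using p D by (auto simp: less_mult_imp_div_less)
  have "x $ p = sform D (vec_form D x) (unit_vec D (p div D)) (unit_vec D (p mod D))"
    using d by (simp add: sform_unit vec_form_def)
  also have "\<dots> = 0" by (intro z) auto
  finally show "x $ p = 0\<^sub>v (D * D) $ p" using p by simp
qed (use x in simp)

lemma aux_subspace_subsp:
  assumes "aux_subspace D W"
  shows "subsp D W"
proof -
  have "submodule class_ring W (module_vec TYPE(complex) D)"
    using assms by (simp add: VectorSpace.subspace_def)
  then show ?thesis
    unfolding submodule_def subsp_def by (auto simp: module_vec_simps class_ring_simps)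
qed

text \<open>w - P w lies in W and is orthogonal to W, hence to itself.\<close>

lemma projector_fixes:
  assumes P: "orthogonal_projector D W P" and W: "subsp D W" and w: "w \<in> W"
  shows "P *\<^sub>v w = w"
proof -
  have wc: "w \<in> carrier_vec D" using W w subsp_carrier by blast
  have Pw: "P *\<^sub>v w \<in> W" and orth: "\<And>y. y \<in> W \<Longrightarrow> (w - P *\<^sub>v w) \<bullet>c y = 0"
    using P wc by (auto simp: orthogonal_projector_def)
  have Pwc: "P *\<^sub>v w \<in> carrier_vec D" using W Pw subsp_carrier by blast
  have "w - P *\<^sub>v w \<in> W" using W w Pw by (rule subsp_minus)
  moreover have "dim_vec (w - P *\<^sub>v w) = D" using Pwc by (simp only: index_minus_vec carrier_vecD)
  ultimately have "w - P *\<^sub>v w = 0\<^sub>v D" using cscalar_self_zero[OF orth] by metis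
  moreover have "w = P *\<^sub>v w + (w - P *\<^sub>v w)"
    using wc P by (intro eq_vecI) (auto simp: orthogonal_projector_def)
  ultimately show ?thesis using Pwc by (metis right_zero_vec)
qed

context stable_family
begin

text \<open>The transpose of the transfer matrix of A; on flattened forms it acts as
  \<open>dual_map\<close>.\<close>

definition dual_mat :: "complex mat" where
  "dual_mat = mat (D * D) (D * D) (\<lambda>(q, p). \<Sum>i\<in>I. A i $$ (p div D, q div D) * cnj (A i $$ (p mod D, q mod D)))"

lemma dual_mat_carrier: "dual_mat \<in> carrier_mat (D * D) (D * D)"
  by (simp add: dual_mat_def)

lemma dual_mat_entry:
  assumes x: "x \<in> carrier_vec (D * D)" and jl: "j < D" "l < D"
  shows "(dual_mat *\<^sub>v x) $ (j * D + l) = dual_map (vec_form D x) (j, l)"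
proof -
  have dm: "(j * D + l) div D = j" "(j * D + l) mod D = l" if "l < D" for j l using that by auto
  have "(dual_mat *\<^sub>v x) $ (j * D + l) = (\<Sum>p<D * D. dual_mat $$ (j * D + l, p) * x $ p)"
    by (rule mult_vec_entry[OF dual_mat_carrier x pair_index_less[OF jl]])
  also have "\<dots> = (\<Sum>a<D. \<Sum>b<D. dual_mat $$ (j * D + l, a * D + b) * x $ (a * D + b))"
    by (rule sum_square_index)
  also have "\<dots> = (\<Sum>a<D. \<Sum>b<D. \<Sum>i\<in>I. vec_form D x (a, b) * A i $$ (a, j) * cnj (A i $$ (b, l)))"
  proof (intro sum.cong refl)
    fix a b assume "a \<in> {..<D}" "b \<in> {..<D}"
    then have "dual_mat $$ (j * D + l, a * D + b) = (\<Sum>i\<in>I. A i $$ (a, j) * cnj (A i $$ (b, l)))"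
      using jl by (simp add: dual_mat_def pair_index_less dm)
    then show "dual_mat $$ (j * D + l, a * D + b) * x $ (a * D + b) =
      (\<Sum>i\<in>I. vec_form D x (a, b) * A i $$ (a, j) * cnj (A i $$ (b, l)))"
      by (simp add: vec_form_def sum_distrib_left mult.commute mult.left_commute)
  qed
  also have "\<dots> = (\<Sum>a<D. \<Sum>i\<in>I. \<Sum>b<D. vec_form D x (a, b) * A i $$ (a, j) * cnj (A i $$ (b, l)))"
    by (intro sum.cong refl sum.swap)
  also have "\<dots> = (\<Sum>i\<in>I. \<Sum>a<D. \<Sum>b<D. vec_form D x (a, b) * A i $$ (a, j) * cnj (A i $$ (b, l)))"
    by (rule sum.swap)
  finally show ?thesis using jl by (simp add: dual_map_def)
qed

lemma sform_dual_mat: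
  assumes x: "x \<in> carrier_vec (D * D)"
  shows "sf (dual_map (vec_form D x)) u v = sf (vec_form D (dual_mat *\<^sub>v x)) u v"
  unfolding sform_def
proof (intro sum.cong refl)
  fix i k assume "i \<in> {..<D}" "k \<in> {..<D}"
  then show "dual_map (vec_form D x) (i, k) * u $ i * cnj (v $ k) = vec_form D (dual_mat *\<^sub>v x) (i, k) * u $ i * cnj (v $ k)"
    using dual_mat_entry[OF x, of i k] by (simp add: vec_form_def)
qed

lemma eigenvector_eigenform:
  assumes x: "x \<in> carrier_vec (D * D)" and e: "dual_mat *\<^sub>v x = lam \<cdot>\<^sub>v x"
  shows "eigenform (vec_form D x) lam"
proof -
  have "lam \<cdot>\<^sub>v x = lam \<cdot>\<^sub>v x + 0 \<cdot>\<^sub>v x" using x by (intro eq_vecI) auto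
  then have "sf (vec_form D (lam \<cdot>\<^sub>v x)) u v = lam * sf (vec_form D x) u v" for u v
    using sform_vec_form_lin[OF x x, of lam 0 u v] by simp
  then show ?thesis unfolding eigenform_def sform_dual_mat[OF x] e by blast
qed

lemma vanishes_vec_form: "x \<in> carrier_vec (D * D) \<Longrightarrow> vanishes (vec_form D x) \<Longrightarrow> x = 0\<^sub>v (D * D)"
  by (rule vec_form_zero) (auto simp: vanishes_def)

lemma eigenvalue_eigenform:
  assumes "eigenvalue dual_mat lam"
  shows "\<exists>g. eigenform g lam \<and> \<not> vanishes g"
proof -
  from assms obtain x where x: "x \<in> carrier_vec (D * D)" "x \<noteq> 0\<^sub>v (D * D)" "dual_mat *\<^sub>v x = lam \<cdot>\<^sub>v x"
    using dual_mat_carrier by (auto simp: eigenvalue_def eigenvector_def)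
  then show ?thesis using eigenvector_eigenform vanishes_vec_form by blast
qed

text \<open>The fixed vector is the flattened h, nonzero because h is positive on the first unit
  vector.\<close>

lemma eigenvalue_one: "eigenvalue dual_mat 1"
proof -
  define x where "x = vec (D * D) (\<lambda>p. h (p div D, p mod D))"
  have x: "x \<in> carrier_vec (D * D)" by (simp add: x_def)
  have xh: "vec_form D x (i, k) = h (i, k)" if "i < D" "k < D" for i k
    using that by (simp add: vec_form_def x_def pair_index_less)
  have sh: "sf (vec_form D x) u v = sf h u v" for u v
    unfolding sform_def by (intro sum.cong refl) (simp add: xh)
  have "dual_mat *\<^sub>v x - x = 0\<^sub>v (D * D)"
  proof (rule vec_form_zero[where D = D])
    show "dual_mat *\<^sub>v x - x \<in> carrier_vec (D * D)" using dual_mat_carrier x by simp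
    fix u v assume uv: "u \<in> C" "v \<in> C"
    have "dual_mat *\<^sub>v x - x = 1 \<cdot>\<^sub>v (dual_mat *\<^sub>v x) + (-1) \<cdot>\<^sub>v x"
      using dual_mat_carrier x by (intro eq_vecI) auto
    then have "sf (vec_form D (dual_mat *\<^sub>v x - x)) u v = sf (vec_form D (dual_mat *\<^sub>v x)) u v - sf (vec_form D x) u v"
      using sform_vec_form_lin[of "dual_mat *\<^sub>v x" D x 1 "-1" u v] dual_mat_carrier x by simp
    also have "\<dots> = 0"
      unfolding sform_dual_mat[OF x, symmetric] sform_dual[OF uv] sh h_inv[OF uv] by simp
    finally show "sf (vec_form D (dual_mat *\<^sub>v x - x)) u v = 0" .
  qed
  moreover have "dual_mat *\<^sub>v x = x + (dual_mat *\<^sub>v x - x)" using dual_mat_carrier x by (intro eq_vecI) auto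
  ultimately have "dual_mat *\<^sub>v x = 1 \<cdot>\<^sub>v x" using x by simp
  moreover have "x \<noteq> 0\<^sub>v (D * D)"
  proof
    assume "x = 0\<^sub>v (D * D)"
    then have "vec_form D x (0, 0) = 0" using D0 by (simp add: vec_form_def)
    then have "h (0, 0) = 0" using xh[of 0 0] D0 by simp
    moreover have "unit_vec D 0 \<noteq> (0\<^sub>v D :: complex vec)"
      using D0 by (metis index_unit_vec(1) index_zero_vec(1) zero_neq_one)
    ultimately show False using h_pos[of "unit_vec D 0"] D0 by (simp add: sform_unit)
  qed
  ultimately show ?thesis using x dual_mat_carrier by (auto simp: eigenvalue_def eigenvector_def)
qed

lemma no_jordan_vector:
  assumes w: "w \<in> carrier_vec (D * D)" "dual_mat *\<^sub>v w = w" and x: "x \<in> carrier_vec (D * D)" "dual_mat *\<^sub>v x = x + w"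
  shows "w = 0\<^sub>v (D * D)"
proof (rule vanishes_vec_form[OF w(1)], rule no_jordan_chain)
  show "eigenform (vec_form D w) 1" using w by (intro eigenvector_eigenform) auto
  show "sf (dual_map (vec_form D x)) u v = sf (vec_form D x) u v + sf (vec_form D w) u v" for u v
    unfolding sform_dual_mat[OF x(1)] x(2) using sform_vec_form_lin[OF x(1) w(1), of 1 1] by simp
qed

text \<open>Three ones on the diagonal of a Schur form give, in the absence of Jordan chains, three
  independent fixed forms.\<close>

lemma multiplicity_one_le_2: "Polynomial.order 1 (char_poly dual_mat) \<le> 2"
proof (rule ccontr)
  assume gt: "\<not> Polynomial.order 1 (char_poly dual_mat) \<le> 2"
  define n where "n = D * D"
  have M: "dual_mat \<in> carrier_mat n n" using dual_mat_carrier by (simp add: n_def)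
  from char_poly_factorized[OF M] obtain as where as: "char_poly dual_mat = (\<Prod>a\<leftarrow>as. [:- a, 1:])" "length as = n" by blast
  have "count_list as 1 \<ge> 3" using gt unfolding as order_linear_factors by simp
  from three_ones_first[OF this] obtain bs where bs: "mset as = mset (1 # 1 # 1 # bs)" by blast
  let ?es = "1 # 1 # 1 # bs"
  have "prod_mset (mset (map (\<lambda>a. [:- a, 1:]) as)) = prod_mset (mset (map (\<lambda>a. [:- a, 1:]) ?es))"
    using bs by (metis mset_map)
  then have cp: "char_poly dual_mat = (\<Prod>a\<leftarrow>?es. [:- a, 1:])"
    unfolding as prod_mset_prod_list by simp
  have "n = length ?es" using bs as(2) by (metis size_mset)
  then have n3: "n \<ge> 3" by simp
  obtain T P Q where sd: "schur_decomposition dual_mat ?es = (T, P, Q)"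
    by (rule prod_cases3)
  from schur_decomposition[OF M cp sd] have sim: "similar_mat_wit dual_mat T P Q" and up: "upper_triangular T"
    and dg: "diag_mat T = ?es" by auto
  have "n = dim_row dual_mat" using M by simp
  note sw = similar_mat_witD[OF this sim]
  note PQ = sw(1-3) and T = sw(5) and P = sw(6) and Q = sw(7)
  have Td: "T $$ (i, i) = 1" if "i < 3" for i
  proof -
    have "T $$ (i, i) = ?es ! i" using dg that n3 T by (auto simp: diag_mat_def dest!: arg_cong[of _ _ "\<lambda>l. l ! i"])
    also have "\<dots> = 1" using that by (auto simp: less_Suc_eq numeral_3_eq_3)
    finally show ?thesis .
  qed
  have Tl: "T $$ (i, j) = 0" if "j < i" "i < n" for i j using up that T by (auto simp: upper_triangular_def)
  define e where "e j = (unit_vec n j :: complex vec)" for j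
  have ec: "e j \<in> carrier_vec n" for j by (simp add: e_def)
  have Te: "(T *\<^sub>v e j) $ i = T $$ (i, j)" if "i < n" "j < n" for i j using T that by (simp add: e_def)
  \<comment> \<open>The first three columns of P. By triangularity and the ones on the diagonal,
    applying \<open>dual_mat\<close> to one of them adds only a combination of the earlier
    ones.\<close>
  define x where "x j = P *\<^sub>v e j" for j
  have xc: "x j \<in> carrier_vec n" for j using P ec by (simp add: x_def)
  have Mx: "dual_mat *\<^sub>v (P *\<^sub>v y) = P *\<^sub>v (T *\<^sub>v y)" if y: "y \<in> carrier_vec n" for y
  proof -
    have "dual_mat * P = P * T * (Q * P)" using PQ(3) P Q T by (simp add: assoc_mult_mat[of _ n n _ n _ n])
    also have "\<dots> = P * T" unfolding PQ(2) using P T by simp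
    finally have "dual_mat * P = P * T" .
    then show ?thesis using y M P T by (metis assoc_mult_mat_vec)
  qed
  have 0: "T *\<^sub>v e 0 = e 0"
  proof (rule eq_vecI)
    fix i assume "i < dim_vec (e 0)"
    then have "i < n" using ec[of 0] by simp
    then show "(T *\<^sub>v e 0) $ i = e 0 $ i" using Te[of i 0] Td[of 0] Tl[of 0 i] n3 by (cases "i = 0") (auto simp: e_def)
  qed (use T ec[of 0] ec[of 1] ec[of 2] in auto)
  have 1: "T *\<^sub>v e 1 = e 1 + T $$ (0, 1) \<cdot>\<^sub>v e 0"
  proof (rule eq_vecI)
    fix i assume "i < dim_vec (e 1 + T $$ (0, 1) \<cdot>\<^sub>v e 0)"
    then have "i < n" using ec[of 0] by simp
    moreover consider "i = 0" | "i = 1" | "i > 1" by linarith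
    ultimately show "(T *\<^sub>v e 1) $ i = (e 1 + T $$ (0, 1) \<cdot>\<^sub>v e 0) $ i"
      using Te[of i 1] Td[of 1] Tl[of 1 i] n3 by cases (auto simp: e_def)
  qed (use T ec[of 0] ec[of 1] ec[of 2] in auto)
  have 2: "T *\<^sub>v e 2 = e 2 + (T $$ (0, 2) \<cdot>\<^sub>v e 0 + T $$ (1, 2) \<cdot>\<^sub>v e 1)"
  proof (rule eq_vecI)
    fix i assume "i < dim_vec (e 2 + (T $$ (0, 2) \<cdot>\<^sub>v e 0 + T $$ (1, 2) \<cdot>\<^sub>v e 1))"
    then have "i < n" using ec[of 1] by simp
    moreover consider "i = 0" | "i = 1" | "i = 2" | "i > 2" by linarith
    ultimately show "(T *\<^sub>v e 2) $ i = (e 2 + (T $$ (0, 2) \<cdot>\<^sub>v e 0 + T $$ (1, 2) \<cdot>\<^sub>v e 1)) $ i"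
      using Te[of i 2] Td[of 2] Tl[of 2 i] n3 by cases (auto simp: e_def)
  qed (use T ec[of 0] ec[of 1] ec[of 2] in auto)
  have Plin: "P *\<^sub>v (a \<cdot>\<^sub>v e i) = a \<cdot>\<^sub>v x i" for a i unfolding x_def by (rule mult_mat_vec[OF P ec])
  have m0: "dual_mat *\<^sub>v x 0 = x 0" using Mx[OF ec, of 0] 0 by (simp add: x_def)
  have m1': "dual_mat *\<^sub>v x 1 = x 1 + T $$ (0, 1) \<cdot>\<^sub>v x 0"
    unfolding x_def[of 1] Mx[OF ec] 1 using ec by (simp add: mult_add_distrib_mat_vec[OF P] Plin)
  \<comment> \<open>x 0 is fixed, so a nonzero increment here would start a Jordan chain. The same
    argument for x 2 uses that x 0 and x 1 are both fixed.\<close>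
  have "T $$ (0, 1) \<cdot>\<^sub>v x 0 = 0\<^sub>v (D * D)"
    by (rule no_jordan_vector[of _ "x 1"]) (use xc m0 m1' mult_mat_vec[OF M] in \<open>auto simp: n_def\<close>)
  then have m1: "dual_mat *\<^sub>v x 1 = x 1" using m1' xc[of 1] by (simp add: n_def)
  let ?w = "T $$ (0, 2) \<cdot>\<^sub>v x 0 + T $$ (1, 2) \<cdot>\<^sub>v x 1"
  have m2': "dual_mat *\<^sub>v x 2 = x 2 + ?w"
    unfolding x_def[of 2] Mx[OF ec] 2 using ec by (simp add: mult_add_distrib_mat_vec[OF P] Plin)
  have "?w = 0\<^sub>v (D * D)"
  proof (rule no_jordan_vector[of _ "x 2"])
    show "dual_mat *\<^sub>v ?w = ?w"
      using xc by (simp add: mult_add_distrib_mat_vec[OF M] mult_mat_vec[OF M] m0 m1[unfolded One_nat_def])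
  qed (use xc m2' in \<open>auto simp: n_def\<close>)
  then have m2: "dual_mat *\<^sub>v x 2 = x 2" using m2' xc[of 2] by (simp add: n_def)
  have xc': "x j \<in> carrier_vec (D * D)" for j using xc by (simp add: n_def)
  have ef: "eigenform (vec_form D (x j)) 1" if "dual_mat *\<^sub>v x j = x j" for j
    using that xc' by (intro eigenvector_eigenform) auto
  from fixed_forms_dependent[OF ef[OF m0] ef[OF m1] ef[OF m2]] obtain a b c where
    abc: "a \<noteq> 0 \<or> b \<noteq> 0 \<or> c \<noteq> 0" and dep: "\<And>u v. u \<in> C \<Longrightarrow> v \<in> C \<Longrightarrow>
      a * sf (vec_form D (x 0)) u v + b * sf (vec_form D (x 1)) u v + c * sf (vec_form D (x 2)) u v = 0" by blast
  let ?y = "1 \<cdot>\<^sub>v (a \<cdot>\<^sub>v x 0 + b \<cdot>\<^sub>v x 1) + c \<cdot>\<^sub>v x 2"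
  have "?y = 0\<^sub>v (D * D)"
  proof (rule vec_form_zero)
    show "?y \<in> carrier_vec (D * D)" using xc' by simp
    fix u v assume uv: "u \<in> C" "v \<in> C"
    have "sf (vec_form D ?y) u v = 1 * sf (vec_form D (a \<cdot>\<^sub>v x 0 + b \<cdot>\<^sub>v x 1)) u v + c * sf (vec_form D (x 2)) u v"
      by (rule sform_vec_form_lin) (use xc' in auto)
    also have "\<dots> = 0" unfolding sform_vec_form_lin[OF xc' xc'] using dep[OF uv] by simp
    finally show "sf (vec_form D ?y) u v = 0" .
  qed
  then have y0: "a \<cdot>\<^sub>v x 0 + b \<cdot>\<^sub>v x 1 + c \<cdot>\<^sub>v x 2 = 0\<^sub>v n" by (simp add: n_def)
  \<comment> \<open>The dependence among the x j is carried back by Q, the inverse of P, to the unit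
    vectors, where it is impossible.\<close>
  let ?f = "a \<cdot>\<^sub>v e 0 + b \<cdot>\<^sub>v e 1 + c \<cdot>\<^sub>v e 2"
  have fc: "?f \<in> carrier_vec n" using ec by simp
  have "P *\<^sub>v ?f = 0\<^sub>v n" using ec y0 by (simp add: mult_add_distrib_mat_vec[OF P] Plin)
  then have "Q *\<^sub>v (P *\<^sub>v ?f) = 0\<^sub>v n" using Q by (auto intro!: eq_vecI)
  moreover have "Q *\<^sub>v (P *\<^sub>v ?f) = ?f" using assoc_mult_mat_vec[OF Q P fc] PQ(2) fc by simp
  ultimately have f0: "?f = 0\<^sub>v n" by simp
  have "a = 0" "b = 0" "c = 0"
    using arg_cong[OF f0, of "\<lambda>v. v $ 0"] arg_cong[OF f0, of "\<lambda>v. v $ 1"] arg_cong[OF f0, of "\<lambda>v. v $ 2"] n3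
    by (auto simp: e_def)
  with abc show False by simp
qed

text \<open>Bounded iterates keep the eigenvalues in the unit disc, h supplies the eigenvalue 1, and
  eigenvalues of modulus one square to 1. The assumption \<open>no\<close> removes -1, and the
  multiplicity is read off the transpose.\<close>

lemma GNT_criterion:
  assumes H: "labels H = I" and T: "even_tensor H T" "bond T = D" "\<And>i. i \<in> I \<Longrightarrow> amat T i = A i"
    and zT: "\<And>i. i < D \<Longrightarrow> zmat T $$ (i, i) = z i"
    and no: "\<And>g. eigenform g (-1) \<Longrightarrow> vanishes g"
  shows "GNT H T"
proof -
  define E where "E = transfer_mat H T"
  have E: "E \<in> carrier_mat (D * D) (D * D)" using T by (simp add: E_def transfer_mat_def)
  have EM: "E = transpose_mat dual_mat"
  proof (rule eq_matI)
    fix p q assume "p < dim_row (transpose_mat dual_mat)" "q < dim_col (transpose_mat dual_mat)"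
    then have pq: "p < D * D" "q < D * D" using dual_mat_carrier by auto
    have "E $$ (p, q) = (\<Sum>i\<in>I. kronecker (A i) (map_mat cnj (A i)) $$ (p, q))"
      using pq T H by (simp add: E_def transfer_mat_def)
    also have "\<dots> = (\<Sum>i\<in>I. A i $$ (p div D, q div D) * cnj (A i $$ (p mod D, q mod D)))"
    proof (rule sum.cong[OF refl])
      fix i assume i: "i \<in> I"
      have "p mod D < D" "q mod D < D" using D0 by auto
      then show "kronecker (A i) (map_mat cnj (A i)) $$ (p, q) = A i $$ (p div D, q div D) * cnj (A i $$ (p mod D, q mod D))"
        using Ac[OF i] pq by (auto simp: kronecker_def)
    qed
    finally show "E $$ (p, q) = transpose_mat dual_mat $$ (p, q)" using pq by (simp add: dual_mat_def)
  qed (use E dual_mat_carrier in auto)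
  have cp: "char_poly E = char_poly dual_mat" unfolding EM by (rule char_poly_transpose_mat[OF dual_mat_carrier])
  have spec: "spectrum E = Collect (eigenvalue dual_mat)"
    unfolding spectrum_root_char_poly[OF E] cp using eigenvalue_root_char_poly[OF dual_mat_carrier] by auto
  have DD: "D * D > 0" using D0 by simp
  have le1: "cmod e \<le> 1" if "e \<in> spectrum E" for e
    using that eigenvalue_eigenform eigenform_le_1 unfolding spec by blast
  have one: "1 \<in> spectrum E" using eigenvalue_one by (simp add: spec)
  have sr: "spectral_radius E = 1"
  proof (rule antisym)
    from spectral_radius_mem_max(1)[OF E DD] show "spectral_radius E \<le> 1" using le1 by auto
    have "1 \<in> norm ` spectrum E" using one by force
    then show "1 \<le> spectral_radius E" by (rule spectral_radius_mem_max(2)[OF E DD])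
  qed
  have per: "e = 1" if "e \<in> peripheral_spectrum E" for e
  proof -
    have "eigenvalue dual_mat e" "cmod e = 1" using that by (auto simp: peripheral_spectrum_def spec)
    then obtain g where g: "eigenform g e" "\<not> vanishes g" using eigenvalue_eigenform by blast
    have "e * e = 1" using peripheral_eigenform_square[OF g(1) \<open>cmod e = 1\<close> g(2)] .
    then have "e = 1 \<or> e = -1" by (simp add: square_eq_1_iff)
    then show ?thesis using no g by blast
  qed
  have "1 \<in> peripheral_spectrum E" using one by (simp add: peripheral_spectrum_def)
  with per have ps: "peripheral_spectrum E = {1}" by blast
  have "char_poly E \<noteq> 0" using degree_monic_char_poly[OF E] DD by auto
  moreover have "poly (char_poly E) 1 = 0" using one unfolding spectrum_root_char_poly[OF E] by simp
  ultimately have "Polynomial.order 1 (char_poly E) \<noteq> 0" by (simp add: order_root)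
  moreover have "Polynomial.order 1 (char_poly E) \<le> 2" unfolding cp by (rule multiplicity_one_le_2)
  ultimately have "Polynomial.order 1 (char_poly E) \<in> {1, 2}" by auto
  then have pc: "peripheral_count E \<in> {1, 2}" by (simp add: peripheral_count_def ps)
  \<comment> \<open>Commutation of the orthogonal projector with Z is converted into invariance of W
    under Z, the form of gradedness that \<open>irreducible\<close> expects.\<close>
  have irr: "W = {0\<^sub>v D} \<or> W = C" if W: "graded_subspace T W" "invariant_subspace H T W" for W
  proof (rule irreducible)
    from W(1) obtain P where sub: "aux_subspace D W" and P: "orthogonal_projector D W P" and PZ: "P * zmat T = zmat T * P"
      by (auto simp: graded_subspace_def T)
    show Ws: "subsp D W" using sub by (rule aux_subspace_subsp)
    have Zc: "zmat T \<in> carrier_mat D D" and Zd: "diagonal_mat (zmat T)" using T by (auto simp: even_tensor_def)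
    have Pc: "P \<in> carrier_mat D D" using P by (simp add: orthogonal_projector_def)
    have Zv: "zmat T *\<^sub>v v = pact z v" if v: "v \<in> C" for v
    proof (rule eq_vecI)
      fix i assume "i < dim_vec (pact z v)"
      then have i: "i < D" using v by simp
      have "(zmat T *\<^sub>v v) $ i = (\<Sum>k<D. zmat T $$ (i, k) * v $ k)" by (rule mult_vec_entry[OF Zc v i])
      also have "\<dots> = (\<Sum>k<D. if k = i then z i * v $ i else 0)"
        using Zd Zc i by (intro sum.cong) (auto simp: diagonal_mat_def zT)
      also have "\<dots> = pact z v $ i" using i v by simp
      finally show "(zmat T *\<^sub>v v) $ i = pact z v $ i" .
    qed (use Zc v in auto)
    show "pact z w \<in> W" if w: "w \<in> W" for w
    proof -
      have wc: "w \<in> C" using Ws w subsp_carrier by blast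
      have "pact z w = zmat T *\<^sub>v (P *\<^sub>v w)" using projector_fixes[OF P Ws w] Zv[OF wc] by simp
      also have "\<dots> = P *\<^sub>v (zmat T *\<^sub>v w)"
        using assoc_mult_mat_vec[OF Zc Pc wc] assoc_mult_mat_vec[OF Pc Zc wc] PZ by simp
      also have "\<dots> \<in> W" using P Zv[OF wc] wc by (simp add: orthogonal_projector_def)
      finally show ?thesis .
    qed
    show "A i *\<^sub>v w \<in> W" if "i \<in> I" "w \<in> W" for i w
      using W(2) that T(3) H by (auto simp: invariant_subspace_def)
  qed
  show ?thesis unfolding GNT_def E_def[symmetric] T(2)
    using T(1) irr sr pc per by blast
qed

end

section \<open>Blocks and their direct sum\<close>

lemma diag_block_carrier:
  "(\<And>t. t \<in> set ts \<Longrightarrow> f t \<in> carrier_mat (n t) (n t)) \<Longrightarrow>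
    diag_block_mat (map f ts) \<in> carrier_mat (sum_list (map n ts)) (sum_list (map n ts))"
  by (induction ts) (auto simp: Let_def)

lemma diag_block_Cons:
  assumes "\<And>x. x \<in> set (t # ts) \<Longrightarrow> f x \<in> carrier_mat (n x) (n x)"
  shows "diag_block_mat (map f (t # ts)) = four_block_mat (f t) (0\<^sub>m (n t) (sum_list (map n ts)))
    (0\<^sub>m (sum_list (map n ts)) (n t)) (diag_block_mat (map f ts))"
proof -
  have "f t \<in> carrier_mat (n t) (n t)" using assms by simp
  moreover have "diag_block_mat (map f ts) \<in> carrier_mat (sum_list (map n ts)) (sum_list (map n ts))"
    using assms by (intro diag_block_carrier) simp
  ultimately show ?thesis by (simp add: Let_def)
qed

lemma diag_block_mult:
  assumes "\<And>t. t \<in> set ts \<Longrightarrow> f t \<in> carrier_mat (n t) (n t)" "\<And>t. t \<in> set ts \<Longrightarrow> g t \<in> carrier_mat (n t) (n t)"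
  shows "diag_block_mat (map f ts) * diag_block_mat (map g ts) = diag_block_mat (map (\<lambda>t. f t * g t) ts)"
  using assms
proof (induction ts)
  case Nil
  show ?case by (auto intro!: eq_matI)
next
  case (Cons t ts)
  let ?N = "sum_list (map n ts)"
  have f: "f t \<in> carrier_mat (n t) (n t)" "diag_block_mat (map f ts) \<in> carrier_mat ?N ?N"
    using Cons.prems(1) diag_block_carrier[of ts f n] by simp_all
  have g: "g t \<in> carrier_mat (n t) (n t)" "diag_block_mat (map g ts) \<in> carrier_mat ?N ?N"
    using Cons.prems(2) diag_block_carrier[of ts g n] by simp_all
  have fg: "f s * g s \<in> carrier_mat (n s) (n s)" if "s \<in> set (t # ts)" for s using Cons.prems that by (meson mult_carrier_mat)
  have IH: "diag_block_mat (map f ts) * diag_block_mat (map g ts) = diag_block_mat (map (\<lambda>t. f t * g t) ts)"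
    using Cons.prems by (intro Cons.IH) auto
  have h: "f t * g t \<in> carrier_mat (n t) (n t)" "diag_block_mat (map (\<lambda>t. f t * g t) ts) \<in> carrier_mat ?N ?N"
    using fg diag_block_carrier[of ts "\<lambda>t. f t * g t" n] by simp_all
  have "diag_block_mat (map f (t # ts)) * diag_block_mat (map g (t # ts)) =
    four_block_mat (f t) (0\<^sub>m (n t) ?N) (0\<^sub>m ?N (n t)) (diag_block_mat (map f ts)) *
    four_block_mat (g t) (0\<^sub>m (n t) ?N) (0\<^sub>m ?N (n t)) (diag_block_mat (map g ts))"
    using diag_block_Cons[of t ts f n] diag_block_Cons[of t ts g n] Cons.prems by simp
  also have "\<dots> = four_block_mat (f t * g t) (0\<^sub>m (n t) ?N) (0\<^sub>m ?N (n t)) (diag_block_mat (map (\<lambda>t. f t * g t) ts))"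
    by (subst mult_four_block_mat[OF f(1) zero_carrier_mat zero_carrier_mat f(2) g(1) zero_carrier_mat zero_carrier_mat g(2)])
       (use f g h in \<open>simp add: IH\<close>)
  also have "\<dots> = diag_block_mat (map (\<lambda>t. f t * g t) (t # ts))"
    using diag_block_Cons[of t ts "\<lambda>t. f t * g t" n] fg by simp
  finally show ?case .
qed

lemma diag_block_smult:
  fixes f :: "'t \<Rightarrow> complex mat"
  assumes "\<And>t. t \<in> set ts \<Longrightarrow> f t \<in> carrier_mat (n t) (n t)"
  shows "diag_block_mat (map (\<lambda>t. c \<cdot>\<^sub>m f t) ts) = c \<cdot>\<^sub>m diag_block_mat (map f ts)"
  using assms
proof (induction ts)
  case Nil
  show ?case by (auto intro!: eq_matI)
next
  case (Cons t ts)
  let ?N = "sum_list (map n ts)"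
  have f: "f t \<in> carrier_mat (n t) (n t)" "diag_block_mat (map f ts) \<in> carrier_mat ?N ?N"
    using Cons.prems(1) diag_block_carrier[of ts f n] by simp_all
  have cf: "c \<cdot>\<^sub>m f s \<in> carrier_mat (n s) (n s)" if "s \<in> set (t # ts)" for s using Cons.prems[OF that] by simp
  have IH: "diag_block_mat (map (\<lambda>t. c \<cdot>\<^sub>m f t) ts) = c \<cdot>\<^sub>m diag_block_mat (map f ts)"
    using Cons.prems by (intro Cons.IH) auto
  have "diag_block_mat (map (\<lambda>t. c \<cdot>\<^sub>m f t) (t # ts)) =
    four_block_mat (c \<cdot>\<^sub>m f t) (0\<^sub>m (n t) ?N) (0\<^sub>m ?N (n t)) (c \<cdot>\<^sub>m diag_block_mat (map f ts))"
    using diag_block_Cons[of t ts "\<lambda>t. c \<cdot>\<^sub>m f t" n] cf IH by simp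
  also have "\<dots> = c \<cdot>\<^sub>m four_block_mat (f t) (0\<^sub>m (n t) ?N) (0\<^sub>m ?N (n t)) (diag_block_mat (map f ts))"
  proof -
    have "c \<cdot>\<^sub>m 0\<^sub>m a b = 0\<^sub>m a b" for a b by (rule eq_matI) auto
    then show ?thesis by (subst smult_four_block_mat[OF f(1) zero_carrier_mat zero_carrier_mat f(2)]) simp
  qed
  also have "\<dots> = c \<cdot>\<^sub>m diag_block_mat (map f (t # ts))"
    using diag_block_Cons[of t ts f n] Cons.prems by simp
  finally show ?case .
qed

lemma sum_lessThan_add: "(\<Sum>i<a + b. g i) = (\<Sum>i<a. g i) + (\<Sum>i<b. g (a + i :: nat))"
  for g :: "nat \<Rightarrow> 'b :: comm_monoid_add"
  by (induction b) (simp_all add: add.assoc)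

lemma diag_block_trace:
  assumes "\<And>t. t \<in> set ts \<Longrightarrow> f t \<in> carrier_mat (n t) (n t)"
  shows "mat_trace (diag_block_mat (map f ts)) = (\<Sum>t\<leftarrow>ts. mat_trace (f t))"
  using assms
proof (induction ts)
  case Nil
  show ?case by (simp add: mat_trace_def)
next
  case (Cons t ts)
  let ?N = "sum_list (map n ts)" and ?X = "diag_block_mat (map f ts)"
  have f: "f t \<in> carrier_mat (n t) (n t)" "?X \<in> carrier_mat ?N ?N"
    using Cons.prems(1) diag_block_carrier[of ts f n] by simp_all
  let ?Y = "four_block_mat (f t) (0\<^sub>m (n t) ?N) (0\<^sub>m ?N (n t)) ?X"
  have "mat_trace ?Y = (\<Sum>i<n t + ?N. ?Y $$ (i, i))" using f by (simp add: mat_trace_def)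
  also have "\<dots> = (\<Sum>i<n t. ?Y $$ (i, i)) + (\<Sum>i<?N. ?Y $$ (n t + i, n t + i))"
    by (rule sum_lessThan_add)
  also have "\<dots> = mat_trace (f t) + mat_trace ?X"
    using f by (simp add: mat_trace_def)
  also have "mat_trace ?X = (\<Sum>t\<leftarrow>ts. mat_trace (f t))" using Cons.prems by (intro Cons.IH) simp
  finally have "mat_trace ?Y = (\<Sum>t\<leftarrow>t # ts. mat_trace (f t))" by simp
  moreover have "diag_block_mat (map f (t # ts)) = ?Y" using Cons.prems by (intro diag_block_Cons)
  ultimately show ?case by (simp only:)
qed

lemma diag_block_one:
  "diag_block_mat (map (\<lambda>t. 1\<^sub>m (n t)) ts) = 1\<^sub>m (sum_list (map n ts))"
proof (induction ts)
  case (Cons t ts)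
  then show ?case by (simp add: Let_def)
qed (auto intro!: eq_matI)

lemma diag_block_diagonal:
  assumes "\<And>t. t \<in> set ts \<Longrightarrow> f t \<in> carrier_mat (n t) (n t)" "\<And>t. t \<in> set ts \<Longrightarrow> diagonal_mat (f t)"
    "\<And>t i. t \<in> set ts \<Longrightarrow> i < n t \<Longrightarrow> f t $$ (i, i) \<in> S"
  shows "diagonal_mat (diag_block_mat (map f ts)) \<and> (\<forall>i<sum_list (map n ts). diag_block_mat (map f ts) $$ (i, i) \<in> S)"
  using assms
proof (induction ts)
  case Nil
  show ?case by (simp add: diagonal_mat_def)
next
  case (Cons t ts)
  let ?N = "sum_list (map n ts)" and ?X = "diag_block_mat (map f ts)"
  have f: "f t \<in> carrier_mat (n t) (n t)" "?X \<in> carrier_mat ?N ?N"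
    using Cons.prems(1) diag_block_carrier[of ts f n] by simp_all
  have IH: "diagonal_mat ?X \<and> (\<forall>i<?N. ?X $$ (i, i) \<in> S)" using Cons.prems by (intro Cons.IH) auto
  have e: "diag_block_mat (map f (t # ts)) = four_block_mat (f t) (0\<^sub>m (n t) ?N) (0\<^sub>m ?N (n t)) ?X"
    using Cons.prems(1) by (intro diag_block_Cons)
  have d: "diagonal_mat (f t)" "\<And>i. i < n t \<Longrightarrow> f t $$ (i, i) \<in> S" using Cons.prems by auto
  show ?case
  proof (intro conjI allI impI, unfold e)
    show "diagonal_mat (four_block_mat (f t) (0\<^sub>m (n t) ?N) (0\<^sub>m ?N (n t)) ?X)"
      unfolding diagonal_mat_def using f IH d by (auto simp: diagonal_mat_def)
    fix i assume "i < sum_list (map n (t # ts))"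
    then show "four_block_mat (f t) (0\<^sub>m (n t) ?N) (0\<^sub>m ?N (n t)) ?X $$ (i, i) \<in> S"
      using f IH d by auto
  qed
qed

section \<open>Even tensors and their word matrices\<close>

definition parity_matrix :: "nat \<Rightarrow> (nat \<Rightarrow> complex) \<Rightarrow> complex mat" where
  "parity_matrix d y = mat d d (\<lambda>(i, j). if i = j then y i else 0)"

lemma parity_matrix_mult:
  assumes "M \<in> carrier_mat d d" "i < d" "j < d"
  shows "(parity_matrix d y * M) $$ (i, j) = y i * M $$ (i, j)" "(M * parity_matrix d y) $$ (i, j) = M $$ (i, j) * y j"
proof -
  have Z: "parity_matrix d y \<in> carrier_mat d d" by (simp add: parity_matrix_def)
  have "(parity_matrix d y * M) $$ (i, j) = (\<Sum>k<d. if k = i then y i * M $$ (i, j) else 0)"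
    unfolding mult_mat_entry[OF Z assms] using assms by (intro sum.cong) (auto simp: parity_matrix_def)
  then show "(parity_matrix d y * M) $$ (i, j) = y i * M $$ (i, j)" using assms by simp
  have "(M * parity_matrix d y) $$ (i, j) = (\<Sum>k<d. if k = j then M $$ (i, j) * y j else 0)"
    unfolding mult_mat_entry[OF assms(1) Z assms(2,3)] using assms by (intro sum.cong) (auto simp: parity_matrix_def)
  then show "(M * parity_matrix d y) $$ (i, j) = M $$ (i, j) * y j" using assms by simp
qed

lemma zmat_eq_parity_matrix:
  assumes "even_tensor H T"
  shows "zmat T = parity_matrix (bond T) (\<lambda>i. zmat T $$ (i, i))"
  using assms by (intro eq_matI) (auto simp: even_tensor_def parity_matrix_def diagonal_mat_def)

lemma even_tensor_entries:
  assumes T: "even_tensor H T" and n: "n \<in> labels H" and ij: "i < bond T" "j < bond T"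
  shows "zmat T $$ (i, i) * amat T n $$ (i, j) = (-1) ^ grade H n * (amat T n $$ (i, j) * zmat T $$ (j, j))"
proof -
  have A: "amat T n \<in> carrier_mat (bond T) (bond T)" and
    eq: "zmat T * amat T n = (-1) ^ grade H n \<cdot>\<^sub>m (amat T n * zmat T)"
    using T n by (auto simp: even_tensor_def)
  have Z: "zmat T \<in> carrier_mat (bond T) (bond T)" using T by (simp add: even_tensor_def)
  have "(zmat T * amat T n) $$ (i, j) = zmat T $$ (i, i) * amat T n $$ (i, j)"
    by (subst zmat_eq_parity_matrix[OF T]) (rule parity_matrix_mult[OF A ij])
  moreover have "(amat T n * zmat T) $$ (i, j) = amat T n $$ (i, j) * zmat T $$ (j, j)"
    by (subst zmat_eq_parity_matrix[OF T]) (rule parity_matrix_mult[OF A ij])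
  moreover have "((-1) ^ grade H n \<cdot>\<^sub>m (amat T n * zmat T)) $$ (i, j) = (-1) ^ grade H n * (amat T n * zmat T) $$ (i, j)"
    using A Z ij by (subst index_smult_mat) auto
  ultimately show ?thesis unfolding eq by metis
qed

lemma even_tensorI:
  assumes "d \<ge> 1" "parity d y" "\<And>n. n \<in> labels H \<Longrightarrow> f n \<in> carrier_mat d d"
    "\<And>n i j. n \<in> labels H \<Longrightarrow> i < d \<Longrightarrow> j < d \<Longrightarrow> y i * f n $$ (i, j) = (-1) ^ grade H n * (f n $$ (i, j) * y j)"
  shows "even_tensor H \<lparr>bond = d, amat = f, zmat = parity_matrix d y\<rparr>"
  unfolding even_tensor_def
proof (intro conjI ballI allI impI)
  fix n assume n: "n \<in> labels H"
  have Z: "parity_matrix d y \<in> carrier_mat d d" by (simp add: parity_matrix_def)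
  show "zmat \<lparr>bond = d, amat = f, zmat = parity_matrix d y\<rparr> * amat \<lparr>bond = d, amat = f, zmat = parity_matrix d y\<rparr> n =
    (- 1) ^ grade H n \<cdot>\<^sub>m (amat \<lparr>bond = d, amat = f, zmat = parity_matrix d y\<rparr> n * zmat \<lparr>bond = d, amat = f, zmat = parity_matrix d y\<rparr>)"
    unfolding tensor.simps
  proof (rule eq_matI)
    fix i j assume "i < dim_row ((- 1) ^ grade H n \<cdot>\<^sub>m (f n * parity_matrix d y))"
      "j < dim_col ((- 1) ^ grade H n \<cdot>\<^sub>m (f n * parity_matrix d y))"
    then have ij: "i < d" "j < d" using Z assms(3)[OF n] by auto
    have "((- 1) ^ grade H n \<cdot>\<^sub>m (f n * parity_matrix d y)) $$ (i, j) = (- 1) ^ grade H n * (f n * parity_matrix d y) $$ (i, j)"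
      using ij Z assms(3)[OF n] by (subst index_smult_mat) auto
    then show "(parity_matrix d y * f n) $$ (i, j) = ((- 1) ^ grade H n \<cdot>\<^sub>m (f n * parity_matrix d y)) $$ (i, j)"
      unfolding parity_matrix_mult[OF assms(3)[OF n] ij] using assms(4)[OF n ij] by simp
  qed (use Z assms(3)[OF n] in auto)
qed (use assms in \<open>auto simp: parity_matrix_def parity_def diagonal_mat_def\<close>)

lemma word_mat_Nil [simp]: "word_mat T [] = 1\<^sub>m (bond T)"
  by (simp add: word_mat_def)

lemma word_mat_Cons [simp]: "word_mat T (n # w) = amat T n * word_mat T w"
  by (simp add: word_mat_def)

lemma word_mat_carrier:
  assumes "even_tensor H T" "set w \<subseteq> labels H"
  shows "word_mat T w \<in> carrier_mat (bond T) (bond T)"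
  using assms(2)
proof (induction w)
  case (Cons n w)
  then have "amat T n \<in> carrier_mat (bond T) (bond T)" using assms(1) by (simp add: even_tensor_def)
  then show ?case using Cons by simp
qed simp

lemma word_mat_append:
  assumes T: "even_tensor H T" and v: "set v \<subseteq> labels H" and w: "set w \<subseteq> labels H"
  shows "word_mat T (v @ w) = word_mat T v * word_mat T w"
  using v
proof (induction v)
  case Nil
  then show ?case using word_mat_carrier[OF T w] by simp
next
  case (Cons n v)
  then have "amat T n \<in> carrier_mat (bond T) (bond T)" using T by (simp add: even_tensor_def)
  then show ?case using Cons word_mat_carrier[OF T w] word_mat_carrier[OF T, of v] by simp
qed

text \<open>The starting point of the decomposition, valid for every k; each letter contributes its
  own sign.\<close>

lemma word_mat_word_family:
  assumes T: "even_tensor H T"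
  shows "word_family H k (bond T) (\<lambda>i. zmat T $$ (i, i)) (word_mat T)"
  unfolding word_family_def
proof (intro conjI ballI allI impI)
  let ?z = "\<lambda>i. zmat T $$ (i, i)"
  show "parity (bond T) ?z" using T by (simp add: even_tensor_def parity_def)
  fix w assume "w \<in> lwords H k"
  then have w: "set w \<subseteq> labels H" by (simp add: lwords_def)
  show "word_mat T w \<in> carrier_mat (bond T) (bond T)" by (rule word_mat_carrier[OF T w])
  fix i j assume ij: "i < bond T" "j < bond T"
  show "?z i * word_mat T w $$ (i, j) = (- 1) ^ word_parity H w * (word_mat T w $$ (i, j) * ?z j)"
    using w ij
  proof (induction w arbitrary: i)
    case Nil
    then show ?case by (simp add: word_parity_def)
  next
    case (Cons n w)
    have n: "n \<in> labels H" and w: "set w \<subseteq> labels H" using Cons.prems by auto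
    have A: "amat T n \<in> carrier_mat (bond T) (bond T)" using T n by (simp add: even_tensor_def)
    let ?s = "(- 1) ^ grade H n :: complex" and ?s' = "(- 1) ^ word_parity H w :: complex"
    have "?z i * (amat T n $$ (i, k) * word_mat T w $$ (k, j)) = ?s * ?s' * ((amat T n $$ (i, k) * word_mat T w $$ (k, j)) * ?z j)"
      if k: "k < bond T" for k
    proof -
      have "?z i * (amat T n $$ (i, k) * word_mat T w $$ (k, j)) = ?z i * amat T n $$ (i, k) * word_mat T w $$ (k, j)" by simp
      also have "\<dots> = ?s * amat T n $$ (i, k) * (?z k * word_mat T w $$ (k, j))"
        unfolding even_tensor_entries[OF T n Cons.prems(2) k] by simp
      also have "\<dots> = ?s * ?s' * ((amat T n $$ (i, k) * word_mat T w $$ (k, j)) * ?z j)"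
        unfolding Cons.IH[OF w k Cons.prems(3)] by simp
      finally show ?thesis .
    qed
    then have "(\<Sum>k<bond T. ?z i * (amat T n $$ (i, k) * word_mat T w $$ (k, j))) =
      (\<Sum>k<bond T. ?s * ?s' * ((amat T n $$ (i, k) * word_mat T w $$ (k, j)) * ?z j))" by (intro sum.cong) auto
    then show ?case
      unfolding word_mat_Cons mult_mat_entry[OF A word_mat_carrier[OF T w] Cons.prems(2,3)]
      by (simp add: word_parity_def power_add sum_distrib_left sum_distrib_right)
  qed
qed (use T in \<open>auto simp: lwords_def word_mat_append\<close>)

section \<open>Words over the blocked alphabet and normal blocks\<close>

lemma finite_words: "graded_space H \<Longrightarrow> finite (words H N)"
  unfolding words_def graded_space_def by (intro finite_lists_length_eq) blast

lemma words_subset_lwords: "k dvd N \<Longrightarrow> words H N \<subseteq> lwords H k"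
  by (auto simp: words_def lwords_def)

lemma sum_words_add:
  "(\<Sum>w\<in>words H (a + b). f w) = (\<Sum>v\<in>words H a. \<Sum>w\<in>words H b. f (v @ w))"
proof -
  have "(\<Sum>v\<in>words H a. \<Sum>w\<in>words H b. f (v @ w)) = (\<Sum>p\<in>words H a \<times> words H b. f (fst p @ snd p))"
    by (simp add: sum.cartesian_product case_prod_beta)
  also have "\<dots> = (\<Sum>w\<in>words H (a + b). f w)"
    by (rule sum.reindex_bij_witness[where i = "\<lambda>w. (take a w, drop a w)" and j = "\<lambda>p. fst p @ snd p"])
      (auto simp: words_def dest: in_set_takeD in_set_dropD)
  finally show ?thesis ..
qed

lemma smult_mat_vec: "A \<in> carrier_mat m n \<Longrightarrow> v \<in> carrier_vec n \<Longrightarrow> (c \<cdot>\<^sub>m A) *\<^sub>v v = c \<cdot>\<^sub>v (A *\<^sub>v v)"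
  for A :: "complex mat"
  by (intro eq_vecI) (auto simp: scalar_prod_def sum_distrib_left mult.assoc)

text \<open>Translates between the locale, whose letters are the words of length k, and the word
  family, which sees only the concatenation; each block contributes one factor c.\<close>

lemma word_act_scaled:
  assumes B: "word_family H k e y B" and ws: "set ws \<subseteq> words H k" and u: "u \<in> carrier_vec e"
  shows "concat ws \<in> lwords H k \<and> word_act (\<lambda>w. c \<cdot>\<^sub>m B w) ws u = c ^ length ws \<cdot>\<^sub>v (B (concat ws) *\<^sub>v u)"
  using ws
proof (induction ws)
  case Nil
  then show ?case using B u by (simp add: word_act_def lwords_def word_family_def)
next
  case (Cons w ws)
  then have IH: "concat ws \<in> lwords H k" "word_act (\<lambda>w. c \<cdot>\<^sub>m B w) ws u = c ^ length ws \<cdot>\<^sub>v (B (concat ws) *\<^sub>v u)"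
    by auto
  have w: "w \<in> lwords H k" using Cons.prems words_subset_lwords[of k k H] by auto
  have Bw: "B w \<in> carrier_mat e e" "B (concat ws) \<in> carrier_mat e e" "B (w @ concat ws) = B w * B (concat ws)"
    using B w IH(1) by (auto simp: word_family_def)
  have x: "B (concat ws) *\<^sub>v u \<in> carrier_vec e" using Bw(2) u by (rule mult_mat_vec_carrier)
  have "word_act (\<lambda>w. c \<cdot>\<^sub>m B w) (w # ws) u = (c \<cdot>\<^sub>m B w) *\<^sub>v (c ^ length ws \<cdot>\<^sub>v (B (concat ws) *\<^sub>v u))"
    using IH(2) by (simp add: word_act_def)
  also have "\<dots> = c \<cdot>\<^sub>v (c ^ length ws \<cdot>\<^sub>v (B w *\<^sub>v (B (concat ws) *\<^sub>v u)))"
    using x by (subst smult_mat_vec[OF Bw(1)]) (auto simp: mult_mat_vec[OF Bw(1) x])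
  also have "\<dots> = c ^ length (w # ws) \<cdot>\<^sub>v (B (concat (w # ws)) *\<^sub>v u)"
    unfolding smult_smult_assoc using Bw u by (simp add: assoc_mult_mat_vec[OF Bw(1,2) u])
  finally show ?case using lwords_append[OF w IH(1)] by simp
qed

lemma words_split:
  assumes "k \<ge> 1" "w \<in> words H (m * k)"
  shows "\<exists>ws. set ws \<subseteq> words H k \<and> length ws = m \<and> concat ws = w"
  using assms(2)
proof (induction m arbitrary: w)
  case 0
  then show ?case by (intro exI[of _ "[]"]) (simp add: words_def)
next
  case (Suc m)
  then have "drop k w \<in> words H (m * k)" "take k w \<in> words H k"
    by (auto simp: words_def dest: in_set_takeD in_set_dropD)
  from Suc.IH[OF this(1)] obtain ws where "set ws \<subseteq> words H k" "length ws = m" "concat ws = drop k w" by blast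
  then show ?case using \<open>take k w \<in> words H k\<close> by (intro exI[of _ "take k w # ws"]) simp
qed

text \<open>A nonzero factor does not affect which subspaces are invariant, and m letters of the
  blocked alphabet are exactly a word of length m * k.\<close>

lemma stable_scaled:
  assumes B: "word_family H k e y B" and st: "stable_words H k e y B" and k: "k \<ge> 1" and c: "c \<noteq> 0"
    and m: "m \<ge> 1" and U: "subsp e U" and Uz: "\<And>u. u \<in> U \<Longrightarrow> pact y u \<in> U"
    and inv: "\<And>ws u. set ws \<subseteq> words H k \<Longrightarrow> length ws = m \<Longrightarrow> u \<in> U \<Longrightarrow> word_act (\<lambda>w. c \<cdot>\<^sub>m B w) ws u \<in> U"
  shows "U = {0\<^sub>v e} \<or> U = carrier_vec e"
proof -
  have "B w *\<^sub>v u \<in> U" if w: "w \<in> words H (m * k)" and u: "u \<in> U" for w u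
  proof -
    from words_split[OF k w] obtain ws where ws: "set ws \<subseteq> words H k" "length ws = m" "concat ws = w" by blast
    have uc: "u \<in> carrier_vec e" using U u subsp_carrier by blast
    have "c ^ m \<cdot>\<^sub>v (B w *\<^sub>v u) \<in> U" using inv[OF ws(1,2) u] word_act_scaled[OF B ws(1) uc, of c] ws by simp
    then have "(1 / c ^ m) \<cdot>\<^sub>v (c ^ m \<cdot>\<^sub>v (B w *\<^sub>v u)) \<in> U" using U by (simp add: subsp_smult)
    then show ?thesis using c by (simp add: smult_smult_assoc)
  qed
  moreover have "m * k \<ge> 1" using m k by simp
  ultimately show ?thesis using st U Uz unfolding stable_words_def by (metis dvd_triv_right)
qed

lemma minus_one_power_mod_2: "(-1 :: complex) ^ (n mod 2) = (-1) ^ n"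
  by (cases "even n") (auto simp: even_iff_mod_2_eq_zero odd_iff_mod_2_eq_one)

lemma subsp_1:
  assumes U: "subsp 1 U"
  shows "U = {0\<^sub>v 1} \<or> U = carrier_vec 1"
proof (cases "\<exists>u\<in>U. u \<noteq> 0\<^sub>v 1")
  case True
  then obtain u where u: "u \<in> U" "u \<noteq> 0\<^sub>v 1" by blast
  have uc: "u \<in> carrier_vec 1" using U u subsp_carrier by blast
  have u0: "u $ 0 \<noteq> 0"
  proof
    assume "u $ 0 = 0"
    then have "u = 0\<^sub>v 1" using uc by (intro eq_vecI) auto
    with u show False by simp
  qed
  have "v \<in> U" if v: "v \<in> carrier_vec 1" for v
  proof -
    have "v = (v $ 0 / u $ 0) \<cdot>\<^sub>v u" using uc v u0 by (intro eq_vecI) auto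
    then show ?thesis using subsp_smult[OF U u(1)] by metis
  qed
  moreover have "U \<subseteq> carrier_vec 1" using U by (simp add: subsp_def)
  ultimately show ?thesis by blast
qed (use subsp_zero[OF U] in blast)

text \<open>An eigenform for -1 of the doubled family (words of length 2 k) would yield an eigenform for
  i or -i of the family itself, whose eigenvalues of modulus one square to 1.\<close>

lemma summand_GNT:
  fixes H :: "'n graded_space"
  assumes H: "graded_space H" and k: "k \<ge> 1" and e: "e \<ge> 1"
    and B: "word_family H k e y B" and st: "stable_words H k e y B"
    and nz: "\<exists>w\<in>words H k. B w \<noteq> 0\<^sub>m e e"
  shows "\<exists>r. r > 0 \<and> GNT (block_space (2 * k) H)
    \<lparr>bond = e, amat = (\<lambda>w. complex_of_real (1 / r) \<cdot>\<^sub>m B w), zmat = parity_matrix e y\<rparr>"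
proof -
  define I where "I = words H k"
  define I2 where "I2 = words H (2 * k)"
  define s where "s w = (-1 :: complex) ^ word_parity H w" for w
  have Il: "I \<subseteq> lwords H k" and I2l: "I2 \<subseteq> lwords H k"
    unfolding I_def I2_def by (rule words_subset_lwords, simp)+
  have y: "parity e y" using B by (simp add: word_family_def)
  have Bc: "B w \<in> carrier_mat e e" if "w \<in> lwords H k" for w using B that by (simp add: word_family_def)
  have Bg: "y a * B w $$ (a, b) = s w * (B w $$ (a, b) * y b)" if "w \<in> lwords H k" "a < e" "b < e" for w a b
    using B that by (simp add: word_family_def s_def)
  have Bm: "B (v @ w) = B v * B w" if "v \<in> lwords H k" "w \<in> lwords H k" for v w
    using B that by (simp add: word_family_def)
  have s1: "s w \<in> {1, -1}" for w unfolding s_def by (cases "even (word_parity H w)") auto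
  have fin: "finite I" "finite I2" using finite_words[OF H] by (simp_all add: I_def I2_def)
  interpret S0: graded_family I B y s e
  proof unfold_locales
    show "B w \<in> carrier_mat e e" if "w \<in> I" for w using Bc that Il by blast
    show "y a * B w $$ (a, b) = s w * (B w $$ (a, b) * y b)" if "w \<in> I" "a < e" "b < e" for w a b
      using Bg that Il by blast
    show "\<exists>w\<in>I. B w \<noteq> 0\<^sub>m e e" using nz by (simp add: I_def)
  qed (use fin e y s1 in auto)
  have irr: "U = {0\<^sub>v e} \<or> U = carrier_vec e"
    if U: "subsp e U" "\<And>u. u \<in> U \<Longrightarrow> pact y u \<in> U" "\<And>w u. w \<in> I \<Longrightarrow> u \<in> U \<Longrightarrow> B w *\<^sub>v u \<in> U" for U
    using st[unfolded stable_words_def, rule_format, OF k dvd_refl, of U] U by (auto simp: I_def)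
  from S0.perron_form[OF irr] obtain r h where r: "r > 0" and h: "hermitian_form e h" "even_form e y h"
    "\<And>u. u \<in> carrier_vec e \<Longrightarrow> u \<noteq> 0\<^sub>v e \<Longrightarrow> qform e h u > 0"
    and hB: "\<And>u v. u \<in> carrier_vec e \<Longrightarrow> v \<in> carrier_vec e \<Longrightarrow>
      (\<Sum>w\<in>I. sform e h (B w *\<^sub>v u) (B w *\<^sub>v v)) = complex_of_real r * sform e h u v" by blast
  \<comment> \<open>This factor on words of length k makes h invariant. A word of length 2 k carries
    it twice, which is the coefficient 1 / r of the final tensor.\<close>
  define c where "c = complex_of_real (1 / sqrt r)"
  have c0: "c \<noteq> 0" and cc: "c * c = complex_of_real (1 / r)" "cnj c = c"
    using r by (simp_all add: c_def of_real_mult[symmetric] del: of_real_mult)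
  define A1 where "A1 w = c \<cdot>\<^sub>m B w" for w
  define A2 where "A2 w = (c * c) \<cdot>\<^sub>m B w" for w
  have act1: "A1 w *\<^sub>v u = c \<cdot>\<^sub>v (B w *\<^sub>v u)" if "w \<in> lwords H k" "u \<in> carrier_vec e" for w u
    unfolding A1_def by (rule smult_mat_vec[OF Bc[OF that(1)] that(2)])
  have act2: "A2 w *\<^sub>v u = (c * c) \<cdot>\<^sub>v (B w *\<^sub>v u)" if "w \<in> lwords H k" "u \<in> carrier_vec e" for w u
    unfolding A2_def by (rule smult_mat_vec[OF Bc[OF that(1)] that(2)])
  have Bv: "B w *\<^sub>v u \<in> carrier_vec e" if "w \<in> lwords H k" "u \<in> carrier_vec e" for w u
    using Bc[OF that(1)] that(2) by (rule mult_mat_vec_carrier)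
  have A1v: "A1 w *\<^sub>v u \<in> carrier_vec e" if "w \<in> lwords H k" "u \<in> carrier_vec e" for w u
    using Bv that by (simp add: act1)
  have A21: "A2 (v @ w) *\<^sub>v u = A1 v *\<^sub>v (A1 w *\<^sub>v u)" if v: "v \<in> I" and w: "w \<in> I" and u: "u \<in> carrier_vec e" for v w u
  proof -
    have vw: "v \<in> lwords H k" "w \<in> lwords H k" using v w Il by auto
    have "A1 v *\<^sub>v (A1 w *\<^sub>v u) = c \<cdot>\<^sub>v (B v *\<^sub>v (c \<cdot>\<^sub>v (B w *\<^sub>v u)))"
      using vw u Bv by (simp add: act1)
    also have "B v *\<^sub>v (c \<cdot>\<^sub>v (B w *\<^sub>v u)) = c \<cdot>\<^sub>v (B v *\<^sub>v (B w *\<^sub>v u))"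
      by (rule mult_mat_vec[OF Bc[OF vw(1)] Bv[OF vw(2) u]])
    also have "B v *\<^sub>v (B w *\<^sub>v u) = B (v @ w) *\<^sub>v u"
      unfolding Bm[OF vw] by (rule assoc_mult_mat_vec[symmetric, OF Bc[OF vw(1)] Bc[OF vw(2)] u])
    finally show ?thesis using act2[OF lwords_append[OF vw] u] by (simp add: smult_smult_assoc)
  qed
  \<comment> \<open>The dual map of the doubled family is the square of the dual map of the family
    itself.\<close>
  have sum2: "(\<Sum>w\<in>I2. sform e g (A2 w *\<^sub>v u) (A2 w *\<^sub>v v)) =
    (\<Sum>a\<in>I. \<Sum>b\<in>I. sform e g (A1 a *\<^sub>v (A1 b *\<^sub>v u)) (A1 a *\<^sub>v (A1 b *\<^sub>v v)))"
    if uv: "u \<in> carrier_vec e" "v \<in> carrier_vec e" for g u v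
    unfolding I2_def mult_2 sum_words_add I_def[symmetric]
    using uv by (intro sum.cong refl) (simp add: A21)
  have h1: "(\<Sum>w\<in>I. sform e h (A1 w *\<^sub>v u) (A1 w *\<^sub>v v)) = sform e h u v"
    if uv: "u \<in> carrier_vec e" "v \<in> carrier_vec e" for u v
  proof -
    have "(\<Sum>w\<in>I. sform e h (A1 w *\<^sub>v u) (A1 w *\<^sub>v v)) = (\<Sum>w\<in>I. c * c * sform e h (B w *\<^sub>v u) (B w *\<^sub>v v))"
    proof (rule sum.cong[OF refl])
      fix w assume "w \<in> I"
      then have "w \<in> lwords H k" using Il by blast
      then show "sform e h (A1 w *\<^sub>v u) (A1 w *\<^sub>v v) = c * c * sform e h (B w *\<^sub>v u) (B w *\<^sub>v v)"
        using uv by (simp add: act1 Bv sform_simps cc(2))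
    qed
    also have "\<dots> = c * c * (complex_of_real r * sform e h u v)"
      unfolding sum_distrib_left[symmetric] hB[OF uv] ..
    also have "\<dots> = sform e h u v" unfolding cc(1) using r by simp
    finally show ?thesis .
  qed
  have h2: "(\<Sum>w\<in>I2. sform e h (A2 w *\<^sub>v u) (A2 w *\<^sub>v v)) = sform e h u v"
    if uv: "u \<in> carrier_vec e" "v \<in> carrier_vec e" for u v
  proof -
    have "(\<Sum>w\<in>I2. sform e h (A2 w *\<^sub>v u) (A2 w *\<^sub>v v)) =
      (\<Sum>b\<in>I. \<Sum>a\<in>I. sform e h (A1 a *\<^sub>v (A1 b *\<^sub>v u)) (A1 a *\<^sub>v (A1 b *\<^sub>v v)))"
      unfolding sum2[OF uv] by (rule sum.swap)
    also have "\<dots> = (\<Sum>b\<in>I. sform e h (A1 b *\<^sub>v u) (A1 b *\<^sub>v v))"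
      using Il uv by (intro sum.cong refl h1 A1v) auto
    also have "\<dots> = sform e h u v" by (rule h1[OF uv])
    finally show ?thesis .
  qed
  have cm_zero: "B w = 0\<^sub>m e e" if "w \<in> lwords H k" "x \<cdot>\<^sub>m B w = 0\<^sub>m e e" "x \<noteq> 0" for w x
  proof (rule eq_matI)
    fix i j assume ij: "i < dim_row (0\<^sub>m e e :: complex mat)" "j < dim_col (0\<^sub>m e e :: complex mat)"
    have "x * B w $$ (i, j) = (x \<cdot>\<^sub>m B w) $$ (i, j)" using Bc[OF that(1)] ij by simp
    also have "\<dots> = 0" unfolding that(2) using ij by simp
    finally show "B w $$ (i, j) = 0\<^sub>m e e $$ (i, j)" using that(3) ij by simp
  qed (use Bc[OF that(1)] in auto)
  have nz1: "\<exists>w\<in>I. A1 w \<noteq> 0\<^sub>m e e"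
    using nz cm_zero[OF _ _ c0] Il unfolding A1_def I_def by blast
  \<comment> \<open>Products of nonzero matrices may vanish; here invariance of the definite form h
    under A2 prevents that from happening for all words.\<close>
  have nz2: "\<exists>w\<in>I2. A2 w \<noteq> 0\<^sub>m e e"
  proof (rule ccontr)
    assume "\<not> ?thesis"
    then have z: "A2 w = 0\<^sub>m e e" if "w \<in> I2" for w using that by blast
    let ?u = "unit_vec e 0 :: complex vec"
    have "(\<Sum>w\<in>I2. sform e h (A2 w *\<^sub>v ?u) (A2 w *\<^sub>v ?u)) = 0"
      using e by (intro sum.neutral ballI) (simp add: z sform_def)
    then have "sform e h ?u ?u = 0" using h2[of ?u ?u] by simp
    moreover have "?u \<noteq> 0\<^sub>v e"
    proof
      assume "?u = 0\<^sub>v e"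
      then have "?u $ 0 = 0\<^sub>v e $ 0" by (rule arg_cong)
      then show False using e by simp
    qed
    ultimately show False using h(3)[of ?u] by simp
  qed
  have gs: "y a * (x \<cdot>\<^sub>m B w) $$ (a, b) = s w * ((x \<cdot>\<^sub>m B w) $$ (a, b) * y b)"
    if "w \<in> lwords H k" "a < e" "b < e" for w a b x
  proof -
    have "(x \<cdot>\<^sub>m B w) $$ (a, b) = x * B w $$ (a, b)" using Bc[OF that(1)] that by simp
    then show ?thesis using Bg[OF that] by (simp only: mult.left_commute[of _ x] mult.assoc)
  qed
  have k2: "2 * k \<ge> 1" "k dvd 2 * k" using k by auto
  note B2 = word_family_mono[OF B k2(2)] and st2 = stable_words_mono[OF st k2(2)]
  interpret S1: stable_family I A1 y s e h
  proof unfold_locales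
    show "U = {0\<^sub>v e} \<or> U = carrier_vec e"
      if "m \<ge> 1" "subsp e U" "\<And>u. u \<in> U \<Longrightarrow> pact y u \<in> U"
        "\<And>w u. set w \<subseteq> I \<Longrightarrow> length w = m \<Longrightarrow> u \<in> U \<Longrightarrow> word_act A1 w u \<in> U" for m U
      using that unfolding A1_def I_def by (rule stable_scaled[OF B st k c0])
    show "A1 w \<in> carrier_mat e e" if "w \<in> I" for w using Bc that Il by (auto simp: A1_def)
    show "y a * A1 w $$ (a, b) = s w * (A1 w $$ (a, b) * y b)" if "w \<in> I" "a < e" "b < e" for w a b
      unfolding A1_def using gs that Il by blast
  qed (use fin e y s1 nz1 h h1 in auto)
  interpret S2: stable_family I2 A2 y s e h
  proof unfold_locales
    have cc0: "c * c \<noteq> 0" using c0 by simp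
    show "U = {0\<^sub>v e} \<or> U = carrier_vec e"
      if "m \<ge> 1" "subsp e U" "\<And>u. u \<in> U \<Longrightarrow> pact y u \<in> U"
        "\<And>w u. set w \<subseteq> I2 \<Longrightarrow> length w = m \<Longrightarrow> u \<in> U \<Longrightarrow> word_act A2 w u \<in> U" for m U
      using that unfolding A2_def I2_def by (rule stable_scaled[OF B2 st2 k2(1) cc0])
    show "A2 w \<in> carrier_mat e e" if "w \<in> I2" for w using Bc that I2l by (auto simp: A2_def)
    show "y a * A2 w $$ (a, b) = s w * (A2 w $$ (a, b) * y b)" if "w \<in> I2" "a < e" "b < e" for w a b
      unfolding A2_def using gs that I2l by blast
  qed (use fin e y s1 nz2 h h2 in auto)
  have no: "S2.vanishes g" if g: "S2.eigenform g (-1)" for g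
  proof -
    let ?d = S1.dual_map
    have dd: "sform e (?d (?d g)) u v = - sform e g u v" if uv: "u \<in> carrier_vec e" "v \<in> carrier_vec e" for u v
    proof -
      have "sform e (?d (?d g)) u v = (\<Sum>b\<in>I. \<Sum>a\<in>I. sform e g (A1 a *\<^sub>v (A1 b *\<^sub>v u)) (A1 a *\<^sub>v (A1 b *\<^sub>v v)))"
        unfolding S1.sform_dual[OF uv] using uv by (intro sum.cong refl S1.sform_dual S1.Av)
      also have "\<dots> = (\<Sum>w\<in>I2. sform e g (A2 w *\<^sub>v u) (A2 w *\<^sub>v v))"
        unfolding sum2[OF uv] by (rule sum.swap)
      also have "\<dots> = - sform e g u v" using S2.eigenformD[OF g uv] by simp
      finally show ?thesis .
    qed
    \<comment> \<open>With d the dual map, d d g = - g factors as (d - \<i>) (d + \<i>) g = 0. So g'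
      = (d + \<i>) g is an eigenform for \<i> and vanishes, whence g is an eigenform for - \<i> and
      vanishes too.\<close>
    define g' where "g' = (\<lambda>p. 1 * ?d g p + \<i> * g p)"
    have g'f: "sform e g' u v = sform e (?d g) u v + \<i> * sform e g u v" for u v
      unfolding g'_def sform_lin by simp
    have eg': "S1.eigenform g' \<i>"
      unfolding S1.eigenform_def
    proof (intro ballI)
      fix u v :: "complex vec" assume uv: "u \<in> carrier_vec e" "v \<in> carrier_vec e"
      have "sform e (?d g') u v = sform e (?d (?d g)) u v + \<i> * sform e (?d g) u v"
        unfolding S1.sform_dual[OF uv] g'f sum.distrib sum_distrib_left ..
      then show "sform e (?d g') u v = \<i> * sform e g' u v"
        unfolding g'f dd[OF uv] by (simp add: algebra_simps)
    qed
    have v': "S1.vanishes g'"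
    proof (rule ccontr)
      assume "\<not> S1.vanishes g'"
      from S1.peripheral_eigenform_square[OF eg' _ this] show False by simp
    qed
    have eg: "S1.eigenform g (- \<i>)"
      unfolding S1.eigenform_def
    proof (intro ballI)
      fix u v :: "complex vec" assume uv: "u \<in> carrier_vec e" "v \<in> carrier_vec e"
      have "sform e (?d g) u v + \<i> * sform e g u v = 0"
        using v' uv unfolding S1.vanishes_def g'f by blast
      then show "sform e (?d g) u v = - \<i> * sform e g u v" by (simp add: eq_neg_iff_add_eq_0)
    qed
    have "S1.vanishes g"
    proof (rule ccontr)
      assume "\<not> S1.vanishes g"
      from S1.peripheral_eigenform_square[OF eg _ this] show False by simp
    qed
    then show ?thesis unfolding S1.vanishes_def S2.vanishes_def .
  qed
  let ?T = "\<lparr>bond = e, amat = (\<lambda>w. complex_of_real (1 / r) \<cdot>\<^sub>m B w), zmat = parity_matrix e y\<rparr>"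
  have "GNT (block_space (2 * k) H) ?T"
  proof (rule S2.GNT_criterion)
    show "labels (block_space (2 * k) H) = I2" by (simp add: block_space_def I2_def)
    show "even_tensor (block_space (2 * k) H) ?T"
    proof (rule even_tensorI[OF e y])
      fix w assume "w \<in> labels (block_space (2 * k) H)"
      then have w: "w \<in> lwords H k" using I2l by (auto simp: block_space_def I2_def)
      show "complex_of_real (1 / r) \<cdot>\<^sub>m B w \<in> carrier_mat e e" using Bc[OF w] by simp
      fix i j assume "i < e" "j < e"
      from gs[OF w this] show "y i * (complex_of_real (1 / r) \<cdot>\<^sub>m B w) $$ (i, j) =
        (- 1) ^ grade (block_space (2 * k) H) w * ((complex_of_real (1 / r) \<cdot>\<^sub>m B w) $$ (i, j) * y j)"
        by (simp only: block_space_def graded_space.simps minus_one_power_mod_2 word_parity_def[symmetric] s_def)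
    qed
    show "amat ?T w = A2 w" if "w \<in> I2" for w by (simp add: A2_def cc)
    show "zmat ?T $$ (i, i) = y i" if "i < e" for i using that by (simp add: parity_matrix_def)
  qed (use no in auto)
  then show ?thesis using r by blast
qed


section \<open>Weighted blocks and assembly of the canonical form\<close>

definition rescale :: "complex \<Rightarrow> 'n tensor \<Rightarrow> 'n tensor" where
  "rescale \<mu> T = T\<lparr>amat := (\<lambda>n. \<mu> \<cdot>\<^sub>m amat T n)\<rparr>"

lemma rescale_simps [simp]:
  "bond (rescale \<mu> T) = bond T" "zmat (rescale \<mu> T) = zmat T" "amat (rescale \<mu> T) n = \<mu> \<cdot>\<^sub>m amat T n"
  by (simp_all add: rescale_def)

lemma smult_smult_mat: "a \<cdot>\<^sub>m (b \<cdot>\<^sub>m M) = (a * b) \<cdot>\<^sub>m M" for M :: "complex mat"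
  by (rule eq_matI) auto

lemma even_rescale:
  assumes T: "even_tensor H T"
  shows "even_tensor H (rescale \<mu> T)"
proof -
  have "zmat T * (\<mu> \<cdot>\<^sub>m amat T n) = (- 1) ^ grade H n \<cdot>\<^sub>m (\<mu> \<cdot>\<^sub>m amat T n * zmat T)" if n: "n \<in> labels H" for n
  proof -
    have A: "amat T n \<in> carrier_mat (bond T) (bond T)" and Z: "zmat T \<in> carrier_mat (bond T) (bond T)"
      and eq: "zmat T * amat T n = (-1) ^ grade H n \<cdot>\<^sub>m (amat T n * zmat T)"
      using T n by (auto simp: even_tensor_def)
    show ?thesis
      unfolding mult_smult_distrib[OF Z A] mult_smult_assoc_mat[OF A Z] eq smult_smult_mat by (simp add: mult.commute)
  qed
  then show ?thesis using T by (auto simp: even_tensor_def)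
qed

lemma GNT_even: "GNT H T \<Longrightarrow> even_tensor H T"
  by (simp add: GNT_def)

text \<open>A vanishing summand receives the coefficient 0 and, as a placeholder block, the one-dimensional
  family supported on the powers of a single letter; it is even because k is.\<close>

lemma summand_block:
  fixes H :: "'n graded_space"
  assumes H: "graded_space H" and k: "k \<ge> 1" "even k" and e: "e \<ge> 1"
    and B: "word_family H k e y B" and st: "stable_words H k e y B"
  shows "\<exists>t. GNT (block_space (2 * k) H) (snd t) \<and>
    (\<forall>ws. ws \<noteq> [] \<longrightarrow> set ws \<subseteq> words H (2 * k) \<longrightarrow>
      mat_trace (word_mat (rescale (fst t) (snd t)) ws) = mat_trace (B (concat ws)))"
proof (cases "\<exists>w\<in>words H k. B w \<noteq> 0\<^sub>m e e")
  case True
  from summand_GNT[OF H k(1) e B st True] obtain r where r: "r > 0" and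
    G: "GNT (block_space (2 * k) H) \<lparr>bond = e, amat = (\<lambda>w. complex_of_real (1 / r) \<cdot>\<^sub>m B w), zmat = parity_matrix e y\<rparr>"
    (is "GNT _ ?T") by blast
  let ?R = "rescale (complex_of_real r) ?T"
  have R: "amat ?R w = B w" for w using r by (simp add: smult_smult_mat) (auto intro!: eq_matI)
  have l: "words H (2 * k) \<subseteq> lwords H k" by (rule words_subset_lwords) simp
  have wm: "concat ws \<in> lwords H k \<and> word_mat ?R ws = B (concat ws)" if "set ws \<subseteq> words H (2 * k)" for ws
    using that
  proof (induction ws)
    case Nil
    then show ?case using B by (simp add: word_family_def lwords_def)
  next
    case (Cons w ws)
    then have w: "w \<in> lwords H k" "concat ws \<in> lwords H k" and IH: "word_mat ?R ws = B (concat ws)" using l by auto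
    have "word_mat ?R (w # ws) = B w * B (concat ws)" unfolding word_mat_Cons R IH ..
    then show ?case using B w lwords_append[OF w] by (simp add: word_family_def)
  qed
  have "GNT (block_space (2 * k) H) (snd (complex_of_real r, ?T)) \<and>
    (\<forall>ws. ws \<noteq> [] \<longrightarrow> set ws \<subseteq> words H (2 * k) \<longrightarrow>
      mat_trace (word_mat (rescale (fst (complex_of_real r, ?T)) (snd (complex_of_real r, ?T))) ws) = mat_trace (B (concat ws)))"
    unfolding fst_conv snd_conv using G wm by simp
  then show ?thesis by (rule exI)
next
  case False
  then have Bz: "B w = 0\<^sub>m e e" if "w \<in> words H k" for w using that by blast
  obtain n0 where n0: "n0 \<in> labels H" using H by (auto simp: graded_space_def)
  define B0 where "B0 w = (if set w \<subseteq> {n0} then 1\<^sub>m 1 else 0\<^sub>m 1 1 :: complex mat)" for w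
  have par: "(-1 :: complex) ^ word_parity H w = 1" if "w \<in> lwords H k" "set w \<subseteq> {n0}" for w
  proof -
    have "w = replicate (length w) n0" using that(2) by (metis replicate_eqI singletonD subsetD)
    then obtain m where w: "w = replicate m n0" by blast
    have "word_parity H w = m * grade H n0" by (simp add: w word_parity_def sum_list_replicate)
    moreover have "even m" using that(1) k(2) by (auto simp: lwords_def w)
    ultimately show ?thesis by simp
  qed
  have B0: "word_family H k 1 (\<lambda>_. 1) B0"
    unfolding word_family_def
  proof (intro conjI ballI allI impI)
    show "B0 w \<in> carrier_mat 1 1" for w by (simp add: B0_def)
    show "1 * B0 w $$ (i, j) = (- 1) ^ word_parity H w * (B0 w $$ (i, j) * 1)"
      if "w \<in> lwords H k" "i < 1" "j < 1" for w i j
      using par[OF that(1)] that by (auto simp: B0_def)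
    show "B0 (v @ w) = B0 v * B0 w" for v w by (auto simp: B0_def)
  qed (auto simp: parity_def B0_def)
  have st0: "stable_words H k 1 (\<lambda>_. 1) B0" unfolding stable_words_def using subsp_1 by blast
  have "replicate k n0 \<in> words H k" using n0 by (auto simp: words_def)
  moreover have "B0 (replicate k n0) \<noteq> 0\<^sub>m 1 1"
  proof
    assume "B0 (replicate k n0) = 0\<^sub>m 1 1"
    moreover have "B0 (replicate k n0) = 1\<^sub>m 1" by (auto simp: B0_def)
    ultimately have "(1\<^sub>m 1 :: complex mat) = 0\<^sub>m 1 1" by simp
    from arg_cong[OF this, of "\<lambda>M. M $$ (0, 0)"] show False by simp
  qed
  ultimately have "\<exists>w\<in>words H k. B0 w \<noteq> 0\<^sub>m 1 1" by blast
  from summand_GNT[OF H k(1) le_refl B0 st0 this] obtain T where G: "GNT (block_space (2 * k) H) (T :: 'n list tensor)"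
    by blast
  have "mat_trace (word_mat (rescale 0 T) ws) = mat_trace (B (concat ws))"
    if ne: "ws \<noteq> []" and ws: "set ws \<subseteq> words H (2 * k)" for ws
  proof -
    obtain w vs where wv: "ws = w # vs" using ne by (cases ws) auto
    have w: "w \<in> words H (2 * k)" and vs: "set vs \<subseteq> words H (2 * k)" using ws wv by auto
    have A: "amat T w \<in> carrier_mat (bond T) (bond T)"
      using GNT_even[OF G] w by (simp add: even_tensor_def block_space_def)
    have V: "word_mat (rescale 0 T) vs \<in> carrier_mat (bond T) (bond T)"
      using word_mat_carrier[OF even_rescale[OF GNT_even[OF G]], of vs 0] vs by (simp add: block_space_def)
    have "0 \<cdot>\<^sub>m amat T w = 0\<^sub>m (bond T) (bond T)" using A by (intro eq_matI) auto
    then have l0: "mat_trace (word_mat (rescale 0 T) ws) = 0" using V wv by (simp add: mat_trace_def)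
    \<comment> \<open>B is known to vanish only on words of length exactly k, so half of the first
      letter of length 2 k is split off.\<close>
    define x where "x = take k w"
    define u where "u = drop k w @ concat vs"
    have x: "x \<in> words H k" and dk: "drop k w \<in> words H k"
      using w by (auto simp: x_def words_def dest: in_set_takeD in_set_dropD)
    have cl: "concat vs \<in> lwords H k" if "set vs \<subseteq> words H (2 * k)" for vs
      using that
    proof (induction vs)
      case (Cons v vs)
      then have "v \<in> lwords H k" using words_subset_lwords[of k "2 * k" H] by auto
      then show ?case using Cons lwords_append[of v H k "concat vs"] by simp
    qed (simp add: lwords_def)
    have xl: "x \<in> lwords H k" "drop k w \<in> lwords H k" using x dk words_subset_lwords[of k k H] by auto
    have ul: "u \<in> lwords H k" unfolding u_def using xl(2) cl[OF vs] by (rule lwords_append)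
    have "concat ws = x @ u" by (simp add: wv x_def u_def)
    then have "B (concat ws) = B x * B u" using B xl(1) ul by (simp add: word_family_def)
    moreover have "B u \<in> carrier_mat e e" using B ul by (simp add: word_family_def)
    ultimately have "B (concat ws) = 0\<^sub>m e e" using Bz[OF x] by simp
    then show ?thesis using l0 by (simp add: mat_trace_def)
  qed
  then have "GNT (block_space (2 * k) H) (snd (0, T)) \<and>
    (\<forall>ws. ws \<noteq> [] \<longrightarrow> set ws \<subseteq> words H (2 * k) \<longrightarrow>
      mat_trace (word_mat (rescale (fst (0, T)) (snd (0, T))) ws) = mat_trace (B (concat ws)))"
    using G by simp
  then show ?thesis by (rule exI)
qed

definition tensor_sum :: "(complex \<times> 'n tensor) list \<Rightarrow> 'n tensor" where
  "tensor_sum ts = \<lparr>bond = sum_list (map (\<lambda>t. bond (snd t)) ts),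
     amat = (\<lambda>n. diag_block_mat (map (\<lambda>t. fst t \<cdot>\<^sub>m amat (snd t) n) ts)),
     zmat = diag_block_mat (map (\<lambda>t. zmat (snd t)) ts)\<rparr>"

lemma even_tensor_sum:
  assumes ts: "ts \<noteq> []" and ev: "\<And>t. t \<in> set ts \<Longrightarrow> even_tensor H (snd t)"
  shows "even_tensor H (tensor_sum ts)"
proof -
  let ?n = "\<lambda>t. bond (snd t)"
  let ?N = "sum_list (map ?n ts)"
  have Zc: "zmat (snd t) \<in> carrier_mat (?n t) (?n t)" "diagonal_mat (zmat (snd t))"
    "\<And>i. i < ?n t \<Longrightarrow> zmat (snd t) $$ (i, i) \<in> {1, -1}" "?n t \<ge> 1" if "t \<in> set ts" for t
    using ev[OF that] by (auto simp: even_tensor_def)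
  have Ac: "fst t \<cdot>\<^sub>m amat (snd t) n \<in> carrier_mat (?n t) (?n t)" if "n \<in> labels H" "t \<in> set ts" for n t
    using ev[OF that(2)] that(1) by (simp add: even_tensor_def)
  have N: "?N \<ge> 1"
  proof -
    obtain t where t: "t \<in> set ts" using ts by (cases ts) auto
    then have "?n t \<le> ?N" by (intro member_le_sum_list) auto
    then show ?thesis using Zc(4)[OF t] by linarith
  qed
  have Z: "diag_block_mat (map (\<lambda>t. zmat (snd t)) ts) \<in> carrier_mat ?N ?N"
    by (rule diag_block_carrier) (rule Zc(1))
  have "diag_block_mat (map (\<lambda>t. zmat (snd t)) ts) * diag_block_mat (map (\<lambda>t. fst t \<cdot>\<^sub>m amat (snd t) n) ts) =
    (- 1) ^ grade H n \<cdot>\<^sub>m (diag_block_mat (map (\<lambda>t. fst t \<cdot>\<^sub>m amat (snd t) n) ts) * diag_block_mat (map (\<lambda>t. zmat (snd t)) ts))"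
    if n: "n \<in> labels H" for n
  proof -
    let ?A = "\<lambda>t. fst t \<cdot>\<^sub>m amat (snd t) n" and ?Z = "\<lambda>t. zmat (snd t)"
    have "diag_block_mat (map ?Z ts) * diag_block_mat (map ?A ts) = diag_block_mat (map (\<lambda>t. ?Z t * ?A t) ts)"
      by (rule diag_block_mult[where n = ?n]) (use Zc Ac n in auto)
    also have "map (\<lambda>t. ?Z t * ?A t) ts = map (\<lambda>t. (- 1) ^ grade H n \<cdot>\<^sub>m (?A t * ?Z t)) ts"
    proof (rule map_cong[OF refl])
      fix t assume "t \<in> set ts"
      from even_rescale[OF ev[OF this], of "fst t"] n
      show "?Z t * ?A t = (- 1) ^ grade H n \<cdot>\<^sub>m (?A t * ?Z t)" by (simp add: even_tensor_def)
    qed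
    also have "diag_block_mat (map (\<lambda>t. (- 1) ^ grade H n \<cdot>\<^sub>m (?A t * ?Z t)) ts) =
      (- 1) ^ grade H n \<cdot>\<^sub>m diag_block_mat (map (\<lambda>t. ?A t * ?Z t) ts)"
      by (rule diag_block_smult[where n = ?n]) (use Zc(1) Ac[OF n] in \<open>meson mult_carrier_mat\<close>)
    also have "diag_block_mat (map (\<lambda>t. ?A t * ?Z t) ts) = diag_block_mat (map ?A ts) * diag_block_mat (map ?Z ts)"
      by (rule diag_block_mult[where n = ?n, symmetric]) (use Zc Ac n in auto)
    finally show ?thesis .
  qed
  moreover have "diagonal_mat (diag_block_mat (map (\<lambda>t. zmat (snd t)) ts)) \<and>
    (\<forall>i<?N. diag_block_mat (map (\<lambda>t. zmat (snd t)) ts) $$ (i, i) \<in> {1, -1})"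
    by (rule diag_block_diagonal[where n = ?n]) (use Zc in auto)
  moreover have "diag_block_mat (map (\<lambda>t. fst t \<cdot>\<^sub>m amat (snd t) n) ts) \<in> carrier_mat ?N ?N" if "n \<in> labels H" for n
    by (rule diag_block_carrier) (rule Ac[OF that])
  ultimately show ?thesis unfolding even_tensor_def tensor_sum_def tensor.simps using N Z by blast
qed

lemma word_mat_tensor_sum:
  assumes ev: "\<And>t. t \<in> set ts \<Longrightarrow> even_tensor H (snd t)" and w: "set w \<subseteq> labels H"
  shows "word_mat (tensor_sum ts) w = diag_block_mat (map (\<lambda>t. word_mat (rescale (fst t) (snd t)) w) ts)"
  using w
proof (induction w)
  case Nil
  show ?case by (simp add: tensor_sum_def diag_block_one[where n = "\<lambda>t. bond (snd t)"])
next
  case (Cons n w)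
  have IH: "word_mat (tensor_sum ts) w = diag_block_mat (map (\<lambda>t. word_mat (rescale (fst t) (snd t)) w) ts)"
    using Cons by simp
  have "word_mat (tensor_sum ts) (n # w) = diag_block_mat (map (\<lambda>t. fst t \<cdot>\<^sub>m amat (snd t) n) ts) *
    diag_block_mat (map (\<lambda>t. word_mat (rescale (fst t) (snd t)) w) ts)"
    unfolding word_mat_Cons IH by (simp add: tensor_sum_def)
  also have "\<dots> = diag_block_mat (map (\<lambda>t. fst t \<cdot>\<^sub>m amat (snd t) n * word_mat (rescale (fst t) (snd t)) w) ts)"
  proof (rule diag_block_mult[where n = "\<lambda>t. bond (snd t)"])
    fix t assume t: "t \<in> set ts"
    show "fst t \<cdot>\<^sub>m amat (snd t) n \<in> carrier_mat (bond (snd t)) (bond (snd t))"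
      using ev[OF t] Cons.prems by (simp add: even_tensor_def)
    show "word_mat (rescale (fst t) (snd t)) w \<in> carrier_mat (bond (snd t)) (bond (snd t))"
      using word_mat_carrier[OF even_rescale[OF ev[OF t]], of w "fst t"] Cons.prems by simp
  qed
  finally show ?case by simp
qed

lemma word_mat_block_tensor:
  assumes T: "even_tensor H T" and ws: "set ws \<subseteq> words H k"
  shows "set (concat ws) \<subseteq> labels H \<and> word_mat (block_tensor T) ws = word_mat T (concat ws)"
  using ws
proof (induction ws)
  case Nil
  show ?case by (simp add: block_tensor_def)
next
  case (Cons w ws)
  then have "set w \<subseteq> labels H" "set (concat ws) \<subseteq> labels H" "word_mat (block_tensor T) ws = word_mat T (concat ws)"
    by (auto simp: words_def)
  then show ?case using word_mat_append[OF T, of w "concat ws"] by (simp add: block_tensor_def)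
qed

theorem mainTheorem5:
  fixes H :: "'n graded_space" and T :: "'n tensor"
  assumes "graded_space H" and "even_tensor H T"
  shows "\<exists>k\<ge>1. \<exists>G :: 'n list tensor.
           even_tensor (block_space k H) G \<and> GCF (block_space k H) G \<and>
           (\<forall>N\<ge>1. fMPS (block_space k H) G N = fMPS (block_space k H) (block_tensor T) N)"
proof -
  note H = assms(1) and T = assms(2)
  have "bond T \<ge> 1" using T by (simp add: even_tensor_def)
  \<comment> \<open>Starting from block length 2 makes the resulting k even, as
    \<open>summand_block\<close> demands.\<close>
  from stable_decomposition[OF this _ word_mat_word_family[OF T], of 2]
  obtain k bs where k: "k \<ge> 1" "even k" and bs: "stable_summands H k (word_mat T) bs" by auto
  \<comment> \<open>The stable decomposition is found at length k; the doubling is the one that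
    removes the eigenvalue -1 from every block.\<close>
  let ?H = "block_space (2 * k) H"
  let ?R = "\<lambda>b t. GNT ?H (snd t) \<and> (\<forall>ws. ws \<noteq> [] \<longrightarrow> set ws \<subseteq> words H (2 * k) \<longrightarrow>
      mat_trace (word_mat (rescale (fst t) (snd t)) ws) = mat_trace (snd (snd b) (concat ws)))"
  have "\<forall>b\<in>set bs. \<exists>t. ?R b t"
  proof
    fix b assume b: "b \<in> set bs"
    obtain e y B where eyB: "b = (e, y, B)" by (cases b)
    from stable_summandsD[OF bs b[unfolded eyB]] summand_block[OF H k]
    show "\<exists>t. ?R b t" unfolding eyB snd_conv by blast
  qed
  from bchoice[OF this] obtain F where F: "\<And>b. b \<in> set bs \<Longrightarrow> ?R b (F b)" by blast
  define ts where "ts = map F bs"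
  define G where "G = tensor_sum ts"
  have gnt: "GNT ?H (snd t)" if "t \<in> set ts" for t using that F by (auto simp: ts_def)
  then have ev: "even_tensor ?H (snd t)" if "t \<in> set ts" for t using that GNT_even by blast
  have ne: "ts \<noteq> []" using bs by (simp add: ts_def stable_summands_def)
  have eG: "even_tensor ?H G" unfolding G_def by (rule even_tensor_sum[OF ne ev])
  have "GCF ?H G"
    unfolding GCF_def
  proof (intro conjI exI[of _ ts] eG)
    show "\<forall>(\<mu>, B)\<in>set ts. GNT ?H B" using gnt by (auto simp: case_prod_beta)
  qed (simp_all add: G_def tensor_sum_def case_prod_unfold)
  moreover have "fMPS ?H G N = fMPS ?H (block_tensor T) N" if N: "N \<ge> 1" for N
  proof
    fix ws
    show "fMPS ?H G N ws = fMPS ?H (block_tensor T) N ws"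
    proof (cases "ws \<in> words ?H N")
      case True
      then have ws: "set ws \<subseteq> words H (2 * k)" "ws \<noteq> []" using N by (auto simp: words_def block_space_def)
      then have wl: "set ws \<subseteq> labels ?H" by (simp add: block_space_def)
      have c: "concat ws \<in> lwords H k"
      proof -
        have "k dvd length (concat ws)" using ws(1)
          by (induction ws) (auto simp: words_def)
        then show ?thesis using word_mat_block_tensor[OF T ws(1)] by (simp add: lwords_def)
      qed
      have tc: "word_mat (rescale (fst t) (snd t)) ws \<in> carrier_mat (bond (snd t)) (bond (snd t))" if "t \<in> set ts" for t
        using word_mat_carrier[OF even_rescale[OF ev[OF that]] wl, of "fst t"] by simp
      have "mat_trace (word_mat G ws) = (\<Sum>t\<leftarrow>ts. mat_trace (word_mat (rescale (fst t) (snd t)) ws))"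
      proof -
        have "word_mat G ws = diag_block_mat (map (\<lambda>t. word_mat (rescale (fst t) (snd t)) ws) ts)"
          unfolding G_def by (rule word_mat_tensor_sum[OF ev wl])
        then show ?thesis by (simp only:) (rule diag_block_trace[where n = "\<lambda>t. bond (snd t)"], rule tc)
      qed
      also have "\<dots> = (\<Sum>b\<leftarrow>bs. mat_trace (snd (snd b) (concat ws)))"
        unfolding ts_def map_map o_def using F ws by (intro arg_cong[where f = sum_list] map_cong) auto
      also have "\<dots> = mat_trace (word_mat T (concat ws))"
        using stable_summands_trace[OF bs c] by (simp add: case_prod_unfold)
      also have "\<dots> = mat_trace (word_mat (block_tensor T) ws)"
        using word_mat_block_tensor[OF T ws(1)] by simp
      finally show ?thesis by (simp add: fMPS_def True)
    qed (simp add: fMPS_def)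
  qed
  ultimately show ?thesis using eG k(1) by (intro exI[of _ "2 * k"]) auto
qed

end
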